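(* The model $\mathscr{D}$ is fully abstract for PCF, i.e. for all PCF programs (closed PCF terms) $P,P'$ of type $\alpha$: $\mathcal{I}_\alpha(P)=\mathcal{I}_\alpha(P')$ if and only if $P\equiv_{\mathrm{obs}}P'$.
   Context: PCF is Plotkin's language (call-by-name weak head reduction $\to_{\sf PCF}$, simple types over the ground type $\mathsf{int}$). Observational equivalence: $P\equiv_{\mathrm{obs}}P'$ iff for every PCF context $C[\cdot]$ of result type $\mathsf{int}$ (closing both), $C[P]\twoheadrightarrow_{\sf PCF}\underline n \iff C[P']\twoheadrightarrow_{\sf PCF}\underline n$. Extended addressing machines (EAMs) are tuples $\langle R_0,\dots,R_r,P,T\rangle$ (registers, program, input tape of addresses) over a countable set $\mathbb{A}$ of addresses containing $\mathbb{N}$; a bijective address table map $\#$ assigns an address to every EAM, with $\#(\mathsf{n})=n$ for the numeral machine $\mathsf n$; $\mathsf M@[a_1,\dots,a_k]$ appends $a_1,\dots,a_k$ to the tape of $\mathsf M$, and application of addresses is $a\cdot b=\#(\#^{-1}(a)@[b])$. EAMs have a deterministic reduction $\to_{\mathsf c}$ and a simple type system with judgements $\mathsf M:\alpha$. There is a compositional translation $\mathrm{Tr}_{\vec x}(M)$ sending each PCF (or EPCF, i.e. PCF with closed explicit substitutions) term with free variables among $\vec x=x_1,\dots,x_n$ to an EAM that reads the values of $x_1,\dots,x_n$ from its input tape ($\mathrm{Tr}(M)$ for $n=0$); it is type-preserving. Let $\mathcal D_\alpha=\{a\in\mathbb A\mid \#^{-1}(a):\alpha\}$ and define the logical relation on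 EAMs of type $\alpha$: $\mathsf M\equiv_{\mathsf{int}}\mathsf N$ iff for all $n$, $\mathsf M\twoheadrightarrow_{\mathsf c}\mathsf n\iff \mathsf N\twoheadrightarrow_{\mathsf c}\mathsf n$; $\mathsf M\equiv_{\alpha\to\beta}\mathsf N$ iff for all $a,b\in\mathcal D_\alpha$ with $\#^{-1}(a)\equiv_\alpha\#^{-1}(b)$, $\mathsf M@[a]\equiv_\beta \mathsf N@[b]$; write $a\simeq_\alpha b$ for $\#^{-1}(a)\equiv_\alpha\#^{-1}(b)$. The model $\mathscr{D}$ has carriers $\mathcal D_\alpha/{\simeq_\alpha}$, application $[a]\cdot[b]=[a\cdot b]$, and interpretation $\mathcal{I}_{\beta_1\to\cdots\to\beta_n\to\alpha}(x_1{:}\beta_1,\dots,x_n{:}\beta_n\vdash P:\alpha)=[\#\mathrm{Tr}_{\vec x}(P)]_{\simeq_{\beta_1\to\cdots\to\beta_n\to\alpha}}$; for closed $P$ of type $\alpha$ this is $\mathcal I_\alpha(P)=[\#\mathrm{Tr}(P)]_{\simeq_\alpha}$. *)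

theory Defs
  imports "HOL-Library.Countable"
begin

section \<open>PCF\<close>

datatype ty = TInt | Arr ty ty (infixr "\<rightarrow>" 200)

abbreviation arrs :: "ty list \<Rightarrow> ty \<Rightarrow> ty" where
  "arrs \<beta>s \<alpha> \<equiv> foldr Arr \<beta>s \<alpha>"

text \<open>Terms up to renaming of bound variables, as de Bruijn terms: \<open>Var i\<close> refers to the
  \<open>i\<close>-th enclosing binder, counting from 0 outwards.\<close>

datatype tm =
    Var nat
  | App tm tm
  | Lam tm
  | Zero
  | Pred tm
  | Succ tm
  | Ifz tm tm tm
  | Fix tm

primrec lift :: "nat \<Rightarrow> tm \<Rightarrow> tm" where
  "lift k (Var i) = (if i < k then Var i else Var (Suc i))"
| "lift k (App P Q) = App (lift k P) (lift k Q)"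
| "lift k (Lam P) = Lam (lift (Suc k) P)"
| "lift k Zero = Zero"
| "lift k (Pred P) = Pred (lift k P)"
| "lift k (Succ P) = Succ (lift k P)"
| "lift k (Ifz P Q Q') = Ifz (lift k P) (lift k Q) (lift k Q')"
| "lift k (Fix P) = Fix (lift k P)"

text \<open>\<open>subst k S P\<close> replaces variable \<open>k\<close> of \<open>P\<close> by \<open>S\<close> and removes its binder, so the
  variables above \<open>k\<close> move down by one.\<close>

primrec subst :: "nat \<Rightarrow> tm \<Rightarrow> tm \<Rightarrow> tm" where
  "subst k S (Var i) = (if i < k then Var i else if i = k then S else Var (i - 1))"
| "subst k S (App P Q) = App (subst k S P) (subst k S Q)"
| "subst k S (Lam P) = Lam (subst (Suc k) (lift 0 S) P)"
| "subst k S Zero = Zero"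
| "subst k S (Pred P) = Pred (subst k S P)"
| "subst k S (Succ P) = Succ (subst k S P)"
| "subst k S (Ifz P Q Q') = Ifz (subst k S P) (subst k S Q) (subst k S Q')"
| "subst k S (Fix P) = Fix (subst k S P)"

definition num_tm :: "nat \<Rightarrow> tm" where
  "num_tm n = (Succ ^^ n) Zero"

inductive pcf_step :: "tm \<Rightarrow> tm \<Rightarrow> bool" where
  "pcf_step (App (Lam P) Q) (subst 0 Q P)"
| "pcf_step (Pred Zero) Zero"
| "pcf_step (Pred (num_tm (Suc n))) (num_tm n)"
| "pcf_step (Ifz Zero P Q) P"
| "pcf_step (Ifz (num_tm (Suc n)) P Q) Q"
| "pcf_step (Fix P) (App P (Fix P))"
| "pcf_step P P' \<Longrightarrow> pcf_step (App P Q) (App P' Q)"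
| "pcf_step P P' \<Longrightarrow> pcf_step (Pred P) (Pred P')"
| "pcf_step P P' \<Longrightarrow> pcf_step (Succ P) (Succ P')"
| "pcf_step P P' \<Longrightarrow> pcf_step (Ifz P Q Q') (Ifz P' Q Q')"

text \<open>In an environment \<open>\<Gamma>\<close>, the type of \<open>Var i\<close> is \<open>\<Gamma> ! i\<close>; the most recently bound
  variable comes first.\<close>

inductive has_ty :: "ty list \<Rightarrow> tm \<Rightarrow> ty \<Rightarrow> bool" where
  "i < length \<Gamma> \<Longrightarrow> has_ty \<Gamma> (Var i) (\<Gamma> ! i)"
| "has_ty \<Gamma> P (\<alpha> \<rightarrow> \<beta>) \<Longrightarrow> has_ty \<Gamma> Q \<alpha> \<Longrightarrow> has_ty \<Gamma> (App P Q) \<beta>"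
| "has_ty (\<alpha> # \<Gamma>) P \<beta> \<Longrightarrow> has_ty \<Gamma> (Lam P) (\<alpha> \<rightarrow> \<beta>)"
| "has_ty \<Gamma> Zero TInt"
| "has_ty \<Gamma> P TInt \<Longrightarrow> has_ty \<Gamma> (Pred P) TInt"
| "has_ty \<Gamma> P TInt \<Longrightarrow> has_ty \<Gamma> (Succ P) TInt"
| "has_ty \<Gamma> P TInt \<Longrightarrow> has_ty \<Gamma> Q \<alpha> \<Longrightarrow> has_ty \<Gamma> Q' \<alpha> \<Longrightarrow> has_ty \<Gamma> (Ifz P Q Q') \<alpha>"
| "has_ty \<Gamma> P (\<alpha> \<rightarrow> \<alpha>) \<Longrightarrow> has_ty \<Gamma> (Fix P) \<alpha>"

datatype ctx =
    Hole
  | AppC1 ctx tm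
  | AppC2 tm ctx
  | LamC ctx
  | PredC ctx
  | SuccC ctx
  | IfzC1 ctx tm tm
  | IfzC2 tm ctx tm
  | IfzC3 tm tm ctx
  | FixC ctx

primrec fill :: "ctx \<Rightarrow> tm \<Rightarrow> tm" where
  "fill Hole P = P"
| "fill (AppC1 C Q) P = App (fill C P) Q"
| "fill (AppC2 Q C) P = App Q (fill C P)"
| "fill (LamC C) P = Lam (fill C P)"
| "fill (PredC C) P = Pred (fill C P)"
| "fill (SuccC C) P = Succ (fill C P)"
| "fill (IfzC1 C Q Q') P = Ifz (fill C P) Q Q'"
| "fill (IfzC2 Q C Q') P = Ifz Q (fill C P) Q'"
| "fill (IfzC3 Q Q' C) P = Ifz Q Q' (fill C P)"
| "fill (FixC C) P = Fix (fill C P)"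

text \<open>\<open>ctx_ty \<alpha> \<Gamma> C \<beta>\<close>: in environment \<open>\<Gamma>\<close> the context \<open>C\<close> has type \<open>\<beta>\<close>, provided its hole
  has type \<open>\<alpha>\<close>. The hole may lie below binders of \<open>C\<close>.\<close>

inductive ctx_ty :: "ty \<Rightarrow> ty list \<Rightarrow> ctx \<Rightarrow> ty \<Rightarrow> bool" for \<alpha> :: ty where
  "ctx_ty \<alpha> \<Gamma> Hole \<alpha>"
| "ctx_ty \<alpha> \<Gamma> C (\<beta> \<rightarrow> \<gamma>) \<Longrightarrow> has_ty \<Gamma> Q \<beta> \<Longrightarrow> ctx_ty \<alpha> \<Gamma> (AppC1 C Q) \<gamma>"
| "has_ty \<Gamma> Q (\<beta> \<rightarrow> \<gamma>) \<Longrightarrow> ctx_ty \<alpha> \<Gamma> C \<beta> \<Longrightarrow> ctx_ty \<alpha> \<Gamma> (AppC2 Q C) \<gamma>"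
| "ctx_ty \<alpha> (\<beta> # \<Gamma>) C \<gamma> \<Longrightarrow> ctx_ty \<alpha> \<Gamma> (LamC C) (\<beta> \<rightarrow> \<gamma>)"
| "ctx_ty \<alpha> \<Gamma> C TInt \<Longrightarrow> ctx_ty \<alpha> \<Gamma> (PredC C) TInt"
| "ctx_ty \<alpha> \<Gamma> C TInt \<Longrightarrow> ctx_ty \<alpha> \<Gamma> (SuccC C) TInt"
| "ctx_ty \<alpha> \<Gamma> C TInt \<Longrightarrow> has_ty \<Gamma> Q \<beta> \<Longrightarrow> has_ty \<Gamma> Q' \<beta> \<Longrightarrow> ctx_ty \<alpha> \<Gamma> (IfzC1 C Q Q') \<beta>"
| "has_ty \<Gamma> Q TInt \<Longrightarrow> ctx_ty \<alpha> \<Gamma> C \<beta> \<Longrightarrow> has_ty \<Gamma> Q' \<beta> \<Longrightarrow> ctx_ty \<alpha> \<Gamma> (IfzC2 Q C Q') \<beta>"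
| "has_ty \<Gamma> Q TInt \<Longrightarrow> has_ty \<Gamma> Q' \<beta> \<Longrightarrow> ctx_ty \<alpha> \<Gamma> C \<beta> \<Longrightarrow> ctx_ty \<alpha> \<Gamma> (IfzC3 Q Q' C) \<beta>"
| "ctx_ty \<alpha> \<Gamma> C (\<beta> \<rightarrow> \<beta>) \<Longrightarrow> ctx_ty \<alpha> \<Gamma> (FixC C) \<beta>"

text \<open>Observational equivalence of programs (closed terms) of type \<open>\<alpha>\<close>. A closed term needs
  no index shifting when it is placed below binders.\<close>

definition obs_eq :: "ty \<Rightarrow> tm \<Rightarrow> tm \<Rightarrow> bool" where
  "obs_eq \<alpha> P P' \<longleftrightarrow>
     (\<forall>C. ctx_ty \<alpha> [] C TInt \<longrightarrow>
        (\<forall>n. pcf_step\<^sup>*\<^sup>* (fill C P) (num_tm n) \<longleftrightarrow> pcf_step\<^sup>*\<^sup>* (fill C P') (num_tm n)))"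


section \<open>Extended addressing machines\<close>

text \<open>Programs first load from the tape, then compute on registers, and finally call a register
  or stop. \<open>AppI k i j A\<close> stands for \<open>k \<leftarrow> App(i,j); A\<close>, and \<open>TestI l i j k A\<close> for
  \<open>l \<leftarrow> Test(i,j,k); A\<close>, \<open>PredI j i A\<close> for \<open>j \<leftarrow> Pred(i); A\<close>, similarly \<open>SuccI\<close>.\<close>

datatype acode =
    AppI nat nat nat acode
  | TestI nat nat nat nat acode
  | PredI nat nat acode
  | SuccI nat nat acode
  | Call nat
  | Stop

datatype code = Load nat code | Run acode

text \<open>A machine is a triple of registers (\<open>None\<close> for uninitialised), program and input tape.
  Writing to a register that does not exist has no effect; this is how inputs are discarded,
  and how \<^const>\<open>list_update\<close> behaves.\<close>

datatype 'a eam = EAM (regs: "'a option list") (prog: code) (tape: "'a list")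

definition get :: "'b option list \<Rightarrow> nat \<Rightarrow> 'b option" where
  "get R i = (if i < length R then R ! i else None)"

text \<open>\<open>valid r I P\<close>: with \<open>r\<close> registers, those in \<open>I\<close> being initialised, \<open>P\<close> never reads an
  uninitialised register.\<close>

primrec avalid :: "nat \<Rightarrow> nat set \<Rightarrow> acode \<Rightarrow> bool" where
  "avalid r I (AppI k i j A) \<longleftrightarrow> {i, j} \<subseteq> I \<and> avalid r (I \<union> ({k} \<inter> {..<r})) A"
| "avalid r I (TestI l i j k A) \<longleftrightarrow> {i, j, k} \<subseteq> I \<and> avalid r (I \<union> ({l} \<inter> {..<r})) A"
| "avalid r I (PredI j i A) \<longleftrightarrow> i \<in> I \<and> avalid r (I \<union> ({j} \<inter> {..<r})) A"
| "avalid r I (SuccI j i A) \<longleftrightarrow> i \<in> I \<and> avalid r (I \<union> ({j} \<inter> {..<r})) A"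
| "avalid r I (Call i) \<longleftrightarrow> i \<in> I"
| "avalid r I Stop \<longleftrightarrow> True"

primrec valid :: "nat \<Rightarrow> nat set \<Rightarrow> code \<Rightarrow> bool" where
  "valid r I (Load i P) \<longleftrightarrow> valid r (I \<union> ({i} \<inter> {..<r})) P"
| "valid r I (Run A) \<longleftrightarrow> avalid r I A"

definition EAMs :: "'a eam set" where
  "EAMs = {M. regs M \<noteq> [] \<and>
     valid (length (regs M)) {i. get (regs M) i \<noteq> None} (prog M)}"

definition app_tape :: "'a eam \<Rightarrow> 'a list \<Rightarrow> 'a eam" (infixl "@@" 65) where
  "M @@ T = EAM (regs M) (prog M) (tape M @ T)"

text \<open>The fixed-point machine containing the address \<open>y\<close>; below, \<open>y\<close> is its own address.\<close>

definition Y_eam :: "'a \<Rightarrow> 'a eam" where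
  "Y_eam y = EAM [None, Some y] (Load 0 (Run (AppI 1 1 0 (AppI 0 0 1 (Call 0))))) []"

text \<open>The type \<open>'a\<close> is the set of addresses, containing the naturals through \<open>num\<close>; \<open>addr\<close> is the
  address table map. Besides giving numeral machines their addresses, it satisfies a reflection
  principle: the fixed-point machine has access to its own address \<open>y\<close>.\<close>

locale address_table_map =
  fixes num :: "nat \<Rightarrow> 'a::countable"
    and addr :: "'a eam \<Rightarrow> 'a"
    and y :: 'a
  assumes inj_num: "inj num"
    and bij_addr: "bij_betw addr EAMs UNIV"
    and addr_numeral: "addr (EAM [Some (num n)] (Run Stop) []) = num n"
    and addr_Y: "addr (Y_eam y) = y"
begin

definition numeral_eam :: "nat \<Rightarrow> 'a eam" where
  "numeral_eam n = EAM [Some (num n)] (Run Stop) []"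

definition mach :: "'a \<Rightarrow> 'a eam" where
  "mach a = inv_into EAMs addr a"

definition app :: "'a \<Rightarrow> 'a \<Rightarrow> 'a" (infixl "\<cdot>" 70) where
  "a \<cdot> b = addr (mach a @@ [b])"

text \<open>The arithmetic instructions need a number in their first argument register; otherwise the
  machine whose address is stored there is reduced first. Recall \<open>0 - 1 = 0\<close> on \<open>nat\<close>.\<close>

inductive step :: "'a eam \<Rightarrow> 'a eam \<Rightarrow> bool" where
  "get R i = Some a \<Longrightarrow> step (EAM R (Run (Call i)) T) (mach a @@ T)"
| "step (EAM R (Load i P) (a # T)) (EAM (R[i := Some a]) P T)"
| "get R i = Some a \<Longrightarrow> get R j = Some b \<Longrightarrow>
     step (EAM R (Run (AppI k i j A)) T) (EAM (R[k := Some (a \<cdot> b)]) (Run A) T)"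
| "get R i = Some (num n) \<Longrightarrow>
     step (EAM R (Run (PredI j i A)) T) (EAM (R[j := Some (num (n - 1))]) (Run A) T)"
| "get R i = Some a \<Longrightarrow> step (mach a) M \<Longrightarrow>
     step (EAM R (Run (PredI j i A)) T) (EAM (R[i := Some (addr M)]) (Run (PredI j i A)) T)"
| "get R i = Some (num n) \<Longrightarrow>
     step (EAM R (Run (SuccI j i A)) T) (EAM (R[j := Some (num (Suc n))]) (Run A) T)"
| "get R i = Some a \<Longrightarrow> step (mach a) M \<Longrightarrow>
     step (EAM R (Run (SuccI j i A)) T) (EAM (R[i := Some (addr M)]) (Run (SuccI j i A)) T)"
| "get R i = Some (num 0) \<Longrightarrow> get R j = Some b \<Longrightarrow>
     step (EAM R (Run (TestI l i j k A)) T) (EAM (R[l := Some b]) (Run A) T)"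
| "get R i = Some (num (Suc n)) \<Longrightarrow> get R k = Some c \<Longrightarrow>
     step (EAM R (Run (TestI l i j k A)) T) (EAM (R[l := Some c]) (Run A) T)"
| "get R i = Some a \<Longrightarrow> step (mach a) M \<Longrightarrow>
     step (EAM R (Run (TestI l i j k A)) T) (EAM (R[i := Some (addr M)]) (Run (TestI l i j k A)) T)"


subsection \<open>Typing\<close>

text \<open>\<open>code_ty \<Delta> P T \<alpha>\<close> types a program and tape relative to a partial assignment \<open>\<Delta>\<close> of types
  to the registers (one entry per register). Since \<open>Y_eam y\<close> refers to itself, it gets its types
  by a rule of its own.\<close>

inductive eam_ty :: "'a eam \<Rightarrow> ty \<Rightarrow> bool"
  and code_ty :: "ty option list \<Rightarrow> code \<Rightarrow> 'a list \<Rightarrow> ty \<Rightarrow> bool"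
where
  ty_num: "eam_ty (numeral_eam n) TInt"
| ty_fix: "eam_ty (Y_eam y) ((\<alpha> \<rightarrow> \<alpha>) \<rightarrow> \<alpha>)"
| ty_eam: "list_all2 (rel_option (\<lambda>a \<beta>. eam_ty (mach a) \<beta>)) R \<Delta> \<Longrightarrow> code_ty \<Delta> P T \<alpha> \<Longrightarrow>
     eam_ty (EAM R P T) \<alpha>"
| ty_load_empty: "code_ty (\<Delta>[i := Some \<beta>]) P [] \<alpha> \<Longrightarrow> code_ty \<Delta> (Load i P) [] (\<beta> \<rightarrow> \<alpha>)"
| ty_load: "eam_ty (mach a) \<beta> \<Longrightarrow> code_ty (\<Delta>[i := Some \<beta>]) P T \<alpha> \<Longrightarrow>
     code_ty \<Delta> (Load i P) (a # T) \<alpha>"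
| ty_app: "get \<Delta> i = Some (\<beta> \<rightarrow> \<gamma>) \<Longrightarrow> get \<Delta> j = Some \<beta> \<Longrightarrow>
     code_ty (\<Delta>[k := Some \<gamma>]) (Run A) T \<alpha> \<Longrightarrow> code_ty \<Delta> (Run (AppI k i j A)) T \<alpha>"
| ty_pred: "get \<Delta> i = Some TInt \<Longrightarrow> code_ty (\<Delta>[j := Some TInt]) (Run A) T \<alpha> \<Longrightarrow>
     code_ty \<Delta> (Run (PredI j i A)) T \<alpha>"
| ty_succ: "get \<Delta> i = Some TInt \<Longrightarrow> code_ty (\<Delta>[j := Some TInt]) (Run A) T \<alpha> \<Longrightarrow>
     code_ty \<Delta> (Run (SuccI j i A)) T \<alpha>"
| ty_test: "get \<Delta> i = Some TInt \<Longrightarrow> get \<Delta> j = Some \<beta> \<Longrightarrow> get \<Delta> k = Some \<beta> \<Longrightarrow>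
     code_ty (\<Delta>[l := Some \<beta>]) (Run A) T \<alpha> \<Longrightarrow> code_ty \<Delta> (Run (TestI l i j k A)) T \<alpha>"
| ty_call: "get \<Delta> i = Some (arrs \<beta>s \<alpha>) \<Longrightarrow> list_all2 (\<lambda>a \<beta>. eam_ty (mach a) \<beta>) T \<beta>s \<Longrightarrow>
     code_ty \<Delta> (Run (Call i)) T \<alpha>"


subsection \<open>Translation of PCF\<close>

text \<open>In the machines below, \<open>n\<close> is the number of variables \<open>x\<^sub>1, \<dots>, x\<^sub>n\<close> and the operands come
  first on the tape, followed by the values of \<open>x\<^sub>1, \<dots>, x\<^sub>n\<close>. Each operand is applied to these values
  (by \<open>spread\<close>) before the operation is executed.\<close>

definition loads :: "nat \<Rightarrow> acode \<Rightarrow> code" where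
  "loads m A = foldr Load [0..<m] (Run A)"

definition spread :: "nat \<Rightarrow> nat list \<Rightarrow> acode \<Rightarrow> acode" where
  "spread k js A = foldr (\<lambda>j. AppI k k j) js A"

definition Proj_eam :: "nat \<Rightarrow> nat \<Rightarrow> 'a eam" where
  "Proj_eam n i = EAM (replicate n None) (loads n (Call i)) []"

definition Apply_eam :: "nat \<Rightarrow> 'a eam" where
  "Apply_eam n = EAM (replicate (n + 2) None)
     (loads (n + 2) (spread 0 [2..<n+2] (spread 1 [2..<n+2] (AppI 0 0 1 (Call 0))))) []"

definition Pred_eam :: "nat \<Rightarrow> 'a eam" where
  "Pred_eam n = EAM (replicate (n + 1) None)
     (loads (n + 1) (spread 0 [1..<n+1] (PredI 0 0 (Call 0)))) []"

definition Succ_eam :: "nat \<Rightarrow> 'a eam" where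
  "Succ_eam n = EAM (replicate (n + 1) None)
     (loads (n + 1) (spread 0 [1..<n+1] (SuccI 0 0 (Call 0)))) []"

definition Ifz_eam :: "nat \<Rightarrow> 'a eam" where
  "Ifz_eam n = EAM (replicate (n + 3) None)
     (loads (n + 3) (spread 0 [3..<n+3] (spread 1 [3..<n+3] (spread 2 [3..<n+3]
       (TestI 0 0 1 2 (Call 0)))))) []"

definition Fix_eam :: "nat \<Rightarrow> 'a eam" where
  "Fix_eam n = EAM (replicate (n + 1) None @ [Some (addr (Y_eam y))])
     (loads (n + 1) (spread 0 [1..<n+1] (AppI 0 (n + 1) 0 (Call 0)))) []"

text \<open>\<open>Tr n P\<close> is the translation of \<open>P\<close> relative to \<open>x\<^sub>1, \<dots>, x\<^sub>n\<close>, where \<open>x\<^sub>n\<close> is the most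
  recently bound variable; so \<open>Var i\<close> is \<open>x\<^sub>n\<^sub>-\<^sub>i\<close>, whose value is loaded into register \<open>n - 1 - i\<close>.\<close>

primrec Tr :: "nat \<Rightarrow> tm \<Rightarrow> 'a eam" where
  "Tr n (Var i) = Proj_eam n (n - 1 - i)"
| "Tr n (App P Q) = Apply_eam n @@ [addr (Tr n P), addr (Tr n Q)]"
| "Tr n (Lam P) = Tr (Suc n) P"
| "Tr n Zero = Proj_eam (Suc n) 0 @@ [num 0]"
| "Tr n (Pred P) = Pred_eam n @@ [addr (Tr n P)]"
| "Tr n (Succ P) = Succ_eam n @@ [addr (Tr n P)]"
| "Tr n (Ifz P Q Q') = Ifz_eam n @@ [addr (Tr n P), addr (Tr n Q), addr (Tr n Q')]"
| "Tr n (Fix P) = Fix_eam n @@ [addr (Tr n P)]"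


subsection \<open>The model\<close>

definition D :: "ty \<Rightarrow> 'a set" where
  "D \<alpha> = {a. eam_ty (mach a) \<alpha>}"

primrec eam_eq :: "ty \<Rightarrow> 'a eam \<Rightarrow> 'a eam \<Rightarrow> bool" where
  "eam_eq TInt M N \<longleftrightarrow> (\<forall>n. step\<^sup>*\<^sup>* M (numeral_eam n) \<longleftrightarrow> step\<^sup>*\<^sup>* N (numeral_eam n))"
| "eam_eq (\<alpha> \<rightarrow> \<beta>) M N \<longleftrightarrow>
     (\<forall>a \<in> D \<alpha>. \<forall>b \<in> D \<alpha>. eam_eq \<alpha> (mach a) (mach b) \<longrightarrow> eam_eq \<beta> (M @@ [a]) (N @@ [b]))"

definition addr_eq :: "ty \<Rightarrow> ('a \<times> 'a) set" where
  "addr_eq \<alpha> = {(a, b). a \<in> D \<alpha> \<and> b \<in> D \<alpha> \<and> eam_eq \<alpha> (mach a) (mach b)}"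

definition model_carrier :: "ty \<Rightarrow> 'a set set" where
  "model_carrier \<alpha> = D \<alpha> // addr_eq \<alpha>"

definition model_app :: "ty \<Rightarrow> 'a set \<Rightarrow> 'a set \<Rightarrow> 'a set" where
  "model_app \<beta> X Z = (\<Union>a \<in> X. \<Union>b \<in> Z. addr_eq \<beta> `` {a \<cdot> b})"

text \<open>With \<open>\<Gamma> = [\<beta>\<^sub>n, \<dots>, \<beta>\<^sub>1]\<close>, this is an element of the carrier at type
  \<open>\<beta>\<^sub>1 \<rightarrow> \<dots> \<rightarrow> \<beta>\<^sub>n \<rightarrow> \<alpha>\<close>.\<close>

definition interp :: "ty list \<Rightarrow> tm \<Rightarrow> ty \<Rightarrow> 'a set" where
  "interp \<Gamma> P \<alpha> = addr_eq (arrs (rev \<Gamma>) \<alpha>) `` {addr (Tr (length \<Gamma>) P)}"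

end

end

(* Two kinds of computations, closed PCF terms and machines, are compared by one step-indexed
   approximation relation LR: only the evaluation steps of the left side are counted, and arguments
   range over objects of the same kind as the function. A term and its translation approximate each
   other (the fixed-point case is an induction on the step index), and conversely every typed machine
   is equivalent to some PCF term, by induction on the finite typing derivation. Hence all typed
   machines are related to themselves and LR at all indices is transitive across both kinds. In both
   directions together it is the logical relation of the model on machines and observational
   equivalence on terms. *)

theory Submission
  imports Defs
begin

text \<open>The obstacle is that the two notions quantify over different arguments: the model over
  all typed machines, observational equivalence over terms only. Only because every typed machine
  has a term does each argument of one kind have an equivalent of the other. Keeping one kind on
  each side means that a term is never fed to a machine, at the price that a composition may have to
  exchange arguments on the way.

  The index serves the fixed-point operator. Its machine recurs through its own address, so no
  induction on terms or derivations reaches its unfolding; at index 0 nothing is demanded, and every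
  unfolding costs a step. Since runs on the right are not bounded, the second of two composed
  approximations must be available at every index. Reflexivity needs no separate argument: going to
  the counterpart of the other kind and back is already a composition.\<close>

section \<open>Closed substitution\<close>

text \<open>\<open>csub k \<sigma> P\<close> replaces the variables \<open>k, k + 1, \<dots>\<close> of \<open>P\<close> simultaneously by \<open>\<sigma>\<close>. The terms
  in \<open>\<sigma>\<close> are not lifted under binders, so they have to be closed.\<close>

primrec csub :: "nat \<Rightarrow> tm list \<Rightarrow> tm \<Rightarrow> tm" where
  "csub k \<sigma> (Var i) = (if i < k then Var i else if i - k < length \<sigma> then \<sigma> ! (i - k)
     else Var (i - length \<sigma>))"
| "csub k \<sigma> (App P Q) = App (csub k \<sigma> P) (csub k \<sigma> Q)"
| "csub k \<sigma> (Lam P) = Lam (csub (Suc k) \<sigma> P)"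
| "csub k \<sigma> Zero = Zero"
| "csub k \<sigma> (Pred P) = Pred (csub k \<sigma> P)"
| "csub k \<sigma> (Succ P) = Succ (csub k \<sigma> P)"
| "csub k \<sigma> (Ifz P Q Q') = Ifz (csub k \<sigma> P) (csub k \<sigma> Q) (csub k \<sigma> Q')"
| "csub k \<sigma> (Fix P) = Fix (csub k \<sigma> P)"

lemma csub_id: "has_ty \<Gamma> P \<alpha> \<Longrightarrow> length \<Gamma> \<le> k \<Longrightarrow> csub k \<sigma> P = P"
  by (induction arbitrary: k rule: has_ty.induct) auto

lemma lift_id: "has_ty \<Gamma> P \<alpha> \<Longrightarrow> length \<Gamma> \<le> k \<Longrightarrow> lift k P = P"
  by (induction arbitrary: k rule: has_ty.induct) auto

lemma subst_id: "has_ty \<Gamma> P \<alpha> \<Longrightarrow> length \<Gamma> \<le> k \<Longrightarrow> subst k S P = P"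
  by (induction arbitrary: k S rule: has_ty.induct) auto

lemma has_ty_weaken: "has_ty \<Gamma> P \<alpha> \<Longrightarrow> has_ty (\<Gamma> @ \<Gamma>') P \<alpha>"
proof (induction rule: has_ty.induct)
  case (1 i \<Gamma>)
  then show ?case
    by (metis has_ty.intros(1) length_append nth_append trans_less_add1)
qed (auto intro: has_ty.intros)

lemma has_ty_closed_weaken: "has_ty [] P \<alpha> \<Longrightarrow> has_ty \<Gamma> P \<alpha>"
  using has_ty_weaken[of "[]"] by simp

lemma has_ty_csub:
  assumes "has_ty (\<Gamma>' @ \<Gamma>) P \<alpha>" "length \<sigma> = length \<Gamma>"
    "\<And>i. i < length \<Gamma> \<Longrightarrow> has_ty [] (\<sigma> ! i) (\<Gamma> ! i)"
  shows "has_ty \<Gamma>' (csub (length \<Gamma>') \<sigma> P) \<alpha>"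
  using assms(1)
proof (induction "\<Gamma>' @ \<Gamma>" P \<alpha> arbitrary: \<Gamma>' rule: has_ty.induct)
  case (1 i)
  then show ?case
    using assms(2,3) has_ty.intros(1)[of i \<Gamma>']
    by (auto simp: nth_append intro: has_ty_closed_weaken)
next
  case (3 \<alpha> P \<beta>)
  show ?case
    using 3(2)[of "\<alpha> # \<Gamma>'"] by (auto intro: has_ty.intros)
qed (auto intro: has_ty.intros)

text \<open>The closed terms in \<open>\<sigma>\<close> contain no variable that the outer
  substitution could hit, and the closed \<open>S\<close> is not changed by lifting, so the two
  substitutions merge into one simultaneous one.\<close>

lemma subst_csub:
  assumes "has_ty [] S \<beta>" "\<And>Q. Q \<in> set \<sigma> \<Longrightarrow> \<exists>\<gamma>. has_ty [] Q \<gamma>"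
  shows "subst k S (csub (Suc k) \<sigma> P) = csub k (S # \<sigma>) P"
proof (induction P arbitrary: k)
  case (Var i)
  show ?case
  proof (cases "i \<le> k \<or> length \<sigma> \<le> i - Suc k")
    case False
    then have "i - Suc k < length \<sigma>" by auto
    with assms(2) have "subst k S (\<sigma> ! (i - Suc k)) = \<sigma> ! (i - Suc k)"
      by (metis nth_mem subst_id le0 list.size(3))
    moreover have "i - k = Suc (i - Suc k)" using False by auto
    ultimately show ?thesis using False by auto
  qed (auto simp: nth_Cons' not_less)
qed (auto simp: lift_id[OF assms(1)])

lemma beta_csub:
  assumes "has_ty [] S \<beta>" "length \<sigma> = length \<Gamma>"
    "\<And>i. i < length \<Gamma> \<Longrightarrow> has_ty [] (\<sigma> ! i) (\<Gamma> ! i)"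
  shows "pcf_step (App (Lam (csub (Suc 0) \<sigma> P)) S) (csub 0 (S # \<sigma>) P)"
proof -
  have "subst 0 S (csub (Suc 0) \<sigma> P) = csub 0 (S # \<sigma>) P"
    using assms by (intro subst_csub) (auto simp: in_set_conv_nth)
  then show ?thesis by (metis pcf_step.intros(1))
qed

section \<open>Contexts as open terms\<close>

text \<open>Turns a context into the body of a function: the hole becomes a variable bound outside
  the whole context, hence \<open>k\<close> counts the binders passed. This is faithful because only
  closed terms are put into the hole, so nothing can be captured.\<close>

primrec fill_var :: "nat \<Rightarrow> ctx \<Rightarrow> tm" where
  "fill_var k Hole = Var k"
| "fill_var k (AppC1 C Q) = App (fill_var k C) Q"
| "fill_var k (AppC2 Q C) = App Q (fill_var k C)"
| "fill_var k (LamC C) = Lam (fill_var (Suc k) C)"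
| "fill_var k (PredC C) = Pred (fill_var k C)"
| "fill_var k (SuccC C) = Succ (fill_var k C)"
| "fill_var k (IfzC1 C Q Q') = Ifz (fill_var k C) Q Q'"
| "fill_var k (IfzC2 Q C Q') = Ifz Q (fill_var k C) Q'"
| "fill_var k (IfzC3 Q Q' C) = Ifz Q Q' (fill_var k C)"
| "fill_var k (FixC C) = Fix (fill_var k C)"

lemma has_ty_fill_var: "ctx_ty \<alpha> \<Gamma> C \<beta> \<Longrightarrow> has_ty (\<Gamma> @ [\<alpha>]) (fill_var (length \<Gamma>) C) \<beta>"
proof (induction rule: ctx_ty.induct)
  case (1 \<Gamma>)
  then show ?case using has_ty.intros(1)[of "length \<Gamma>" "\<Gamma> @ [\<alpha>]"] by simp
qed (auto intro: has_ty.intros has_ty_weaken)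

lemma subst_fill_var:
  "ctx_ty \<alpha> \<Gamma> C \<beta> \<Longrightarrow> has_ty [] P \<gamma> \<Longrightarrow> subst (length \<Gamma>) P (fill_var (length \<Gamma>) C) = fill C P"
  by (induction rule: ctx_ty.induct) (auto simp: subst_id lift_id)

section \<open>Determinism\<close>

lemma num_tm_0 [simp]: "num_tm 0 = Zero"
  and num_tm_Suc: "num_tm (Suc n) = Succ (num_tm n)"
  by (simp_all add: num_tm_def)

lemma num_tm_inj [simp]: "num_tm m = num_tm n \<longleftrightarrow> m = n"
proof (induction m arbitrary: n)
  case 0
  then show ?case by (cases n) (auto simp: num_tm_Suc)
next
  case (Suc m)
  then show ?case by (cases n) (auto simp: num_tm_Suc)
qed

inductive_cases step_AppE: "pcf_step (App P Q) P'"
inductive_cases step_PredE: "pcf_step (Pred P) P'"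
inductive_cases step_SuccE: "pcf_step (Succ P) P'"
inductive_cases step_IfzE: "pcf_step (Ifz P Q Q') P'"
inductive_cases step_FixE: "pcf_step (Fix P) P'"
inductive_cases step_LamE: "pcf_step (Lam P) P'"
inductive_cases step_ZeroE: "pcf_step Zero P'"

lemma num_tm_normal: "\<not> pcf_step (num_tm n) P"
proof (induction n arbitrary: P)
  case (Suc n)
  then show ?case by (metis num_tm_Suc step_SuccE)
qed (auto elim: step_ZeroE)

lemma num_tm_simps:
  "num_tm n = Zero \<longleftrightarrow> n = 0" "Zero = num_tm n \<longleftrightarrow> n = 0"
  "num_tm n = Succ P \<longleftrightarrow> (\<exists>m. n = Suc m \<and> P = num_tm m)"
  "num_tm n \<noteq> App P Q" "num_tm n \<noteq> Lam P" "num_tm n \<noteq> Pred P"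
  "num_tm n \<noteq> Ifz P Q Q'" "num_tm n \<noteq> Fix P"
  by (cases n; auto simp: num_tm_Suc)+

lemma pcf_step_det: "pcf_step P P' \<Longrightarrow> pcf_step P P'' \<Longrightarrow> P' = P''"
proof (induction arbitrary: P'' rule: pcf_step.induct)
  case (1 P Q)
  then show ?case by (auto elim: step_AppE step_LamE)
next
  case 2
  then show ?case by (auto simp: num_tm_simps elim: step_PredE step_ZeroE)
next
  case (3 n)
  from 3 show ?case
    by (rule step_PredE) (auto simp: num_tm_normal num_tm_simps)
next
  case (4 P Q)
  then show ?case by (auto elim: step_IfzE step_ZeroE simp: num_tm_simps)
next
  case (5 n P Q)
  from 5 show ?case
    by (rule step_IfzE) (auto simp: num_tm_normal num_tm_simps)
next
  case (6 P)
  then show ?case by (auto elim: step_FixE)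
next
  case (7 P P' Q)
  from 7(3,1,2) show ?case by (elim step_AppE) (blast elim: step_LamE)+
next
  case (8 P P')
  from 8(3,1,2) show ?case
    by (elim step_PredE) (use num_tm_normal step_ZeroE in blast)+
next
  case (9 P P')
  from 9(3,1,2) show ?case by (elim step_SuccE) blast
next
  case (10 P P' Q Q')
  from 10(3,1,2) show ?case
    by (elim step_IfzE) (use num_tm_normal step_ZeroE in blast)+
qed

section \<open>Machines: addresses, determinism and validity of reducts\<close>

lemma get_list_update:
  "get (R[i := v]) j = (if j = i \<and> i < length R then v else get R j)"
  by (auto simp: get_def nth_list_update)

lemma get_less: "get R i = Some v \<Longrightarrow> i < length R"
  by (auto simp: get_def split: if_splits)

context address_table_map
begin

lemma numeral_EAMs: "numeral_eam n \<in> EAMs"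
  by (simp add: numeral_eam_def EAMs_def)

lemma Y_EAMs: "Y_eam y \<in> EAMs"
proof -
  have "{i. get [None, Some y] i \<noteq> None} = {1}"
    by (auto simp: get_def less_Suc_eq split: if_splits)
  then show ?thesis by (simp add: Y_eam_def EAMs_def)
qed

lemma mach_EAMs [simp]: "mach a \<in> EAMs"
  unfolding mach_def by (metis bij_addr bij_betw_def inv_into_into UNIV_I)

lemma addr_mach [simp]: "addr (mach a) = a"
  unfolding mach_def by (metis bij_addr bij_betw_def f_inv_into_f UNIV_I)

lemma mach_addr [simp]: "M \<in> EAMs \<Longrightarrow> mach (addr M) = M"
  unfolding mach_def by (metis bij_addr bij_betw_def inv_into_f_f)

lemma mach_num [simp]: "mach (num n) = numeral_eam n"
  using mach_addr[OF numeral_EAMs] addr_numeral by (simp add: numeral_eam_def)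

lemma addr_numeral_eam [simp]: "addr (numeral_eam n) = num n"
  using addr_numeral by (simp add: numeral_eam_def)

lemma mach_y [simp]: "mach y = Y_eam y"
  using mach_addr[OF Y_EAMs] addr_Y by simp

lemma app_tape_EAMs [simp]: "M \<in> EAMs \<Longrightarrow> M @@ T \<in> EAMs"
  by (simp add: EAMs_def app_tape_def)

lemma mach_app [simp]: "mach (a \<cdot> b) = mach a @@ [b]"
  by (simp add: app_def)

lemma app_tape_append [simp]: "M @@ T @@ T' = M @@ (T @ T')"
  by (simp add: app_tape_def)

lemma app_tape_Nil [simp]: "M @@ [] = M"
  by (simp add: app_tape_def)

lemma EAM_app_tape [simp]: "EAM R P T @@ T' = EAM R P (T @ T')"
  by (simp add: app_tape_def)

lemma numeral_normal: "\<not> step (numeral_eam n) M"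
  by (auto simp: numeral_eam_def elim: step.cases)

lemma numeral_eam_inj: "numeral_eam m = numeral_eam n \<Longrightarrow> m = n"
  using inj_num by (auto simp: numeral_eam_def inj_def)

lemma num_inj: "num m = num n \<Longrightarrow> m = n"
  using inj_num by (auto simp: inj_def)

inductive_cases step_CallE: "step (EAM R (Run (Call i)) T) M"
inductive_cases step_LoadE: "step (EAM R (Load i P) T) M"
inductive_cases step_AppIE: "step (EAM R (Run (AppI k i j A)) T) M"
inductive_cases step_PredIE: "step (EAM R (Run (PredI j i A)) T) M"
inductive_cases step_SuccIE: "step (EAM R (Run (SuccI j i A)) T) M"
inductive_cases step_TestIE: "step (EAM R (Run (TestI l i j k A)) T) M"

text \<open>The rules that evaluate an operand in place overlap with those that use its value only
  if a numeral machine could step, which \<open>numeral_normal\<close> excludes.\<close>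

lemma step_det: "step M N \<Longrightarrow> step M N' \<Longrightarrow> N = N'"
proof (induction arbitrary: N' rule: step.induct)
  case (1 R i a T)
  then show ?case by (auto elim: step_CallE)
next
  case (2 R i P a T)
  then show ?case by (auto elim: step_LoadE)
next
  case (3 R i a j b k A T)
  then show ?case by (auto elim: step_AppIE)
next
  case (4 R i n j A T)
  from 4(2,1) show ?case by (elim step_PredIE) (auto simp: numeral_normal dest: num_inj)
next
  case (5 R i a M j A T)
  from 5(4,1,2,3) show ?case 
    by (elim step_PredIE) (use numeral_normal mach_num in \<open>metis option.inject\<close>)+
next
  case (6 R i n j A T)
  from 6(2,1) show ?case by (elim step_SuccIE) (auto simp: numeral_normal dest: num_inj)
next
  case (7 R i a M j A T)
  from 7(4,1,2,3) show ?case 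
    by (elim step_SuccIE) (use numeral_normal mach_num in \<open>metis option.inject\<close>)+
next
  case (8 R i j b l k A T)
  from 8(3,1,2) show ?case by (elim step_TestIE) (auto simp: numeral_normal dest: num_inj)
next
  case (9 R i n k c l j A T)
  from 9(3,1,2) show ?case by (elim step_TestIE) (auto simp: numeral_normal dest: num_inj)
next
  case (10 R i a M l j k A T)
  from 10(4,1,2,3) show ?case 
    by (elim step_TestIE) (use numeral_normal mach_num in \<open>metis option.inject\<close>)+
qed

lemma step_app_tape: "step M N \<Longrightarrow> step (M @@ T) (N @@ T)"
proof (induction rule: step.induct)
  case (1 R i a T')
  then show ?case using step.intros(1)[of R i a "T' @ T"] by simp
qed (use step.intros in \<open>auto simp del: One_nat_def\<close>)

text \<open>\<open>mach\<close> inverts \<open>addr\<close> only on \<open>EAMs\<close>, so reducts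
  must stay there for an operand to be stored and read back through its address.\<close>

lemma step_EAMs: "step M N \<Longrightarrow> M \<in> EAMs \<Longrightarrow> N \<in> EAMs"
proof -
  \<comment> \<open>A write outside the registers initialises nothing, which is the intersection
    with \<open>{..<length R}\<close>; the second fact covers operands evaluated in place, whose
    register was initialised before.\<close>
  have *: "{j. \<exists>v. get (R[i := Some a]) j = Some v} =
      {j. \<exists>v. get R j = Some v} \<union> ({i} \<inter> {..<length R})" for R :: "'a option list" and i a
    by (auto simp: get_list_update)
  have **: "get R i = Some a \<Longrightarrow> {j. \<exists>v. get R j = Some v} \<union> {i} \<inter> {..<length R} = {j. \<exists>v. get R j = Some v}"
    for R :: "'a option list" and i a
    by auto
  show "step M N \<Longrightarrow> M \<in> EAMs \<Longrightarrow> N \<in> EAMs"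
  proof (induction rule: step.induct)
    case (1 R i a T)
    show ?case by simp
  qed (auto simp: EAMs_def * **)
qed

end

section \<open>A step-indexed logical relation\<close>

text \<open>A disjoint union, so that the comparisons within each kind and the two mixed ones are
  instances of one relation.\<close>

datatype 'a obj = is_Tm: Tm (un_Tm: tm) | is_Mc: Mc (un_Mc: "'a eam")

context address_table_map
begin

text \<open>On an argument of the other kind the selector gives an unspecified object, but the kind
  of the result is always that of the function.\<close>

definition oapp :: "'a obj \<Rightarrow> 'a obj \<Rightarrow> 'a obj" where
  "oapp X A = (case X of Tm P \<Rightarrow> Tm (App P (un_Tm A)) | Mc M \<Rightarrow> Mc (M @@ [addr (un_Mc A)]))"

definition oval :: "bool \<Rightarrow> nat \<Rightarrow> 'a obj" where
  "oval b n = (if b then Mc (numeral_eam n) else Tm (num_tm n))"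

fun ostep :: "'a obj \<Rightarrow> 'a obj \<Rightarrow> bool" where
  "ostep (Tm P) (Tm P') \<longleftrightarrow> pcf_step P P'"
| "ostep (Mc M) (Mc M') \<longleftrightarrow> step M M'"
| "ostep _ _ \<longleftrightarrow> False"

fun oty :: "'a obj \<Rightarrow> ty \<Rightarrow> bool" where
  "oty (Tm P) \<alpha> \<longleftrightarrow> has_ty [] P \<alpha>"
| "oty (Mc M) \<alpha> \<longleftrightarrow> eam_ty M \<alpha>"

fun wf_obj :: "'a obj \<Rightarrow> bool" where
  "wf_obj (Tm P) \<longleftrightarrow> True"
| "wf_obj (Mc M) \<longleftrightarrow> M \<in> EAMs"

definition ev :: "'a obj \<Rightarrow> nat \<Rightarrow> nat \<Rightarrow> bool" where
  "ev X j n \<longleftrightarrow> (ostep ^^ j) X (oval (is_Mc X) n)"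

text \<open>The strict bound at \<open>TInt\<close> makes index 0 trivial at every type. Quantifying
  over all \<open>j \<le> k\<close> at arrow types makes the relation monotone in the index.\<close>

primrec LR :: "ty \<Rightarrow> nat \<Rightarrow> 'a obj \<Rightarrow> 'a obj \<Rightarrow> bool" where
  "LR TInt k X Y \<longleftrightarrow> (\<forall>j<k. \<forall>n. ev X j n \<longrightarrow> (\<exists>i. ev Y i n))"
| "LR (\<alpha> \<rightarrow> \<beta>) k X Y \<longleftrightarrow> (\<forall>j\<le>k. \<forall>A B. is_Mc A = is_Mc X \<longrightarrow> is_Mc B = is_Mc Y \<longrightarrow>
     oty A \<alpha> \<longrightarrow> oty B \<alpha> \<longrightarrow> LR \<alpha> j A B \<longrightarrow> LR \<beta> j (oapp X A) (oapp Y B))"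

lemma is_Mc_oapp [simp]: "is_Mc (oapp X A) = is_Mc X"
  by (cases X) (auto simp: oapp_def)

lemma oapp_simps [simp]:
  "oapp (Tm P) (Tm Q) = Tm (App P Q)" "oapp (Mc M) (Mc N) = Mc (M @@ [addr N])"
  by (auto simp: oapp_def)

lemma is_Mc_oval [simp]: "is_Mc (oval b n) = b"
  by (auto simp: oval_def)

lemma ostep_is_Mc: "ostep X Y \<Longrightarrow> is_Mc Y = is_Mc X"
  by (cases X; cases Y) auto

lemma ostep_det: "ostep X Y \<Longrightarrow> ostep X Z \<Longrightarrow> Y = Z"
  by (cases X; cases Y; cases Z) (auto intro: step_det pcf_step_det)

lemma ostep_wf: "ostep X Y \<Longrightarrow> wf_obj X \<Longrightarrow> wf_obj Y"
  by (cases X; cases Y) (auto intro: step_EAMs)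

lemma ostep_oapp: "ostep X Y \<Longrightarrow> ostep (oapp X A) (oapp Y A)"
  by (cases X; cases Y) (auto simp: oapp_def intro: step_app_tape pcf_step.intros(7))

lemma oval_normal: "\<not> ostep (oval b n) X"
  by (cases X) (auto simp: oval_def num_tm_normal numeral_normal)

lemma oval_inj [simp]: "oval b m = oval b n \<longleftrightarrow> m = n"
  by (auto simp: oval_def dest: numeral_eam_inj)

lemma ev_0: "ev X 0 n \<longleftrightarrow> X = oval (is_Mc X) n"
  by (auto simp: ev_def)

lemma ev_Suc_D: "ev X (Suc j) n \<Longrightarrow> \<exists>Y. ostep X Y \<and> ev Y j n"
proof -
  assume "ev X (Suc j) n"
  then obtain Y where "ostep X Y" "(ostep ^^ j) Y (oval (is_Mc X) n)"
    unfolding ev_def by (elim relpowp_Suc_E2)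
  then show ?thesis using ostep_is_Mc[of X Y] by (auto simp: ev_def)
qed

lemma ev_step: "ostep X Y \<Longrightarrow> ev X (Suc j) n \<longleftrightarrow> ev Y j n"
proof
  assume XY: "ostep X Y"
  show "ev X (Suc j) n \<Longrightarrow> ev Y j n"
    using ev_Suc_D ostep_det[OF XY] by blast
  show "ev Y j n \<Longrightarrow> ev X (Suc j) n"
    using relpowp_Suc_I2[of ostep, OF XY] ostep_is_Mc[OF XY] by (simp add: ev_def)
qed

lemma ev_step_iff: "ostep X Y \<Longrightarrow> ev X j n \<longleftrightarrow> (\<exists>i. j = Suc i \<and> ev Y i n)"
  using oval_normal by (cases j) (metis ev_0 nat.distinct(1), simp add: ev_step)

lemma ev_oval: "ev (oval b m) j n \<longleftrightarrow> j = 0 \<and> m = n"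
  by (cases j) (auto simp: ev_0 oval_normal dest!: ev_Suc_D)

lemma ev_det: "ev X j n \<Longrightarrow> ev X i m \<Longrightarrow> n = m"
proof (induction j arbitrary: X i)
  case 0
  then show ?case by (metis ev_0 ev_oval)
next
  case (Suc j)
  then show ?case by (metis ev_Suc_D ev_step_iff)
qed

lemma rtranclp_ev: "ostep\<^sup>*\<^sup>* X Y \<Longrightarrow> (\<exists>i. ev X i n) \<longleftrightarrow> (\<exists>i. ev Y i n)"
proof (induction rule: rtranclp_induct)
  case (step Y Z)
  then show ?case by (metis ev_step_iff)
qed simp

lemma rtranclp_ev_le: "ostep\<^sup>*\<^sup>* X Y \<Longrightarrow> ev X j n \<Longrightarrow> \<exists>i\<le>j. ev Y i n"
proof (induction rule: rtranclp_induct)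
  case (step Y Z)
  then show ?case by (metis ev_step_iff Suc_leD)
qed auto

lemma ex_ev_iff: "(\<exists>j. ev X j n) \<longleftrightarrow> ostep\<^sup>*\<^sup>* X (oval (is_Mc X) n)"
  by (simp add: ev_def rtranclp_power)

lemma ostep_Tm_rtranclp: "ostep\<^sup>*\<^sup>* (Tm P) X \<longleftrightarrow> (\<exists>Q. X = Tm Q \<and> pcf_step\<^sup>*\<^sup>* P Q)"
proof
  show "ostep\<^sup>*\<^sup>* (Tm P) X \<Longrightarrow> \<exists>Q. X = Tm Q \<and> pcf_step\<^sup>*\<^sup>* P Q"
  proof (induction rule: rtranclp_induct)
    case (step X Y)
    then show ?case by (cases Y) auto
  qed auto
  have "ostep\<^sup>*\<^sup>* (Tm P) (Tm Q)" if "pcf_step\<^sup>*\<^sup>* P Q" for Q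
    using that
  proof (induction rule: rtranclp_induct)
    case (step Q Q')
    then show ?case by (meson ostep.simps rtranclp.rtrancl_into_rtrancl)
  qed simp
  then show "\<exists>Q. X = Tm Q \<and> pcf_step\<^sup>*\<^sup>* P Q \<Longrightarrow> ostep\<^sup>*\<^sup>* (Tm P) X" by auto
qed

lemma ostep_Mc_rtranclp: "ostep\<^sup>*\<^sup>* (Mc M) X \<longleftrightarrow> (\<exists>N. X = Mc N \<and> step\<^sup>*\<^sup>* M N)"
proof
  show "ostep\<^sup>*\<^sup>* (Mc M) X \<Longrightarrow> \<exists>N. X = Mc N \<and> step\<^sup>*\<^sup>* M N"
  proof (induction rule: rtranclp_induct)
    case (step X Y)
    then show ?case by (cases Y) auto
  qed auto
  have "ostep\<^sup>*\<^sup>* (Mc M) (Mc N)" if "step\<^sup>*\<^sup>* M N" for N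
    using that
  proof (induction rule: rtranclp_induct)
    case (step Q Q')
    then show ?case by (meson ostep.simps rtranclp.rtrancl_into_rtrancl)
  qed simp
  then show "\<exists>N. X = Mc N \<and> step\<^sup>*\<^sup>* M N \<Longrightarrow> ostep\<^sup>*\<^sup>* (Mc M) X" by auto
qed

lemma ex_ev_Tm: "(\<exists>j. ev (Tm P) j n) \<longleftrightarrow> pcf_step\<^sup>*\<^sup>* P (num_tm n)"
  by (simp add: ex_ev_iff ostep_Tm_rtranclp oval_def)

lemma ex_ev_Mc: "(\<exists>j. ev (Mc M) j n) \<longleftrightarrow> step\<^sup>*\<^sup>* M (numeral_eam n)"
  by (simp add: ex_ev_iff ostep_Mc_rtranclp oval_def)

lemma LR_mono: "LR \<alpha> k X Y \<Longrightarrow> j \<le> k \<Longrightarrow> LR \<alpha> j X Y"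
  by (cases \<alpha>) (auto dest: less_le_trans order_trans)

lemma LR_0: "LR \<alpha> 0 X Y"
  by (induction \<alpha> arbitrary: X Y) auto

text \<open>A step on the left pays for one more unit of index. At arrow types the case
  \<open>j = 0\<close> is free by \<open>LR_0\<close>; otherwise the arguments are weakened from
  \<open>Suc i\<close> to \<open>i\<close> before the induction hypothesis gives the unit
  back.\<close>

lemma LR_step_left_Suc: "ostep X X' \<Longrightarrow> LR \<alpha> k X' Y \<Longrightarrow> LR \<alpha> (Suc k) X Y"
proof (induction \<alpha> arbitrary: k X X' Y)
  case TInt
  then show ?case by (auto simp: ev_step_iff)
next
  case (Arr \<alpha> \<beta>)
  show ?case unfolding LR.simps
  proof (intro allI impI)
    fix j A B
    assume *: "j \<le> Suc k" "is_Mc A = is_Mc X" "is_Mc B = is_Mc Y" "oty A \<alpha>" "oty B \<alpha>" "LR \<alpha> j A B"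
    show "LR \<beta> j (oapp X A) (oapp Y B)"
    proof (cases j)
      case (Suc i)
      with * Arr(3,4) have "LR \<beta> i (oapp X' A) (oapp Y B)"
        using LR_mono[OF *(6), of i] ostep_is_Mc by auto
      then show ?thesis using Suc Arr(2) ostep_oapp[OF Arr(3)] by blast
    qed (simp add: LR_0)
  qed
qed

lemma LR_step_left: "ostep X X' \<Longrightarrow> LR \<alpha> k X' Y \<Longrightarrow> LR \<alpha> k X Y"
  by (meson LR_mono LR_step_left_Suc le_SucI order_refl)

text \<open>Right-hand runs may have any length, so these steps leave the index alone.\<close>

lemma LR_step_right: "ostep Y Y' \<Longrightarrow> LR \<alpha> k X Y' \<Longrightarrow> LR \<alpha> k X Y"
proof (induction \<alpha> arbitrary: k X Y Y')
  case TInt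
  then show ?case unfolding LR.simps by (metis ev_step)
next
  case (Arr \<alpha> \<beta>)
  show ?case unfolding LR.simps
    using Arr(2,4) ostep_oapp[OF Arr(3)] ostep_is_Mc[OF Arr(3)] by (metis LR.simps(2))
qed

lemma LR_left: "ostep\<^sup>*\<^sup>* X X' \<Longrightarrow> LR \<alpha> k X' Y \<Longrightarrow> LR \<alpha> k X Y"
  by (induction rule: converse_rtranclp_induct) (auto intro: LR_step_left)

lemma LR_right: "ostep\<^sup>*\<^sup>* Y Y' \<Longrightarrow> LR \<alpha> k X Y' \<Longrightarrow> LR \<alpha> k X Y"
  by (induction rule: converse_rtranclp_induct) (auto intro: LR_step_right)

lemma LR_oval_left: "ev X i n \<Longrightarrow> LR TInt k (oval b n) X"
  by (auto simp: ev_oval)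

lemma LR_oval_right: "ev X i n \<Longrightarrow> LR TInt k X (oval b n)"
  using ev_det by (fastforce simp: ev_oval)

section \<open>Computations that start by evaluating a numeral\<close>

text \<open>\<open>E\<close> maps objects of kind \<open>b\<close> to computations that first evaluate their argument to a
  numeral \<open>v\<close> and then continue as \<open>F v\<close>.\<close>

definition forces :: "bool \<Rightarrow> ('a obj \<Rightarrow> 'a obj) \<Rightarrow> (nat \<Rightarrow> 'a obj) \<Rightarrow> bool" where
  "forces b E F \<longleftrightarrow>
     (\<forall>Z. wf_obj Z \<and> is_Mc Z = b \<longrightarrow> is_Mc (E Z) = b \<and> (\<forall>Z'. ostep Z Z' \<longrightarrow> ostep (E Z) (E Z')) \<and>
       ((\<forall>v. Z \<noteq> oval b v) \<and> (\<forall>Z'. \<not> ostep Z Z') \<longrightarrow>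
         (\<forall>As j n. \<not> ev (foldl oapp (E Z) As) j n))) \<and>
     (\<forall>v. ostep\<^sup>*\<^sup>* (E (oval b v)) (F v))"

lemma rtranclp_oapp: "ostep\<^sup>*\<^sup>* X Y \<Longrightarrow> ostep\<^sup>*\<^sup>* (oapp X A) (oapp Y A)"
proof (induction rule: rtranclp_induct)
  case (step Y Z)
  then show ?case by (meson ostep_oapp rtranclp.rtrancl_into_rtrancl)
qed simp

text \<open>The reason why \<open>forces\<close> states stuckness for all argument lists: a further
  argument is simply put in front of the list, which lets \<open>LR_forces\<close> pass through
  arrow types.\<close>

lemma forces_oapp:
  assumes "forces b E F"
  shows "forces b (\<lambda>Z. oapp (E Z) A) (\<lambda>v. oapp (F v) A)"
proof -
  have "\<not> ev (foldl oapp (oapp (E Z) A) As) j n"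
    if "wf_obj Z" "is_Mc Z = b" "\<forall>v. Z \<noteq> oval b v" "\<forall>Z'. \<not> ostep Z Z'" for Z As j n
  proof -
    have "\<not> ev (foldl oapp (E Z) (A # As)) j n"
      using that assms unfolding forces_def by blast
    then show ?thesis by simp
  qed
  then show ?thesis
    using assms unfolding forces_def by (metis is_Mc_oapp ostep_oapp rtranclp_oapp)
qed

lemma wf_oval: "wf_obj (oval b n)"
  by (auto simp: oval_def numeral_EAMs)

text \<open>A terminating run splits into one of the operand and one of the continuation. Neither is
  longer than the whole, so both stay below the same index.\<close>

lemma forces_ev_D:
  assumes "forces b E F" "wf_obj Z" "is_Mc Z = b" "ev (E Z) j n"
  shows "\<exists>v i i'. i \<le> j \<and> ev Z i v \<and> i' \<le> j \<and> ev (F v) i' n"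
  using assms(2-)
proof (induction j arbitrary: Z rule: less_induct)
  case (less j)
  show ?case
  proof (cases "\<exists>v. Z = oval b v")
    case True
    then obtain v where v: "Z = oval b v" by blast
    moreover have "ostep\<^sup>*\<^sup>* (E Z) (F v)"
      using assms(1) v by (simp add: forces_def)
    then obtain i' where "i' \<le> j" "ev (F v) i' n"
      using rtranclp_ev_le less.prems(3) by blast
    ultimately show ?thesis by (auto simp: ev_oval)
  next
    case nv: False
    show ?thesis
    proof (cases "\<exists>Z'. ostep Z Z'")
      case True
      then obtain Z' where Z': "ostep Z Z'" by blast
      with assms(1) less.prems have "ostep (E Z) (E Z')" by (auto simp: forces_def)
      with less.prems(3) obtain i where i: "j = Suc i" "ev (E Z') i n"
        by (auto simp: ev_step_iff)
      have "wf_obj Z'" "is_Mc Z' = b" using Z' less.prems ostep_wf ostep_is_Mc by auto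
      with less.IH[of i Z'] i obtain v l l' where
        "l \<le> i" "ev Z' l v" "l' \<le> i" "ev (F v) l' n" by auto
      then show ?thesis using i Z' ev_step[OF Z'] by (metis Suc_le_mono le_SucI)
    next
      case False
      with nv assms(1) less.prems have "\<not> ev (foldl oapp (E Z) []) j n"
        unfolding forces_def by blast
      then show ?thesis using less.prems by simp
    qed
  qed
qed

text \<open>The converse serves the right side of the relation, where no bound on the run is
  needed.\<close>

lemma forces_ev_I:
  assumes "forces b E F" "wf_obj Z" "is_Mc Z = b" "ev Z j v" "ev (F v) i n"
  shows "\<exists>i. ev (E Z) i n"
  using assms(2-4)
proof (induction j arbitrary: Z)
  case 0
  then have "Z = oval b v" by (simp add: ev_0)
  then have "ostep\<^sup>*\<^sup>* (E Z) (F v)" using assms(1) by (simp add: forces_def)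
  then show ?case using rtranclp_ev assms(5) by blast
next
  case (Suc j)
  then obtain Z' where Z': "ostep Z Z'" "ev Z' j v" using ev_Suc_D by blast
  with assms(1) Suc.prems have "ostep (E Z) (E Z')" by (auto simp: forces_def)
  moreover have "wf_obj Z'" "is_Mc Z' = b" using Z' Suc.prems ostep_wf ostep_is_Mc by auto
  ultimately show ?case using Suc.IH[of Z'] Z' ev_step by blast
qed

text \<open>At \<open>TInt\<close> the left run is split by \<open>forces_ev_D\<close>, both parts
  are transferred to the right and reassembled there by \<open>forces_ev_I\<close>, without loss of
  index. At arrow types the argument is absorbed into the forcing context. The continuations need to
  be related only for a numeral that both operands reach.\<close>

lemma LR_forces:
  assumes "forces b E F" "forces c G H" "wf_obj Z" "is_Mc Z = b" "wf_obj W" "is_Mc W = c"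
    "LR TInt k Z W"
    "\<And>v i j. ev Z i v \<Longrightarrow> ev W j v \<Longrightarrow> LR \<alpha> k (F v) (H v)"
  shows "LR \<alpha> k (E Z) (G W)"
  using assms
proof (induction \<alpha> arbitrary: k E F G H)
  case TInt
  show ?case unfolding LR.simps
  proof (intro allI impI)
    fix j n assume j: "j < k" "ev (E Z) j n"
    then obtain v i i' where v: "i \<le> j" "ev Z i v" "i' \<le> j" "ev (F v) i' n"
      using forces_ev_D[OF TInt(1,3,4)] by blast
    have "i < k" "i' < k" using v j(1) by auto
    then obtain l where l: "ev W l v" using TInt(7) v(2) by auto
    with TInt(8)[OF v(2) l] v(4) \<open>i' < k\<close> obtain l' where "ev (H v) l' n" by auto
    with forces_ev_I[OF TInt(2,5,6) l] show "\<exists>i. ev (G W) i n" by blast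
  qed
next
  case (Arr \<alpha> \<beta>)
  show ?case unfolding LR.simps
  proof (intro allI impI)
    fix j A B
    assume *: "j \<le> k" "is_Mc A = is_Mc (E Z)" "is_Mc B = is_Mc (G W)" "oty A \<alpha>" "oty B \<alpha>" "LR \<alpha> j A B"
    have E: "is_Mc (E Z) = b" "is_Mc (G W) = c"
      using Arr.prems(1-6) by (auto simp: forces_def)
    have F: "is_Mc (F v) = b" "is_Mc (H v) = c" if "ev Z i v" for v i
    proof -
      have "ostep\<^sup>*\<^sup>* X Y \<Longrightarrow> is_Mc Y = is_Mc X" for X Y
        by (induction rule: rtranclp_induct) (auto dest: ostep_is_Mc)
      moreover have "is_Mc (E (oval b v)) = b" "ostep\<^sup>*\<^sup>* (E (oval b v)) (F v)"
          "is_Mc (G (oval c v)) = c" "ostep\<^sup>*\<^sup>* (G (oval c v)) (H v)"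
        using Arr.prems(1,2) wf_oval by (auto simp: forces_def)
      ultimately show "is_Mc (F v) = b" "is_Mc (H v) = c" by auto
    qed
    show "LR \<beta> j (oapp (E Z) A) (oapp (G W) B)"
    proof (rule Arr.IH(2)[OF forces_oapp[OF Arr.prems(1)] forces_oapp[OF Arr.prems(2)] Arr.prems(3-6)])
      show "LR TInt j Z W" using LR_mono[OF Arr.prems(7)] * by blast
      fix v i l assume "ev Z i v" "ev W l v"
      from Arr.prems(8)[OF this] F[OF this(1)] * E
      show "LR \<beta> j (oapp (F v) A) (oapp (H v) B)" by auto
    qed
  qed
qed

end

section \<open>Typing and execution of the translation\<close>

lemma get_map_Some: "get (map Some xs) i = Some v \<longleftrightarrow> i < length xs \<and> xs ! i = v"
  by (auto simp: get_def)

lemma list_update_get: "get R i = Some v \<Longrightarrow> R[i := Some v] = R"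
  by (metis get_def list_update_id option.distinct(1))

context address_table_map
begin

text \<open>The registers typed by \<open>\<Delta>\<close> play the part of the initialised ones.
  \<open>\<Delta>\<close> is nonempty because typed code ends in a \<open>Call\<close>, whose
  register has a type; no rule types \<open>Stop\<close>.\<close>

lemma code_ty_valid: "code_ty \<Delta> P T \<alpha> \<Longrightarrow> \<Delta> \<noteq> [] \<and> valid (length \<Delta>) {i. \<exists>v. get \<Delta> i = Some v} P"
proof (induction rule: eam_ty_code_ty.inducts(2)[where ?P1.0 = "\<lambda>_ _. True"])
  have *: "{j. \<exists>v. get (\<Delta>[i := Some a]) j = Some v} =
      {j. \<exists>v. get \<Delta> j = Some v} \<union> ({i} \<inter> {..<length \<Delta>})" for \<Delta> :: "ty option list" and i a
    by (auto simp: get_list_update)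
  {
    case ty_load_empty
    then show ?case by (simp add: *)
  next
    case ty_load
    then show ?case by (simp add: *)
  next
    case ty_app
    then show ?case by (simp add: *)
  next
    case ty_pred
    then show ?case by (simp add: *)
  next
    case ty_succ
    then show ?case by (simp add: *)
  next
    case ty_test
    then show ?case by (simp add: *)
  next
    case ty_call
    then show ?case by (auto dest: get_less)
  }
qed auto

lemma eam_ty_EAMs: "eam_ty M \<alpha> \<Longrightarrow> M \<in> EAMs"
proof (induction rule: eam_ty.cases)
  case (ty_eam R \<Delta> P T \<alpha>)
  have "length R = length \<Delta>" "\<And>i. (\<exists>v. get R i = Some v) \<longleftrightarrow> (\<exists>v. get \<Delta> i = Some v)"
    using ty_eam(3) unfolding get_def list_all2_conv_all_nth option_rel_Some1
    by (auto, (metis option.rel_cases option.distinct(1))+)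
  then show ?case using ty_eam code_ty_valid[OF ty_eam(4)]
    by (auto simp: EAMs_def)
qed (auto simp: numeral_EAMs Y_EAMs)

lemma mach_addr_ty [simp]: "eam_ty M \<alpha> \<Longrightarrow> mach (addr M) = M"
  by (simp add: eam_ty_EAMs)

text \<open>\<open>Y_eam y\<close> has its type by \<open>ty_fix\<close>, a rule for the empty tape.
  With an argument on the tape its program is typed by the ordinary rules, where the register
  holding \<open>y\<close> gets its type from \<open>ty_fix\<close> again. For a call, the new input
  adds a last argument type to the list \<open>\<beta>s\<close>.\<close>

lemma eam_ty_app1: "eam_ty M (\<alpha> \<rightarrow> \<beta>) \<Longrightarrow> eam_ty (mach b) \<alpha> \<Longrightarrow> eam_ty (M @@ [b]) \<beta>"
  and code_ty_app1: "code_ty \<Delta> P T (\<alpha> \<rightarrow> \<beta>) \<Longrightarrow> eam_ty (mach b) \<alpha> \<Longrightarrow> code_ty \<Delta> P (T @ [b]) \<beta>"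
proof (induction M "\<alpha> \<rightarrow> \<beta>" and \<Delta> P T "\<alpha> \<rightarrow> \<beta>" arbitrary: \<alpha> \<beta> and \<alpha> \<beta> rule: eam_ty_code_ty.inducts)
  case (ty_fix \<alpha>)
  let ?\<Delta> = "[None, Some ((\<alpha> \<rightarrow> \<alpha>) \<rightarrow> \<alpha>)]"
  have "code_ty (?\<Delta>[0 := Some (\<alpha> \<rightarrow> \<alpha>), 1 := Some \<alpha>, 0 := Some \<alpha>]) (Run (Call 0)) [] \<alpha>"
    using ty_call[of _ 0 "[]"] by (simp add: get_def)
  then have "code_ty (?\<Delta>[0 := Some (\<alpha> \<rightarrow> \<alpha>)]) (Run (AppI 1 1 0 (AppI 0 0 1 (Call 0)))) [] \<alpha>"
    by (intro ty_app) (auto simp: get_def)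
  then have "code_ty ?\<Delta> (Load 0 (Run (AppI 1 1 0 (AppI 0 0 1 (Call 0))))) [b] \<alpha>"
    using ty_fix by (intro ty_load)
  then show ?case
    unfolding Y_eam_def EAM_app_tape append_Nil
    by (rule ty_eam[rotated]) (simp add: eam_ty_code_ty.ty_fix)
next
  case (ty_eam R \<Delta> P T)
  have "list_all2 (rel_option (\<lambda>a \<beta>. eam_ty (mach a) \<beta>)) R \<Delta>"
    by (rule list.rel_mono_strong[OF ty_eam(1)]) (auto elim!: option.rel_mono_strong)
  with ty_eam show ?case by (auto intro: eam_ty_code_ty.ty_eam)
next
  case (ty_call \<Delta> i \<beta>s T)
  then have "get \<Delta> i = Some (arrs (\<beta>s @ [\<alpha>]) \<beta>)" by simp
  then show ?case
    by (rule eam_ty_code_ty.ty_call)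
      (use ty_call in \<open>auto intro!: list_all2_appendI elim!: list.rel_mono_strong\<close>)
qed (auto intro: eam_ty_code_ty.intros)

lemma eam_ty_app:
  "list_all2 (\<lambda>a \<beta>. eam_ty (mach a) \<beta>) as \<beta>s \<Longrightarrow> eam_ty M (arrs \<beta>s \<alpha>) \<Longrightarrow> eam_ty (M @@ as) \<alpha>"
proof (induction arbitrary: M rule: list_all2_induct)
  case (Cons a as \<beta> \<beta>s)
  then show ?case using eam_ty_app1[of M \<beta> _ a] Cons(3)[of "M @@ [a]"] by simp
qed simp

text \<open>The split of the registers into a finished prefix and a rest still to be overwritten is
  what the induction needs: each load moves the border one place to the right.\<close>

lemma code_ty_loads:
  "code_ty (\<Delta>0 @ map Some \<beta>s @ drop (length \<beta>s) \<Delta>1) (Run A) [] \<alpha> \<Longrightarrow> length \<beta>s \<le> length \<Delta>1 \<Longrightarrow>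
   code_ty (\<Delta>0 @ \<Delta>1) (foldr Load [length \<Delta>0..<length \<Delta>0 + length \<beta>s] (Run A)) [] (arrs \<beta>s \<alpha>)"
proof (induction \<beta>s arbitrary: \<Delta>0 \<Delta>1)
  case (Cons \<beta> \<beta>s)
  then obtain d \<Delta>2 where \<Delta>1: "\<Delta>1 = d # \<Delta>2" by (cases \<Delta>1) auto
  have "code_ty ((\<Delta>0 @ [Some \<beta>]) @ \<Delta>2)
      (foldr Load [length (\<Delta>0 @ [Some \<beta>])..<length (\<Delta>0 @ [Some \<beta>]) + length \<beta>s] (Run A)) [] (arrs \<beta>s \<alpha>)"
    using Cons.prems \<Delta>1 by (intro Cons.IH) auto
  then show ?case
    using \<Delta>1 by (auto simp: upt_conv_Cons simp del: upt_Suc intro!: ty_load_empty)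
qed simp

lemma steps_loads:
  "length T \<le> length R1 \<Longrightarrow>
   step\<^sup>*\<^sup>* (EAM (R0 @ R1) (foldr Load [length R0..<length R0 + length T] (Run A)) (T @ T'))
     (EAM (R0 @ map Some T @ drop (length T) R1) (Run A) T')"
proof (induction T arbitrary: R0 R1)
  case (Cons a T)
  then obtain d R2 where R1: "R1 = d # R2" by (cases R1) auto
  have "step\<^sup>*\<^sup>* (EAM ((R0 @ [Some a]) @ R2)
      (foldr Load [length (R0 @ [Some a])..<length (R0 @ [Some a]) + length T] (Run A)) (T @ T'))
     (EAM ((R0 @ [Some a]) @ map Some T @ drop (length T) R2) (Run A) T')"
    using Cons.prems R1 by (intro Cons.IH) auto
  moreover have "step (EAM (R0 @ R1) (foldr Load [length R0..<length R0 + length (a # T)] (Run A)) (a # T @ T'))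
    (EAM ((R0 @ [Some a]) @ R2)
      (foldr Load [length (R0 @ [Some a])..<length (R0 @ [Some a]) + length T] (Run A)) (T @ T'))"
    using step.intros(2)[of "R0 @ R1" "length R0"] R1
    by (simp add: upt_conv_Cons del: upt_Suc)
  ultimately show ?case by (simp add: R1 converse_rtranclp_into_rtranclp)
qed simp

text \<open>The common frame of the translation machines. The preloaded registers \<open>ex\<close>
  are there for the fixed-point machine, which keeps \<open>addr (Y_eam y)\<close> behind its
  inputs.\<close>

lemma combinator_ty:
  assumes "code_ty (map Some (\<beta>s @ \<delta>s)) (Run A) [] \<alpha>"
    "list_all2 (\<lambda>a \<beta>. eam_ty (mach a) \<beta>) ex \<delta>s"
  shows "eam_ty (EAM (replicate (length \<beta>s) None @ map Some ex) (loads (length \<beta>s) A) []) (arrs \<beta>s \<alpha>)"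
proof (rule ty_eam)
  show "list_all2 (rel_option (\<lambda>a \<beta>. eam_ty (mach a) \<beta>)) (replicate (length \<beta>s) None @ map Some ex)
     (replicate (length \<beta>s) None @ map Some \<delta>s)"
    using assms(2) by (intro list_all2_appendI) (auto simp: list_all2_conv_all_nth)
  show "code_ty (replicate (length \<beta>s) None @ map Some \<delta>s) (loads (length \<beta>s) A) [] (arrs \<beta>s \<alpha>)"
    using code_ty_loads[of "[]" \<beta>s "replicate (length \<beta>s) None @ map Some \<delta>s"] assms(1)
    by (simp add: loads_def)
qed

lemma combinator_steps:
  "step\<^sup>*\<^sup>* (EAM (replicate (length as) None @ map Some ex) (loads (length as) A) as)
     (EAM (map Some (as @ ex)) (Run A) [])"
  using steps_loads[of as "replicate (length as) None @ map Some ex" "[]" A "[]"]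
  by (simp add: loads_def)

text \<open>Register \<open>k\<close> accumulates the partial application, so its type loses one
  argument per instruction; \<open>k \<notin> set js\<close> keeps the arguments intact
  meanwhile.\<close>

lemma code_ty_spread:
  assumes "list_all2 (\<lambda>j \<beta>. get \<Delta> j = Some \<beta>) js \<beta>s" "get \<Delta> k = Some (arrs \<beta>s \<gamma>)" "k \<notin> set js"
    "code_ty (\<Delta>[k := Some \<gamma>]) (Run A) T \<alpha>"
  shows "code_ty \<Delta> (Run (spread k js A)) T \<alpha>"
  using assms
proof (induction js arbitrary: \<beta>s \<Delta>)
  case Nil
  then have "\<Delta>[k := Some \<gamma>] = \<Delta>"
    by (simp add: list_update_get)
  with Nil show ?case by (simp add: spread_def)
next
  case (Cons j js)
  then obtain \<beta> \<beta>s' where \<beta>s: "\<beta>s = \<beta> # \<beta>s'" by (auto simp: list_all2_Cons1)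
  have "code_ty (\<Delta>[k := Some (arrs \<beta>s' \<gamma>)]) (Run (spread k js A)) T \<alpha>"
    using Cons.prems \<beta>s get_less[OF Cons.prems(2)]
    by (intro Cons.IH[of _ \<beta>s']) (auto simp: get_list_update elim!: list.rel_mono_strong)
  then show ?case
    using Cons.prems \<beta>s by (auto simp: spread_def intro!: ty_app)
qed

lemma steps_spread:
  assumes "list_all2 (\<lambda>j a. get R j = Some a) js as" "get R k = Some c" "k \<notin> set js"
  shows "step\<^sup>*\<^sup>* (EAM R (Run (spread k js A)) T) (EAM (R[k := Some (addr (mach c @@ as))]) (Run A) T)"
  using assms
proof (induction js arbitrary: as R c)
  case Nil
  then have "R[k := Some c] = R"
    by (simp add: list_update_get)
  with Nil show ?case by (simp add: spread_def)
next
  case (Cons j js)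
  then obtain a as' where as: "as = a # as'" by (auto simp: list_all2_Cons1)
  have "step\<^sup>*\<^sup>* (EAM (R[k := Some (c \<cdot> a)]) (Run (spread k js A)) T)
     (EAM (R[k := Some (c \<cdot> a), k := Some (addr (mach (c \<cdot> a) @@ as'))]) (Run A) T)"
    using Cons.prems as get_less[OF Cons.prems(2)]
    by (intro Cons.IH) (auto simp: get_list_update elim!: list.rel_mono_strong)
  moreover have "step (EAM R (Run (spread k (j # js) A)) T) (EAM (R[k := Some (c \<cdot> a)]) (Run (spread k js A)) T)"
    using Cons.prems as by (auto simp: spread_def intro!: step.intros)
  ultimately show ?case by (simp add: as converse_rtranclp_into_rtranclp)
qed

end

lemma get_block:
  "length xs = i \<Longrightarrow> m = i + length as \<Longrightarrow>
   list_all2 (\<lambda>j a. get (map Some (xs @ as @ ys)) j = Some a) [i..<m] as"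
  by (auto simp: list_all2_conv_all_nth get_map_Some nth_append simp del: map_append)

context address_table_map
begin

lemma code_ty_spread_block:
  assumes "code_ty (map Some (xs[k := \<gamma>] @ \<beta>s @ ys)) (Run A) T \<alpha>"
    "length xs = i" "m = i + length \<beta>s" "k < i" "xs ! k = arrs \<beta>s \<gamma>"
  shows "code_ty (map Some (xs @ \<beta>s @ ys)) (Run (spread k [i..<m] A)) T \<alpha>"
proof (rule code_ty_spread)
  show "list_all2 (\<lambda>j a. get (map Some (xs @ \<beta>s @ ys)) j = Some a) [i..<m] \<beta>s"
    using assms by (intro get_block)
  show "get (map Some (xs @ \<beta>s @ ys)) k = Some (arrs \<beta>s \<gamma>)"
    using assms by (simp add: get_map_Some nth_append del: map_append)
  show "code_ty ((map Some (xs @ \<beta>s @ ys))[k := Some \<gamma>]) (Run A) T \<alpha>"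
    using assms by (simp add: list_update_append map_update)
qed (use assms in simp)

lemma steps_spread_block:
  assumes "length xs = i" "m = i + length as" "k < i" "xs ! k = c"
  shows "step\<^sup>*\<^sup>* (EAM (map Some (xs @ as @ ys)) (Run (spread k [i..<m] A)) T)
    (EAM (map Some (xs[k := addr (mach c @@ as)] @ as @ ys)) (Run A) T)"
proof -
  have "get (map Some (xs @ as @ ys)) k = Some c"
    using assms by (simp add: get_map_Some nth_append del: map_append)
  from steps_spread[OF get_block[OF assms(1,2)] this, of A T] show ?thesis
    using assms by (simp add: list_update_append map_update)
qed

section \<open>Types of the translation machines\<close>

lemma Proj_ty: "i < length \<beta>s \<Longrightarrow> eam_ty (Proj_eam (length \<beta>s) i) (arrs \<beta>s (\<beta>s ! i))"
  using combinator_ty[of \<beta>s "[]" "Call i" "\<beta>s ! i" "[]"] ty_call[of "map Some \<beta>s" i "[]" "\<beta>s ! i"]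
  by (simp add: Proj_eam_def get_map_Some)

lemma Apply_ty:
  "eam_ty (Apply_eam (length \<beta>s)) (arrs (arrs \<beta>s (\<alpha> \<rightarrow> \<beta>) # arrs \<beta>s \<alpha> # \<beta>s) \<beta>)"
proof -
  let ?js = "[2..<length \<beta>s + 2]"
  have "code_ty (map Some ([\<alpha> \<rightarrow> \<beta>, \<alpha>] @ \<beta>s @ [])) (Run (AppI 0 0 1 (Call 0))) [] \<beta>"
    by (intro ty_app[where \<beta> = \<alpha> and \<gamma> = \<beta>] ty_call[where \<beta>s = "[]"]) (auto simp: get_def)
  then have "code_ty (map Some ([\<alpha> \<rightarrow> \<beta>, arrs \<beta>s \<alpha>] @ \<beta>s @ [])) (Run (spread 1 ?js (AppI 0 0 1 (Call 0)))) [] \<beta>"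
    by - (rule code_ty_spread_block[where \<gamma> = \<alpha>], auto simp: numeral_2_eq_2 simp del: upt_Suc)
  then have "code_ty (map Some ([arrs \<beta>s (\<alpha> \<rightarrow> \<beta>), arrs \<beta>s \<alpha>] @ \<beta>s @ []))
      (Run (spread 0 ?js (spread 1 ?js (AppI 0 0 1 (Call 0))))) [] \<beta>"
    by - (rule code_ty_spread_block[where \<gamma> = "\<alpha> \<rightarrow> \<beta>"], auto simp: numeral_2_eq_2 simp del: upt_Suc)
  then show ?thesis
    using combinator_ty[of "arrs \<beta>s (\<alpha> \<rightarrow> \<beta>) # arrs \<beta>s \<alpha> # \<beta>s" "[]" _ \<beta> "[]"]
    by (simp add: Apply_eam_def)
qed

lemma Pred_ty: "eam_ty (Pred_eam (length \<beta>s)) (arrs (arrs \<beta>s TInt # \<beta>s) TInt)"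
proof -
  have "code_ty (map Some ([TInt] @ \<beta>s @ [])) (Run (PredI 0 0 (Call 0))) [] TInt"
    by (intro ty_pred ty_call[where \<beta>s = "[]"]) (auto simp: get_def)
  then have "code_ty (map Some ([arrs \<beta>s TInt] @ \<beta>s @ [])) (Run (spread 0 [1..<length \<beta>s + 1]
      (PredI 0 0 (Call 0)))) [] TInt"
    by - (rule code_ty_spread_block[where \<gamma> = TInt], auto simp: numeral_2_eq_2 simp del: upt_Suc)
  then show ?thesis
    using combinator_ty[of "arrs \<beta>s TInt # \<beta>s" "[]" _ TInt "[]"] by (simp add: Pred_eam_def)
qed

lemma Succ_ty: "eam_ty (Succ_eam (length \<beta>s)) (arrs (arrs \<beta>s TInt # \<beta>s) TInt)"
proof -
  have "code_ty (map Some ([TInt] @ \<beta>s @ [])) (Run (SuccI 0 0 (Call 0))) [] TInt"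
    by (intro ty_succ ty_call[where \<beta>s = "[]"]) (auto simp: get_def)
  then have "code_ty (map Some ([arrs \<beta>s TInt] @ \<beta>s @ [])) (Run (spread 0 [1..<length \<beta>s + 1]
      (SuccI 0 0 (Call 0)))) [] TInt"
    by - (rule code_ty_spread_block[where \<gamma> = TInt], auto simp: numeral_2_eq_2 simp del: upt_Suc)
  then show ?thesis
    using combinator_ty[of "arrs \<beta>s TInt # \<beta>s" "[]" _ TInt "[]"] by (simp add: Succ_eam_def)
qed

lemma Ifz_ty:
  "eam_ty (Ifz_eam (length \<beta>s)) (arrs (arrs \<beta>s TInt # arrs \<beta>s \<alpha> # arrs \<beta>s \<alpha> # \<beta>s) \<alpha>)"
proof -
  let ?js = "[3..<length \<beta>s + 3]" and ?b = "arrs \<beta>s \<alpha>" and ?A = "TestI 0 0 1 2 (Call 0)"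
  have "code_ty (map Some ([TInt, \<alpha>, \<alpha>] @ \<beta>s @ [])) (Run ?A) [] \<alpha>"
    by (intro ty_test[where \<beta> = \<alpha>] ty_call[where \<beta>s = "[]"]) (auto simp: get_def)
  then have "code_ty (map Some ([TInt, \<alpha>, ?b] @ \<beta>s @ [])) (Run (spread 2 ?js ?A)) [] \<alpha>"
    by - (rule code_ty_spread_block[where \<gamma> = \<alpha>], auto simp: numeral_2_eq_2 simp del: upt_Suc)
  then have "code_ty (map Some ([TInt, ?b, ?b] @ \<beta>s @ [])) (Run (spread 1 ?js (spread 2 ?js ?A))) [] \<alpha>"
    by - (rule code_ty_spread_block[where \<gamma> = \<alpha>], auto simp: numeral_2_eq_2 simp del: upt_Suc)
  then have "code_ty (map Some ([arrs \<beta>s TInt, ?b, ?b] @ \<beta>s @ []))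
      (Run (spread 0 ?js (spread 1 ?js (spread 2 ?js ?A)))) [] \<alpha>"
    by - (rule code_ty_spread_block[where \<gamma> = TInt], auto simp: numeral_2_eq_2 simp del: upt_Suc)
  then show ?thesis
    using combinator_ty[of "arrs \<beta>s TInt # ?b # ?b # \<beta>s" "[]" _ \<alpha> "[]"]
    by (simp add: Ifz_eam_def numeral_3_eq_3)
qed

lemma Fix_ty: "eam_ty (Fix_eam (length \<beta>s)) (arrs (arrs \<beta>s (\<alpha> \<rightarrow> \<alpha>) # \<beta>s) \<alpha>)"
proof -
  let ?f = "(\<alpha> \<rightarrow> \<alpha>) \<rightarrow> \<alpha>" and ?A = "AppI 0 (length \<beta>s + 1) 0 (Call 0)"
  have "code_ty (map Some ([\<alpha> \<rightarrow> \<alpha>] @ \<beta>s @ [?f])) (Run ?A) [] \<alpha>"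
    by (intro ty_app[where \<beta> = "\<alpha> \<rightarrow> \<alpha>" and \<gamma> = \<alpha>] ty_call[where \<beta>s = "[]"])
      (auto simp: get_def nth_append)
  then have "code_ty (map Some ([arrs \<beta>s (\<alpha> \<rightarrow> \<alpha>)] @ \<beta>s @ [?f]))
      (Run (spread 0 [1..<length \<beta>s + 1] ?A)) [] \<alpha>"
    by - (rule code_ty_spread_block[where \<gamma> = "\<alpha> \<rightarrow> \<alpha>"], auto simp: numeral_2_eq_2 simp del: upt_Suc)
  moreover have "list_all2 (\<lambda>a \<beta>. eam_ty (mach a) \<beta>) [addr (Y_eam y)] [?f]"
    by (simp add: addr_Y ty_fix)
  ultimately show ?thesis
    using combinator_ty[of "arrs \<beta>s (\<alpha> \<rightarrow> \<alpha>) # \<beta>s" "[?f]" _ \<alpha> "[addr (Y_eam y)]"]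
    by (simp add: Fix_eam_def)
qed

lemma eam_ty_app_addr:
  "eam_ty M (\<alpha> \<rightarrow> \<beta>) \<Longrightarrow> eam_ty N \<alpha> \<Longrightarrow> eam_ty (M @@ [addr N]) \<beta>"
  by (simp add: eam_ty_app1)

text \<open>An environment lists the innermost variable first, the tape receives the outermost
  first, hence \<open>rev\<close>. Abstraction is immediate: its machine is that of the body, which
  expects one more input.\<close>

lemma Tr_ty: "has_ty \<Gamma> P \<alpha> \<Longrightarrow> eam_ty (Tr (length \<Gamma>) P) (arrs (rev \<Gamma>) \<alpha>)"
proof (induction rule: has_ty.induct)
  case (1 i \<Gamma>)
  then show ?case using Proj_ty[of "length \<Gamma> - 1 - i" "rev \<Gamma>"] by (simp add: rev_nth)
next
  case (2 \<Gamma> P \<alpha> \<beta> Q)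
  then show ?case using Apply_ty[of "rev \<Gamma>" \<alpha> \<beta>]
      eam_ty_app_addr[OF eam_ty_app_addr, of "Apply_eam (length \<Gamma>)"] by simp
next
  case (3 \<alpha> \<Gamma> P \<beta>)
  then show ?case by simp
next
  case (4 \<Gamma>)
  show ?case
    using Proj_ty[of 0 "TInt # rev \<Gamma>"] ty_num
      eam_ty_app1[of "Proj_eam (Suc (length \<Gamma>)) 0" TInt] by simp
next
  case (5 \<Gamma> P)
  then show ?case using Pred_ty[of "rev \<Gamma>"]
      eam_ty_app_addr[of "Pred_eam (length \<Gamma>)"] by simp
next
  case (6 \<Gamma> P)
  then show ?case using Succ_ty[of "rev \<Gamma>"]
      eam_ty_app_addr[of "Succ_eam (length \<Gamma>)"] by simp
next
  case (7 \<Gamma> P Q \<alpha> Q')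
  then show ?case using Ifz_ty[of "rev \<Gamma>" \<alpha>]
      eam_ty_app_addr[OF eam_ty_app_addr, OF eam_ty_app_addr, of "Ifz_eam (length \<Gamma>)"] by simp
next
  case (8 \<Gamma> P \<alpha>)
  then show ?case using Fix_ty[of "rev \<Gamma>" \<alpha>]
      eam_ty_app_addr[of "Fix_eam (length \<Gamma>)"] by simp
qed

section \<open>Runs of the translation machines on complete input\<close>

lemma step_Call: "get R i = Some a \<Longrightarrow> step (EAM R (Run (Call i)) []) (mach a)"
  using step.intros(1)[of R i a "[]"] by simp

lemma Proj_steps: "i < length as \<Longrightarrow> step\<^sup>*\<^sup>* (Proj_eam (length as) i @@ as) (mach (as ! i))"
  using combinator_steps[of as "[]" "Call i"] step_Call[of "map Some as" i "as ! i"]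
  by (simp add: Proj_eam_def get_map_Some rtranclp.rtrancl_into_rtrancl)

lemma Apply_steps:
  "step\<^sup>*\<^sup>* (Apply_eam (length as) @@ (p # q # as)) (mach p @@ (as @ [addr (mach q @@ as)]))"
proof -
  let ?js = "[2..<length as + 2]"
  let ?A = "AppI 0 0 1 (Call 0)"
  let ?p = "addr (mach p @@ as)" and ?q = "addr (mach q @@ as)"
  have "step\<^sup>*\<^sup>* (Apply_eam (length as) @@ (p # q # as))
      (EAM (map Some (p # q # as)) (Run (spread 0 ?js (spread 1 ?js ?A))) [])"
    using combinator_steps[of "p # q # as" "[]"] by (simp add: Apply_eam_def)
  also have "step\<^sup>*\<^sup>* \<dots> (EAM (map Some (?p # q # as)) (Run (spread 1 ?js ?A)) [])"
    using steps_spread_block[of "[p, q]" 2 "length as + 2" as 0 p "[]"]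
    by (simp add: numeral_2_eq_2 numeral_3_eq_3 del: upt_Suc)
  also have "step\<^sup>*\<^sup>* \<dots> (EAM (map Some (?p # ?q # as)) (Run ?A) [])"
    using steps_spread_block[of "[?p, q]" 2 "length as + 2" as 1 q "[]"]
    by (simp add: numeral_2_eq_2 numeral_3_eq_3 del: upt_Suc)
  also have "step \<dots> (EAM (map Some ((?p \<cdot> ?q) # ?q # as)) (Run (Call 0)) [])"
    using step.intros(3)[of "map Some (?p # ?q # as)" 0 ?p 1 ?q 0] by (simp add: get_def)
  also have "step \<dots> (mach (?p \<cdot> ?q))"
    by (rule step_Call) (simp add: get_def)
  finally show ?thesis by simp
qed

text \<open>The run is followed only up to the arithmetic instruction. Whether that ever completes
  depends on the operand, which is the business of \<open>forces_PredI\<close>.\<close>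

lemma Pred_steps:
  "step\<^sup>*\<^sup>* (Pred_eam (length as) @@ (p # as))
     (EAM (map Some (addr (mach p @@ as) # as)) (Run (PredI 0 0 (Call 0))) [])"
proof -
  let ?js = "[1..<length as + 1]"
  have "step\<^sup>*\<^sup>* (Pred_eam (length as) @@ (p # as))
      (EAM (map Some (p # as)) (Run (spread 0 ?js (PredI 0 0 (Call 0)))) [])"
    using combinator_steps[of "p # as" "[]"] by (simp add: Pred_eam_def)
  also have "step\<^sup>*\<^sup>* \<dots> (EAM (map Some (addr (mach p @@ as) # as)) (Run (PredI 0 0 (Call 0))) [])"
    using steps_spread_block[of "[p]" 1 "length as + 1" as 0 p "[]"]
    by (simp add: numeral_2_eq_2 numeral_3_eq_3 del: upt_Suc)
  finally show ?thesis .
qed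

lemma Succ_steps:
  "step\<^sup>*\<^sup>* (Succ_eam (length as) @@ (p # as))
     (EAM (map Some (addr (mach p @@ as) # as)) (Run (SuccI 0 0 (Call 0))) [])"
proof -
  let ?js = "[1..<length as + 1]"
  have "step\<^sup>*\<^sup>* (Succ_eam (length as) @@ (p # as))
      (EAM (map Some (p # as)) (Run (spread 0 ?js (SuccI 0 0 (Call 0)))) [])"
    using combinator_steps[of "p # as" "[]"] by (simp add: Succ_eam_def)
  also have "step\<^sup>*\<^sup>* \<dots> (EAM (map Some (addr (mach p @@ as) # as)) (Run (SuccI 0 0 (Call 0))) [])"
    using steps_spread_block[of "[p]" 1 "length as + 1" as 0 p "[]"]
    by (simp add: numeral_2_eq_2 numeral_3_eq_3 del: upt_Suc)
  finally show ?thesis .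
qed

lemma Ifz_steps:
  "step\<^sup>*\<^sup>* (Ifz_eam (length as) @@ (p # q # r # as))
     (EAM (map Some (addr (mach p @@ as) # addr (mach q @@ as) # addr (mach r @@ as) # as))
       (Run (TestI 0 0 1 2 (Call 0))) [])"
proof -
  define js where "js = [3..<length as + 3]"
  let ?A = "TestI 0 0 1 2 (Call 0)"
  let ?p = "addr (mach p @@ as)" and ?q = "addr (mach q @@ as)" and ?r = "addr (mach r @@ as)"
  have len: "length (p # q # r # as) = length as + 3" by simp
  have spread: "step\<^sup>*\<^sup>* (EAM (map Some (xs @ as)) (Run (spread k js A)) [])
      (EAM (map Some (xs[k := addr (mach (xs ! k) @@ as)] @ as)) (Run A) [])"
    if "length xs = 3" "k < 3" for xs k A
    using steps_spread_block[OF that(1) _ that(2) refl, of _ as "[]"]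
    by (simp only: js_def append_Nil2 add.commute)
  have "step\<^sup>*\<^sup>* (Ifz_eam (length as) @@ (p # q # r # as))
      (EAM (map Some (p # q # r # as)) (Run (spread 0 js (spread 1 js (spread 2 js ?A)))) [])"
    using combinator_steps[of "p # q # r # as" "[]", unfolded len]
    by (simp add: Ifz_eam_def js_def del: upt_Suc)
  also have "step\<^sup>*\<^sup>* \<dots> (EAM (map Some (?p # q # r # as)) (Run (spread 1 js (spread 2 js ?A))) [])"
    using spread[of "[p, q, r]" 0] by simp
  also have "step\<^sup>*\<^sup>* \<dots> (EAM (map Some (?p # ?q # r # as)) (Run (spread 2 js ?A)) [])"
    using spread[of "[?p, q, r]" 1] by simp
  also have "step\<^sup>*\<^sup>* \<dots> (EAM (map Some (?p # ?q # ?r # as)) (Run ?A) [])"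
    using spread[of "[?p, ?q, r]" 2] by (simp add: numeral_2_eq_2)
  finally show ?thesis .
qed

lemma Fix_steps:
  "step\<^sup>*\<^sup>* (Fix_eam (length as) @@ (p # as)) (Y_eam y @@ [addr (mach p @@ as)])"
proof -
  let ?js = "[1..<length as + 1]"
  let ?A = "AppI 0 (length as + 1) 0 (Call 0)"
  let ?p = "addr (mach p @@ as)"
  have "step\<^sup>*\<^sup>* (Fix_eam (length as) @@ (p # as)) (EAM (map Some (p # as @ [y])) (Run (spread 0 ?js ?A)) [])"
    using combinator_steps[of "p # as" "[y]"] by (simp add: Fix_eam_def addr_Y)
  also have "step\<^sup>*\<^sup>* \<dots> (EAM (map Some (?p # as @ [y])) (Run ?A) [])"
    using steps_spread_block[of "[p]" 1 "length as + 1" as 0 p "[y]"]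
    by (simp del: upt_Suc)
  also have "step \<dots> (EAM (map Some ((y \<cdot> ?p) # as @ [y])) (Run (Call 0)) [])"
    using step.intros(3)[of "map Some (?p # as @ [y])" "length as + 1" y 0 ?p 0]
    by (simp add: get_def nth_append)
  also have "step \<dots> (mach (y \<cdot> ?p))"
    by (rule step_Call) (simp add: get_def)
  finally show ?thesis by simp
qed

end

section \<open>Relating machines and terms\<close>

context address_table_map
begin

text \<open>The Boolean selects the direction, so that both approximations between a machine and a
  term come out of one proof.\<close>

definition sim :: "bool \<Rightarrow> ty \<Rightarrow> nat \<Rightarrow> 'a eam \<Rightarrow> tm \<Rightarrow> bool" where
  "sim d \<alpha> k M P \<longleftrightarrow> (if d then LR \<alpha> k (Mc M) (Tm P) else LR \<alpha> k (Tm P) (Mc M))"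

definition arel :: "bool \<Rightarrow> ty \<Rightarrow> nat \<Rightarrow> 'a \<Rightarrow> tm \<Rightarrow> bool" where
  "arel d \<alpha> k a P \<longleftrightarrow> eam_ty (mach a) \<alpha> \<and> has_ty [] P \<alpha> \<and> sim d \<alpha> k (mach a) P"

lemma sim_mono: "sim d \<alpha> k M P \<Longrightarrow> j \<le> k \<Longrightarrow> sim d \<alpha> j M P"
  using LR_mono by (auto simp: sim_def)

lemma arel_mono: "arel d \<alpha> k a P \<Longrightarrow> j \<le> k \<Longrightarrow> arel d \<alpha> j a P"
  using sim_mono by (auto simp: arel_def)

lemma sim_Mc: "step\<^sup>*\<^sup>* M M' \<Longrightarrow> sim d \<alpha> k M' P \<Longrightarrow> sim d \<alpha> k M P"
  using LR_left[of "Mc M" "Mc M'"] LR_right[of "Mc M" "Mc M'"]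
  by (auto simp: sim_def ostep_Mc_rtranclp)

lemma sim_Tm: "pcf_step\<^sup>*\<^sup>* P P' \<Longrightarrow> sim d \<alpha> k M P' \<Longrightarrow> sim d \<alpha> k M P"
  using LR_left[of "Tm P" "Tm P'"] LR_right[of "Tm P" "Tm P'"]
  by (auto simp: sim_def ostep_Tm_rtranclp)

text \<open>Either side may be the one whose steps count, so each of them has to make a step before
  the index may grow.\<close>

lemma sim_Suc:
  assumes "step M M'" "step\<^sup>*\<^sup>* M' M''" "pcf_step P P'" "sim d \<alpha> k M'' P'"
  shows "sim d \<alpha> (Suc k) M P"
proof -
  have "sim d \<alpha> k M' P'" using sim_Mc assms by blast
  then show ?thesis
    using LR_step_left_Suc[of "Mc M" "Mc M'"] LR_step_left_Suc[of "Tm P" "Tm P'"]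
      LR_step_right[of "Mc M" "Mc M'"] LR_step_right[of "Tm P" "Tm P'"] assms(1,3)
    by (auto simp: sim_def)
qed

lemma sim_ArrI:
  assumes "\<And>j b Q. j \<le> k \<Longrightarrow> arel d \<alpha> j b Q \<Longrightarrow> sim d \<beta> j (M @@ [b]) (App P Q)"
  shows "sim d (\<alpha> \<rightarrow> \<beta>) k M P"
proof (cases d)
  case True
  have "LR (\<alpha> \<rightarrow> \<beta>) k (Mc M) (Tm P)" unfolding LR.simps
  proof (intro allI impI)
    fix j A B
    assume *: "j \<le> k" "is_Mc A = is_Mc (Mc M)" "is_Mc B = is_Mc (Tm P)" "oty A \<alpha>" "oty B \<alpha>" "LR \<alpha> j A B"
    then obtain N Q where "A = Mc N" "B = Tm Q" by (cases A; cases B) auto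
    then show "LR \<beta> j (oapp (Mc M) A) (oapp (Tm P) B)"
      using assms[of j "addr N" Q] * True by (simp add: arel_def sim_def)
  qed
  then show ?thesis using True by (simp add: sim_def)
next
  case False
  have "LR (\<alpha> \<rightarrow> \<beta>) k (Tm P) (Mc M)" unfolding LR.simps
  proof (intro allI impI)
    fix j A B
    assume *: "j \<le> k" "is_Mc A = is_Mc (Tm P)" "is_Mc B = is_Mc (Mc M)" "oty A \<alpha>" "oty B \<alpha>" "LR \<alpha> j A B"
    then obtain N Q where "B = Mc N" "A = Tm Q" by (cases A; cases B) auto
    then show "LR \<beta> j (oapp (Tm P) A) (oapp (Mc M) B)"
      using assms[of j "addr N" Q] * False by (simp add: arel_def sim_def)
  qed
  then show ?thesis using False by (simp add: sim_def)
qed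

lemma sim_App: "sim d (\<alpha> \<rightarrow> \<beta>) k M P \<Longrightarrow> arel d \<alpha> k a Q \<Longrightarrow> sim d \<beta> k (M @@ [a]) (App P Q)"
proof -
  assume *: "sim d (\<alpha> \<rightarrow> \<beta>) k M P" "arel d \<alpha> k a Q"
  then have "LR \<beta> k (oapp (Mc M) (Mc (mach a))) (oapp (Tm P) (Tm Q))" if d
    using that by (auto simp: sim_def arel_def simp del: oapp_simps)
  moreover have "LR \<beta> k (oapp (Tm P) (Tm Q)) (oapp (Mc M) (Mc (mach a)))" if "\<not> d"
    using that * by (auto simp: sim_def arel_def simp del: oapp_simps)
  ultimately show ?thesis by (simp add: sim_def)
qed

lemma sim_num: "step\<^sup>*\<^sup>* M (numeral_eam n) \<Longrightarrow> pcf_step\<^sup>*\<^sup>* P (num_tm n) \<Longrightarrow> sim d TInt k M P"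
proof -
  assume *: "step\<^sup>*\<^sup>* M (numeral_eam n)" "pcf_step\<^sup>*\<^sup>* P (num_tm n)"
  have "ev (oval True n) 0 n" by (simp add: ev_oval)
  then have "sim d TInt k (numeral_eam n) (num_tm n)"
    using LR_oval_left[of "oval True n" 0 n k False] LR_oval_right[of "oval True n" 0 n k False]
    by (simp add: sim_def oval_def)
  with * sim_Mc sim_Tm show ?thesis by blast
qed

lemma ev_McD: "ev (Mc M) j n \<Longrightarrow> step\<^sup>*\<^sup>* M (numeral_eam n)"
  using ex_ev_Mc by blast

lemma ev_TmD: "ev (Tm P) j n \<Longrightarrow> pcf_step\<^sup>*\<^sup>* P (num_tm n)"
  using ex_ev_Tm by blast

lemma sim_forces:
  assumes "forces True (\<lambda>Z. Mc (E (un_Mc Z))) (\<lambda>v. Mc (F v))"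
    "forces False (\<lambda>Z. Tm (G (un_Tm Z))) (\<lambda>v. Tm (H v))"
    "M \<in> EAMs" "sim d TInt k M P"
    "\<And>v. step\<^sup>*\<^sup>* M (numeral_eam v) \<Longrightarrow> pcf_step\<^sup>*\<^sup>* P (num_tm v) \<Longrightarrow> sim d \<alpha> k (F v) (H v)"
  shows "sim d \<alpha> k (E M) (G P)"
proof (cases d)
  case True
  have "LR \<alpha> k (Mc (E (un_Mc (Mc M :: 'a obj)))) (Tm (G (un_Tm (Tm P :: 'a obj))))"
  proof (rule LR_forces[OF assms(1,2), where Z = "Mc M" and W = "Tm P"])
    show "LR \<alpha> k (Mc (F v)) (Tm (H v))" if "ev (Mc M) i v" "ev (Tm P) j v" for v i j
      using ev_McD[OF that(1)] ev_TmD[OF that(2)] assms(5)[of v] True by (simp add: sim_def)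
  qed (use assms True in \<open>auto simp: sim_def simp del: LR.simps\<close>)
  then show ?thesis using True by (simp add: sim_def)
next
  case False
  have "LR \<alpha> k (Tm (G (un_Tm (Tm P :: 'a obj)))) (Mc (E (un_Mc (Mc M :: 'a obj))))"
  proof (rule LR_forces[OF assms(2,1), where Z = "Tm P" and W = "Mc M"])
    show "LR \<alpha> k (Tm (H v)) (Mc (F v))" if "ev (Tm P) i v" "ev (Mc M) j v" for v i j
      using ev_TmD[OF that(1)] ev_McD[OF that(2)] assms(5)[of v] False by (simp add: sim_def)
  qed (use assms False in \<open>auto simp: sim_def simp del: LR.simps\<close>)
  then show ?thesis using False by (simp add: sim_def)
qed

section \<open>Arithmetic and tests as forcing contexts\<close>

text \<open>Abstractions are excluded so that being stuck survives application: an abstraction is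
  normal alone but reducible once applied.\<close>

definition blocked :: "tm \<Rightarrow> bool" where
  "blocked P \<longleftrightarrow> (\<forall>n. P \<noteq> num_tm n) \<and> (\<forall>P'. \<not> pcf_step P P') \<and> (\<forall>Q. P \<noteq> Lam Q)"

lemma blocked_App: "blocked P \<Longrightarrow> blocked (App P Q)"
  unfolding blocked_def by (auto simp: num_tm_simps(4)[THEN not_sym] elim: step_AppE)

lemma blocked_ev: "blocked P \<Longrightarrow> \<not> ev (foldl oapp (Tm P) As) j n"
proof (induction As arbitrary: P)
  case Nil
  then show ?case unfolding blocked_def
    by (metis ex_ev_Tm converse_rtranclpE foldl_Nil)
next
  case (Cons A As)
  then show ?case using blocked_App[of P "un_Tm A"] by (simp add: oapp_def)
qed

lemma forces_Tm:
  assumes "\<And>P P'. pcf_step P P' \<Longrightarrow> pcf_step (G P) (G P')"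
    "\<And>P. (\<forall>n. P \<noteq> num_tm n) \<Longrightarrow> (\<forall>P'. \<not> pcf_step P P') \<Longrightarrow> blocked (G P)"
    "\<And>v. pcf_step\<^sup>*\<^sup>* (G (num_tm v)) (H v)"
  shows "forces False (\<lambda>Z. Tm (G (un_Tm Z))) (\<lambda>v. Tm (H v))"
proof -
  have "\<not> ev (foldl oapp (Tm (G P)) As) j n"
    if "\<forall>v. Tm P \<noteq> oval False v" "\<forall>Z'. \<not> ostep (Tm P) Z'" for P As j n
  proof (rule blocked_ev, rule assms(2))
    show "\<forall>n. P \<noteq> num_tm n" using that(1) by (auto simp: oval_def)
    show "\<forall>P'. \<not> pcf_step P P'" using that(2) ostep.simps(1) by blast
  qed
  moreover have "ostep (Tm (G P)) (Tm (G (un_Tm Z')))" if "ostep (Tm P) Z'" for P Z'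
    using that assms(1) by (cases Z') auto
  ultimately have "is_Mc Z = False \<longrightarrow> (\<forall>Z'. ostep Z Z' \<longrightarrow> ostep (Tm (G (un_Tm Z))) (Tm (G (un_Tm Z')))) \<and>
      ((\<forall>v. Z \<noteq> oval False v) \<and> (\<forall>Z'. \<not> ostep Z Z') \<longrightarrow>
        (\<forall>As j n. \<not> ev (foldl oapp (Tm (G (un_Tm Z))) As) j n))" for Z
    by (cases Z) auto
  then show ?thesis
    using assms(3) by (auto simp: forces_def oval_def ostep_Tm_rtranclp)
qed

lemma forces_Pred: "forces False (\<lambda>Z. Tm (Pred (un_Tm Z))) (\<lambda>v. Tm (num_tm (v - 1)))"
proof (rule forces_Tm)
  show "pcf_step\<^sup>*\<^sup>* (Pred (num_tm v)) (num_tm (v - 1))" for v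
    by (cases v) (auto intro!: r_into_rtranclp pcf_step.intros)
  show "blocked (Pred P)" if "\<forall>n. P \<noteq> num_tm n" "\<forall>P'. \<not> pcf_step P P'" for P
    using that that(1)[THEN spec, of 0] by (auto simp: blocked_def num_tm_simps num_tm_simps(6)[THEN not_sym] elim!: step_PredE)
qed (auto intro: pcf_step.intros)

lemma forces_Succ: "forces False (\<lambda>Z. Tm (Succ (un_Tm Z))) (\<lambda>v. Tm (num_tm (Suc v)))"
proof (rule forces_Tm)
  show "blocked (Succ P)" if "\<forall>n. P \<noteq> num_tm n" "\<forall>P'. \<not> pcf_step P P'" for P
    using that by (auto simp: blocked_def elim!: step_SuccE) (metis num_tm_simps(3))
qed (auto simp: num_tm_Suc intro: pcf_step.intros)

lemma forces_Ifz: "forces False (\<lambda>Z. Tm (Ifz (un_Tm Z) P Q)) (\<lambda>v. Tm (if v = 0 then P else Q))"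
proof (rule forces_Tm)
  show "pcf_step\<^sup>*\<^sup>* (Ifz (num_tm v) P Q) (if v = 0 then P else Q)" for v
    by (cases v) (auto intro!: r_into_rtranclp pcf_step.intros)
  show "blocked (Ifz R P Q)" if "\<forall>n. R \<noteq> num_tm n" "\<forall>P'. \<not> pcf_step R P'" for R
    using that that(1)[THEN spec, of 0] by (auto simp: blocked_def num_tm_simps num_tm_simps(7)[THEN not_sym] elim!: step_IfzE)
qed (auto intro: pcf_step.intros)

lemma foldl_oapp_Mc: "\<exists>T'. foldl oapp (Mc (EAM R P T)) As = Mc (EAM R P T')"
  by (induction As arbitrary: T) (auto simp: oapp_def)

text \<open>Further arguments only extend the tape, which an arithmetic instruction does not read,
  so they cannot revive a machine whose operand is stuck; this is why \<open>ctx\<close> and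
  \<open>inv\<close> are required for every tape. \<open>A \<noteq> Stop\<close> ensures that such a
  machine is not itself a numeral.\<close>

lemma forces_Mc:
  assumes i: "i < length R"
    and ctx: "\<And>R T m M. get R i = Some m \<Longrightarrow> step (mach m) M \<Longrightarrow>
       step (EAM R (Run A) T) (EAM (R[i := Some (addr M)]) (Run A) T)"
    and inv: "\<And>R T M. step (EAM R (Run A) T) M \<Longrightarrow>
       \<exists>m. get R i = Some m \<and> ((\<exists>n. m = num n) \<or> (\<exists>M'. step (mach m) M'))"
    and nStop: "A \<noteq> Stop"
    and val: "\<And>v. step\<^sup>*\<^sup>* (EAM (R[i := Some (num v)]) (Run A) T) (F v)"
  shows "forces True (\<lambda>Z. Mc (EAM (R[i := Some (addr (un_Mc Z))]) (Run A) T)) (\<lambda>v. Mc (F v))"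
proof -
  let ?E = "\<lambda>M. EAM (R[i := Some (addr M)]) (Run A) T"
  have get: "get (R[i := Some m]) i = Some m" for m using i by (simp add: get_list_update)
  have stepE: "step (?E M) (?E M')" if "M \<in> EAMs" "step M M'" for M M'
    using ctx[OF get, of "addr M" M' T] that by simp
  have block: "\<not> ev (foldl oapp (Mc (?E M)) As) j n"
    if "M \<in> EAMs" "\<forall>v. M \<noteq> numeral_eam v" "\<forall>M'. \<not> step M M'" for M As j n
  proof
    assume "ev (foldl oapp (Mc (?E M)) As) j n"
    moreover obtain T' where
      "foldl oapp (Mc (?E M)) As = Mc (EAM (R[i := Some (addr M)]) (Run A) T')"
      using foldl_oapp_Mc by blast
    ultimately have "step\<^sup>*\<^sup>* (EAM (R[i := Some (addr M)]) (Run A) T') (numeral_eam n)"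
      using ev_McD by simp
    then show False
    proof (cases rule: converse_rtranclpE)
      case base
      then show ?thesis using nStop by (simp add: numeral_eam_def)
    next
      case (step N)
      from inv[OF this(1)] get[of "addr M"] that(1,3) obtain v where "addr M = num v"
        by auto
      then have "M = numeral_eam v" using mach_addr[OF that(1)] by simp
      then show ?thesis using that(2) by blast
    qed
  qed
  have step: "ostep (Mc (?E (un_Mc Z))) (Mc (?E (un_Mc Z')))"
    if "wf_obj Z" "is_Mc Z" "ostep Z Z'" for Z Z'
    using that stepE by (cases Z; cases Z') simp_all
  have stuck: "\<not> ev (foldl oapp (Mc (?E (un_Mc Z))) As) j n"
    if Z: "wf_obj Z" "is_Mc Z" "\<forall>v. Z \<noteq> oval True v" "\<forall>Z'. \<not> ostep Z Z'" for Z As j n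
  proof (cases Z)
    case (Mc M)
    have "\<forall>v. M \<noteq> numeral_eam v" using Mc Z(3) by (simp add: oval_def)
    moreover have "\<forall>M'. \<not> step M M'" using Mc Z(4) ostep.simps(2) by blast
    ultimately show ?thesis using block[of M As j n] Mc Z(1) by simp
  qed (use Z in simp)
  have "ostep\<^sup>*\<^sup>* (Mc (?E (un_Mc (oval True v)))) (Mc (F v))" for v
    using val[of v] by (simp add: oval_def ostep_Mc_rtranclp)
  with step stuck show ?thesis unfolding forces_def by simp
qed

lemma forces_PredI:
  assumes "i < length R"
  shows "forces True (\<lambda>Z. Mc (EAM (R[i := Some (addr (un_Mc Z))]) (Run (PredI j i A)) T))
    (\<lambda>v. Mc (EAM (R[i := Some (num v), j := Some (num (v - 1))]) (Run A) T))"
  using assms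
  by (intro forces_Mc) (auto intro!: r_into_rtranclp step.intros(4,5) simp del: One_nat_def simp: get_list_update elim!: step_PredIE)

lemma forces_SuccI:
  assumes "i < length R"
  shows "forces True (\<lambda>Z. Mc (EAM (R[i := Some (addr (un_Mc Z))]) (Run (SuccI j i A)) T))
    (\<lambda>v. Mc (EAM (R[i := Some (num v), j := Some (num (Suc v))]) (Run A) T))"
  using assms
  by (intro forces_Mc) (auto intro!: r_into_rtranclp step.intros(6,7) simp: get_list_update elim!: step_SuccIE)

text \<open>The chosen branch is read after register \<open>i\<close> has been overwritten by the
  numeral, which matters if \<open>j\<close> or \<open>k\<close> equals \<open>i\<close>.\<close>

lemma forces_TestI:
  assumes "i < length R" "j < length R" "k < length R" "R ! j \<noteq> None" "R ! k \<noteq> None"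
  shows "forces True (\<lambda>Z. Mc (EAM (R[i := Some (addr (un_Mc Z))]) (Run (TestI l i j k A)) T))
    (\<lambda>v. Mc (EAM (R[i := Some (num v),
       l := R[i := Some (num v)] ! (if v = 0 then j else k)]) (Run A) T))"
  using assms(1)
proof (rule forces_Mc)
  fix v
  let ?R = "R[i := Some (num v)]"
  have "\<exists>b. get ?R (if v = 0 then j else k) = Some b"
    using assms by (auto simp: get_def nth_list_update)
  then obtain b where b: "get ?R (if v = 0 then j else k) = Some b" by blast
  then have b': "?R ! (if v = 0 then j else k) = Some b"
    by (simp add: get_def split: if_splits)
  have "get ?R i = Some (num v)" using assms by (simp add: get_list_update)
  with b have "step (EAM ?R (Run (TestI l i j k A)) T) (EAM (?R[l := Some b]) (Run A) T)"
    by (cases v) (auto intro: step.intros)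
  then show "step\<^sup>*\<^sup>* (EAM ?R (Run (TestI l i j k A)) T)
     (EAM (?R[l := ?R ! (if v = 0 then j else k)]) (Run A) T)"
    unfolding b' by blast
qed (auto intro: step.intros(10) elim!: step_TestIE)

text \<open>Here the self-reference of \<open>Y_eam y\<close> pays off: \<open>y \<cdot> m\<close>
  is the address of the very machine \<open>Y_eam y @@ [m]\<close>, which runs to
  \<open>mach m @@ [y \<cdot> m]\<close> just as \<open>Fix f\<close> steps to
  \<open>App f (Fix f)\<close>. The induction hypothesis at \<open>k\<close> relates the recursive
  arguments, and the unfolding step raises the index to \<open>Suc k\<close>.\<close>

lemma sim_fix:
  "arel d (\<alpha> \<rightarrow> \<alpha>) k m f \<Longrightarrow> sim d \<alpha> k (Y_eam y @@ [m]) (Fix f)"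
proof (induction k)
  case 0
  show ?case using LR_0 by (simp add: sim_def)
next
  case (Suc k)
  have m: "arel d (\<alpha> \<rightarrow> \<alpha>) k m f" using arel_mono[OF Suc(2), of k] by simp
  have "arel d \<alpha> k (y \<cdot> m) (Fix f)"
    using Suc.IH[OF m] m eam_ty_app1[OF ty_fix] by (auto simp: arel_def intro: has_ty.intros)
  then have "sim d \<alpha> k (mach m @@ [y \<cdot> m]) (App f (Fix f))"
    using m sim_App by (auto simp: arel_def)
  moreover let ?A = "AppI 0 0 1 (Call 0)"
  have "step (Y_eam y @@ [m]) (EAM [Some m, Some y] (Run (AppI 1 1 0 ?A)) [])"
    using step.intros(2)[of "[None, Some y]" 0 "Run (AppI 1 1 0 ?A)" m "[]"] by (simp add: Y_eam_def)
  moreover have "step\<^sup>*\<^sup>* (EAM [Some m, Some y] (Run (AppI 1 1 0 ?A)) []) (mach m @@ [y \<cdot> m])"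
  proof -
    have "step\<^sup>*\<^sup>* (EAM [Some m, Some y] (Run (AppI 1 1 0 ?A)) []) (EAM [Some m, Some (y \<cdot> m)] (Run ?A) [])"
      using step.intros(3)[of "[Some m, Some y]" 1 y 0 m 1 ?A "[]"] by (simp add: get_def r_into_rtranclp)
    also have "step \<dots> (EAM [Some (m \<cdot> (y \<cdot> m)), Some (y \<cdot> m)] (Run (Call 0)) [])"
      using step.intros(3)[of "[Some m, Some (y \<cdot> m)]" 0 m 1 "y \<cdot> m" 0] by (simp add: get_def)
    also have "step \<dots> (mach (m \<cdot> (y \<cdot> m)))"
      by (rule step_Call) (simp add: get_def)
    finally show ?thesis by simp
  qed
  ultimately show ?case using pcf_step.intros(6) by (intro sim_Suc) auto
qed

end

section \<open>Soundness of the translation\<close>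

definition closed_env :: "tm list \<Rightarrow> ty list \<Rightarrow> bool" where
  "closed_env \<sigma> \<Gamma> \<longleftrightarrow> list_all2 (has_ty []) \<sigma> \<Gamma>"

lemma closed_env_nth: "closed_env \<sigma> \<Gamma> \<Longrightarrow> i < length \<Gamma> \<Longrightarrow> has_ty [] (\<sigma> ! i) (\<Gamma> ! i)"
  by (simp add: closed_env_def list_all2_conv_all_nth)

lemma closed_env_length: "closed_env \<sigma> \<Gamma> \<Longrightarrow> length \<sigma> = length \<Gamma>"
  by (auto simp: closed_env_def dest: list_all2_lengthD)

lemma has_ty_csub_env: "closed_env \<sigma> \<Gamma> \<Longrightarrow> has_ty \<Gamma> P \<alpha> \<Longrightarrow> has_ty [] (csub 0 \<sigma> P) \<alpha>"
  using has_ty_csub[of "[]" \<Gamma> P \<alpha> \<sigma>] closed_env_nth closed_env_length by simp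

lemma beta_csub_env:
  "closed_env \<sigma> \<Gamma> \<Longrightarrow> has_ty [] S \<beta> \<Longrightarrow>
   pcf_step (App (Lam (csub (Suc 0) \<sigma> P)) S) (csub 0 (S # \<sigma>) P)"
  using beta_csub closed_env_nth closed_env_length by blast

context address_table_map
begin

definition env_rel :: "bool \<Rightarrow> nat \<Rightarrow> ty list \<Rightarrow> 'a list \<Rightarrow> tm list \<Rightarrow> bool" where
  "env_rel d k \<Gamma> as \<sigma> \<longleftrightarrow> length as = length \<Gamma> \<and> length \<sigma> = length \<Gamma> \<and>
     (\<forall>i<length \<Gamma>. arel d (\<Gamma> ! i) k (as ! i) (\<sigma> ! i))"

lemma env_rel_closed: "env_rel d k \<Gamma> as \<sigma> \<Longrightarrow> closed_env \<sigma> \<Gamma>"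
  by (auto simp: env_rel_def closed_env_def arel_def list_all2_conv_all_nth)

lemma env_rel_mono: "env_rel d k \<Gamma> as \<sigma> \<Longrightarrow> j \<le> k \<Longrightarrow> env_rel d j \<Gamma> as \<sigma>"
  by (auto simp: env_rel_def intro: arel_mono)

lemma env_rel_Cons:
  "env_rel d k \<Gamma> as \<sigma> \<Longrightarrow> arel d \<alpha> k a P \<Longrightarrow> env_rel d k (\<alpha> # \<Gamma>) (a # as) (P # \<sigma>)"
  by (auto simp: env_rel_def less_Suc_eq_0_disj)

lemma Tr_env_ty:
  assumes "has_ty \<Gamma> P \<alpha>" "env_rel d k \<Gamma> as \<sigma>"
  shows "eam_ty (Tr (length \<Gamma>) P @@ rev as) \<alpha>"
proof (rule eam_ty_app)
  show "eam_ty (Tr (length \<Gamma>) P) (arrs (rev \<Gamma>) \<alpha>)" using Tr_ty assms(1) .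
  show "list_all2 (\<lambda>a \<beta>. eam_ty (mach a) \<beta>) (rev as) (rev \<Gamma>)"
    using assms(2) by (auto simp: env_rel_def arel_def list_all2_conv_all_nth rev_nth)
qed

lemma arel_TrI:
  assumes "has_ty \<Gamma> P \<alpha>" "env_rel d k \<Gamma> as \<sigma>"
    "sim d \<alpha> k (Tr (length \<Gamma>) P @@ rev as) (csub 0 \<sigma> P)"
  shows "arel d \<alpha> k (addr (mach (addr (Tr (length \<Gamma>) P)) @@ rev as)) (csub 0 \<sigma> P)"
  using assms Tr_env_ty[OF assms(1,2)] has_ty_csub_env[OF env_rel_closed[OF assms(2)] assms(1)]
    Tr_ty[OF assms(1)]
  by (simp add: arel_def)

text \<open>The fundamental lemma, for open terms closed by related inputs. In the abstraction case
  the machine only receives another input while the term makes a beta step, which leaves the index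
  unchanged. Operands of arithmetic go through \<open>sim_forces\<close>, and recursion through
  \<open>sim_fix\<close>.\<close>

lemma Tr_sim:
  "has_ty \<Gamma> P \<alpha> \<Longrightarrow> env_rel d k \<Gamma> as \<sigma> \<Longrightarrow>
   sim d \<alpha> k (Tr (length \<Gamma>) P @@ rev as) (csub 0 \<sigma> P)"
proof (induction arbitrary: k as \<sigma> rule: has_ty.induct)
  case (1 i \<Gamma>)
  have len: "length \<Gamma> = length (rev as)" using 1 by (simp add: env_rel_def)
  have "length \<Gamma> - 1 - i < length (rev as)" "rev as ! (length \<Gamma> - 1 - i) = as ! i"
    using 1 by (auto simp: env_rel_def rev_nth)
  with Proj_steps[of "length \<Gamma> - 1 - i" "rev as"] len
  have "step\<^sup>*\<^sup>* (Tr (length \<Gamma>) (Var i) @@ rev as) (mach (as ! i))" by simp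
  moreover have "sim d (\<Gamma> ! i) k (mach (as ! i)) (csub 0 \<sigma> (Var i))"
    using 1 by (auto simp: env_rel_def arel_def)
  ultimately show ?case using sim_Mc by blast
next
  case (2 \<Gamma> P \<alpha> \<beta> Q)
  have len: "length \<Gamma> = length (rev as)" using 2 by (simp add: env_rel_def)
  let ?p = "addr (Tr (length \<Gamma>) P)" and ?q = "addr (Tr (length \<Gamma>) Q)"
  have P: "sim d (\<alpha> \<rightarrow> \<beta>) k (Tr (length \<Gamma>) P @@ rev as) (csub 0 \<sigma> P)"
    using 2 by blast
  have "arel d \<alpha> k (addr (mach ?q @@ rev as)) (csub 0 \<sigma> Q)"
    using 2 arel_TrI by blast
  from sim_App[OF P this]
  have "sim d \<beta> k (mach ?p @@ (rev as @ [addr (mach ?q @@ rev as)])) (csub 0 \<sigma> (App P Q))"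
    using Tr_ty[OF 2(1)] by simp
  moreover have "step\<^sup>*\<^sup>* (Tr (length \<Gamma>) (App P Q) @@ rev as)
      (mach ?p @@ (rev as @ [addr (mach ?q @@ rev as)]))"
    using Apply_steps[of "rev as" ?p ?q] len by simp
  ultimately show ?case using sim_Mc by blast
next
  case (3 \<alpha> \<Gamma> P \<beta>)
  show ?case
  proof (rule sim_ArrI)
    fix j b Q
    assume j: "j \<le> k" and b: "arel d \<alpha> j b Q"
    have "sim d \<beta> j (Tr (length (\<alpha> # \<Gamma>)) P @@ rev (b # as)) (csub 0 (Q # \<sigma>) P)"
      using 3(2) env_rel_Cons[OF env_rel_mono[OF 3(3) j] b] by blast
    moreover have "pcf_step (App (csub 0 \<sigma> (Lam P)) Q) (csub 0 (Q # \<sigma>) P)"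
      using beta_csub_env[OF env_rel_closed[OF 3(3)], of Q \<alpha> P] b by (simp add: arel_def)
    ultimately show "sim d \<beta> j (Tr (length \<Gamma>) (Lam P) @@ rev as @@ [b]) (App (csub 0 \<sigma> (Lam P)) Q)"
      using sim_Tm[OF r_into_rtranclp] by simp
  qed
next
  case (4 \<Gamma>)
  have "length \<Gamma> = length (rev as)" using 4 by (simp add: env_rel_def)
  then have "step\<^sup>*\<^sup>* (Tr (length \<Gamma>) Zero @@ rev as) (numeral_eam 0)"
    using Proj_steps[of 0 "num 0 # rev as"] by simp
  then show ?case by (rule sim_num) simp
next
  case (5 \<Gamma> P)
  have len: "length \<Gamma> = length (rev as)" using 5 by (simp add: env_rel_def)
  let ?M = "Tr (length \<Gamma>) P @@ rev as"
  let ?R = "map Some (addr ?M # rev as)"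
  have M: "?M \<in> EAMs" "sim d TInt k ?M (csub 0 \<sigma> P)"
    using 5 Tr_env_ty eam_ty_EAMs by blast+
  have "step\<^sup>*\<^sup>* (Tr (length \<Gamma>) (Pred P) @@ rev as) (EAM ?R (Run (PredI 0 0 (Call 0))) [])"
    using Pred_steps[of "rev as" "addr (Tr (length \<Gamma>) P)"] len Tr_ty[OF 5(1)] by simp
  \<comment> \<open>Register 0 already holds this address; writing it once more exhibits the operand
    as the argument of a forcing context.\<close>
  moreover have "sim d TInt k (EAM (?R[0 := Some (addr ?M)]) (Run (PredI 0 0 (Call 0))) []) (Pred (csub 0 \<sigma> P))"
  proof (rule sim_forces[OF forces_PredI forces_Pred M])
    show "sim d TInt k (EAM (?R[0 := Some (num v), 0 := Some (num (v - 1))]) (Run (Call 0)) [])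
        (num_tm (v - 1))" for v
      by (rule sim_num, rule r_into_rtranclp) (use step_Call[of _ 0 "num (v - 1)"] in \<open>auto simp: get_def\<close>)
  qed simp
  ultimately show ?case using sim_Mc by simp
next
  case (6 \<Gamma> P)
  have len: "length \<Gamma> = length (rev as)" using 6 by (simp add: env_rel_def)
  let ?M = "Tr (length \<Gamma>) P @@ rev as"
  let ?R = "map Some (addr ?M # rev as)"
  have M: "?M \<in> EAMs" "sim d TInt k ?M (csub 0 \<sigma> P)"
    using 6 Tr_env_ty eam_ty_EAMs by blast+
  have "step\<^sup>*\<^sup>* (Tr (length \<Gamma>) (Succ P) @@ rev as) (EAM ?R (Run (SuccI 0 0 (Call 0))) [])"
    using Succ_steps[of "rev as" "addr (Tr (length \<Gamma>) P)"] len Tr_ty[OF 6(1)] by simp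
  moreover have "sim d TInt k (EAM (?R[0 := Some (addr ?M)]) (Run (SuccI 0 0 (Call 0))) []) (Succ (csub 0 \<sigma> P))"
  proof (rule sim_forces[OF forces_SuccI forces_Succ M])
    show "sim d TInt k (EAM (?R[0 := Some (num v), 0 := Some (num (Suc v))]) (Run (Call 0)) [])
        (num_tm (Suc v))" for v
      by (rule sim_num, rule r_into_rtranclp) (use step_Call[of _ 0 "num (Suc v)"] in \<open>auto simp: get_def\<close>)
  qed simp
  ultimately show ?case using sim_Mc by simp
next
  case (7 \<Gamma> P Q \<alpha> Q')
  have len: "length \<Gamma> = length (rev as)" using 7 by (simp add: env_rel_def)
  let ?M = "Tr (length \<Gamma>) P @@ rev as" and ?N = "Tr (length \<Gamma>) Q @@ rev as"
    and ?N' = "Tr (length \<Gamma>) Q' @@ rev as"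
  let ?R = "map Some (addr ?M # addr ?N # addr ?N' # rev as)"
  let ?A = "TestI 0 0 1 2 (Call 0)"
  have M: "?M \<in> EAMs" "sim d TInt k ?M (csub 0 \<sigma> P)"
    using 7 Tr_env_ty eam_ty_EAMs by blast+
  have N: "?N \<in> EAMs" "?N' \<in> EAMs"
    using 7 Tr_env_ty eam_ty_EAMs by blast+
  have "step\<^sup>*\<^sup>* (Tr (length \<Gamma>) (Ifz P Q Q') @@ rev as) (EAM ?R (Run ?A) [])"
    using Ifz_steps[of "rev as" "addr (Tr (length \<Gamma>) P)" "addr (Tr (length \<Gamma>) Q)" "addr (Tr (length \<Gamma>) Q')"]
      len Tr_ty[OF 7(1)] Tr_ty[OF 7(2)] Tr_ty[OF 7(3)] by simp
  moreover have "sim d \<alpha> k (EAM (?R[0 := Some (addr ?M)]) (Run ?A) []) (Ifz (csub 0 \<sigma> P) (csub 0 \<sigma> Q) (csub 0 \<sigma> Q'))"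
  proof (rule sim_forces[OF forces_TestI forces_Ifz M])
    fix v
    let ?R' = "?R[0 := Some (num v)]"
    have mach: "mach (addr (if v = 0 then ?N else ?N')) = (if v = 0 then ?N else ?N')"
      using N by simp
    have "step (EAM (?R'[0 := ?R' ! (if v = 0 then 1 else 2)]) (Run (Call 0)) [])
        (mach (addr (if v = 0 then ?N else ?N')))"
      by (rule step_Call) (simp add: get_def)
    note this[unfolded mach]
    moreover have "sim d \<alpha> k (if v = 0 then ?N else ?N') (if v = 0 then csub 0 \<sigma> Q else csub 0 \<sigma> Q')"
      using 7 by simp
    ultimately show "sim d \<alpha> k (EAM (?R'[0 := ?R' ! (if v = 0 then 1 else 2)]) (Run (Call 0)) [])
        (if v = 0 then csub 0 \<sigma> Q else csub 0 \<sigma> Q')"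
      by (rule sim_Mc[OF r_into_rtranclp])
  qed auto
  ultimately show ?case using sim_Mc by simp
next
  case (8 \<Gamma> P \<alpha>)
  have len: "length \<Gamma> = length (rev as)" using 8 by (simp add: env_rel_def)
  let ?p = "addr (Tr (length \<Gamma>) P)"
  have "arel d (\<alpha> \<rightarrow> \<alpha>) k (addr (mach ?p @@ rev as)) (csub 0 \<sigma> P)"
    using 8 arel_TrI by blast
  from sim_fix[OF this] Fix_steps[of "rev as" ?p] len show ?case
    using sim_Mc by simp
qed

lemma Tr_closed_sim: "has_ty [] P \<alpha> \<Longrightarrow> sim d \<alpha> k (Tr 0 P) P"
  using Tr_sim[of "[]" P \<alpha> d k "[]" "[]"] csub_id[of "[]" P \<alpha> 0 "[]"] by (simp add: env_rel_def)

end

section \<open>Definability\<close>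

context address_table_map
begin

text \<open>Machine registers are represented by variables through \<open>\<rho>\<close>; overwriting a register
  introduces a new variable.\<close>

definition compat :: "ty option list \<Rightarrow> ty list \<Rightarrow> (nat \<Rightarrow> nat) \<Rightarrow> bool" where
  "compat \<Delta> \<Gamma> \<rho> \<longleftrightarrow> (\<forall>i \<beta>. get \<Delta> i = Some \<beta> \<longrightarrow> \<rho> i < length \<Gamma> \<and> \<Gamma> ! \<rho> i = \<beta>)"

definition reg_rel ::
  "bool \<Rightarrow> nat \<Rightarrow> ty option list \<Rightarrow> 'a option list \<Rightarrow> (nat \<Rightarrow> nat) \<Rightarrow> tm list \<Rightarrow> bool" where
  "reg_rel d k \<Delta> R \<rho> \<sigma> \<longleftrightarrow> length R = length \<Delta> \<and>
     (\<forall>i \<beta>. get \<Delta> i = Some \<beta> \<longrightarrow> (\<exists>a. get R i = Some a \<and> arel d \<beta> k a (\<sigma> ! \<rho> i)))"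

text \<open>One term has to serve both directions, all indices and all register contents, so it may
  depend only on the typing data. \<open>\<Gamma>\<close> may be longer than the register list,
  because values of overwritten registers survive as variables.\<close>

definition code_definable :: "ty option list \<Rightarrow> code \<Rightarrow> 'a list \<Rightarrow> ty \<Rightarrow> bool" where
  "code_definable \<Delta> P T \<alpha> \<longleftrightarrow> (\<forall>\<Gamma> \<rho>. compat \<Delta> \<Gamma> \<rho> \<longrightarrow>
     (\<exists>Q. has_ty \<Gamma> Q \<alpha> \<and> (\<forall>d k R \<sigma>. reg_rel d k \<Delta> R \<rho> \<sigma> \<longrightarrow> closed_env \<sigma> \<Gamma> \<longrightarrow>
        sim d \<alpha> k (EAM R P T) (csub 0 \<sigma> Q))))"

text \<open>The new variable is the innermost one, so all others move up. A write to a nonexistent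
  register adds a variable too, which is harmless, as \<open>\<Delta>\<close> has no entry that
  would refer to it.\<close>

definition upd_var :: "(nat \<Rightarrow> nat) \<Rightarrow> nat \<Rightarrow> nat \<Rightarrow> nat" where
  "upd_var \<rho> x = (\<lambda>i. if i = x then 0 else Suc (\<rho> i))"

lemma compat_upd: "compat \<Delta> \<Gamma> \<rho> \<Longrightarrow> compat (\<Delta>[x := Some \<gamma>]) (\<gamma> # \<Gamma>) (upd_var \<rho> x)"
  unfolding compat_def upd_var_def by (auto simp: get_list_update get_def split: if_splits)

lemma reg_rel_upd:
  "reg_rel d k \<Delta> R \<rho> \<sigma> \<Longrightarrow> arel d \<gamma> k a N \<Longrightarrow>
   reg_rel d k (\<Delta>[x := Some \<gamma>]) (R[x := Some a]) (upd_var \<rho> x) (N # \<sigma>)"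
  unfolding reg_rel_def upd_var_def by (auto simp: get_list_update get_def split: if_splits)

lemma reg_rel_mono: "reg_rel d k \<Delta> R \<rho> \<sigma> \<Longrightarrow> j \<le> k \<Longrightarrow> reg_rel d j \<Delta> R \<rho> \<sigma>"
  unfolding reg_rel_def using arel_mono by blast

lemma reg_rel_get:
  assumes "reg_rel d k \<Delta> R \<rho> \<sigma>" "get \<Delta> i = Some \<beta>"
  obtains a where "get R i = Some a" "arel d \<beta> k a (\<sigma> ! \<rho> i)"
  using assms unfolding reg_rel_def by blast

lemma csub_env_Var:
  "compat \<Delta> \<Gamma> \<rho> \<Longrightarrow> closed_env \<sigma> \<Gamma> \<Longrightarrow> get \<Delta> i = Some \<beta> \<Longrightarrow> csub 0 \<sigma> (Var (\<rho> i)) = \<sigma> ! \<rho> i"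
  by (auto simp: compat_def dest!: closed_env_length)

lemma has_ty_env_Var: "compat \<Delta> \<Gamma> \<rho> \<Longrightarrow> get \<Delta> i = Some \<beta> \<Longrightarrow> has_ty \<Gamma> (Var (\<rho> i)) \<beta>"
  using has_ty.intros(1) unfolding compat_def by blast

text \<open>A register write is a let-binding. Call by name binds \<open>N\<close> unevaluated, just
  as the register stores an address without running its machine.\<close>

lemma code_definable_let:
  assumes "code_definable (\<Delta>[x := Some \<gamma>]) P T \<alpha>" "compat \<Delta> \<Gamma> \<rho>"
  obtains Q where "has_ty (\<gamma> # \<Gamma>) Q \<alpha>"
    "\<And>d k R \<sigma> a N. reg_rel d k \<Delta> R \<rho> \<sigma> \<Longrightarrow> closed_env \<sigma> \<Gamma> \<Longrightarrow> arel d \<gamma> k a N \<Longrightarrow>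
       sim d \<alpha> k (EAM (R[x := Some a]) P T) (App (Lam (csub (Suc 0) \<sigma> Q)) N)"
proof -
  from assms obtain Q where Q: "has_ty (\<gamma> # \<Gamma>) Q \<alpha>"
    "\<And>d k R \<sigma>. reg_rel d k (\<Delta>[x := Some \<gamma>]) R (upd_var \<rho> x) \<sigma> \<Longrightarrow> closed_env \<sigma> (\<gamma> # \<Gamma>) \<Longrightarrow>
       sim d \<alpha> k (EAM R P T) (csub 0 \<sigma> Q)"
    using compat_upd[OF assms(2)] unfolding code_definable_def by metis
  show ?thesis
  proof (rule that[OF Q(1)])
    fix d k R \<sigma> a N
    assume *: "reg_rel d k \<Delta> R \<rho> \<sigma>" "closed_env \<sigma> \<Gamma>" "arel d \<gamma> k a N"
    then have "closed_env (N # \<sigma>) (\<gamma> # \<Gamma>)" by (simp add: closed_env_def arel_def)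
    from Q(2)[OF reg_rel_upd[OF *(1,3)] this]
    show "sim d \<alpha> k (EAM (R[x := Some a]) P T) (App (Lam (csub (Suc 0) \<sigma> Q)) N)"
      using beta_csub_env[OF *(2), of N \<gamma> Q] *(3) sim_Tm[OF r_into_rtranclp]
      by (auto simp: arel_def)
  qed
qed

lemma arel_App:
  assumes "arel d (\<alpha> \<rightarrow> \<beta>) k a P" "arel d \<alpha> k b Q"
  shows "arel d \<beta> k (a \<cdot> b) (App P Q)"
proof -
  have "sim d (\<alpha> \<rightarrow> \<beta>) k (mach a) P" using assms(1) by (simp add: arel_def)
  from sim_App[OF this assms(2)] have "sim d \<beta> k (mach (a \<cdot> b)) (App P Q)" by simp
  moreover have "eam_ty (mach (a \<cdot> b)) \<beta>"
    using assms eam_ty_app1[of "mach a" \<alpha> \<beta> b] by (simp add: arel_def)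
  moreover have "has_ty [] (App P Q) \<beta>"
    using assms has_ty.intros(2) by (auto simp: arel_def)
  ultimately show ?thesis by (simp add: arel_def)
qed

lemma arel_num:
  "has_ty [] P TInt \<Longrightarrow> pcf_step\<^sup>*\<^sup>* P (num_tm v) \<Longrightarrow> arel d TInt k (num v) P"
  using sim_num[OF rtranclp.rtrancl_refl] by (simp add: arel_def ty_num)

text \<open>The machine replaces its operand by the numeral, while the environment of the term keeps
  the unevaluated \<open>\<sigma> ! \<rho> i\<close>. The two stay related because that term
  evaluates to the same numeral.\<close>

lemma reg_rel_num:
  assumes "reg_rel d k \<Delta> R \<rho> \<sigma>" "get \<Delta> i = Some TInt" "pcf_step\<^sup>*\<^sup>* (\<sigma> ! \<rho> i) (num_tm v)"
  shows "reg_rel d k \<Delta> (R[i := Some (num v)]) \<rho> \<sigma>"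
proof -
  obtain a where a: "get R i = Some a" "arel d TInt k a (\<sigma> ! \<rho> i)"
    using reg_rel_get[OF assms(1,2)] .
  then have "has_ty [] (\<sigma> ! \<rho> i) TInt" by (simp add: arel_def)
  from arel_num[OF this assms(3)] have "arel d TInt k (num v) (\<sigma> ! \<rho> i)" .
  then show ?thesis
    using assms(1,2) get_less[OF a(1)] unfolding reg_rel_def by (simp add: get_list_update)
qed

lemma arel_Pred:
  assumes "has_ty [] P TInt" "pcf_step\<^sup>*\<^sup>* P (num_tm v)"
  shows "arel d TInt k (num (v - 1)) (Pred P)"
proof -
  have "pcf_step\<^sup>*\<^sup>* (Pred P) (Pred (num_tm v))"
    using assms(2) by (induction rule: rtranclp_induct) (auto intro: pcf_step.intros rtranclp.rtrancl_into_rtrancl)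
  also have "pcf_step (Pred (num_tm v)) (num_tm (v - 1))"
    by (cases v) (auto intro: pcf_step.intros)
  finally show ?thesis by (rule arel_num[OF has_ty.intros(5)[OF assms(1)]])
qed

lemma arel_Succ:
  assumes "has_ty [] P TInt" "pcf_step\<^sup>*\<^sup>* P (num_tm v)"
  shows "arel d TInt k (num (Suc v)) (Succ P)"
proof -
  have "pcf_step\<^sup>*\<^sup>* (Succ P) (Succ (num_tm v))"
    using assms(2) by (induction rule: rtranclp_induct) (auto intro: pcf_step.intros rtranclp.rtrancl_into_rtrancl)
  then show ?thesis 
    using arel_num[OF has_ty.intros(6)[OF assms(1)]] by (simp add: num_tm_Suc)
qed

section \<open>Terms for the individual instructions\<close>

lemma code_definable_load_empty:
  assumes "code_definable (\<Delta>[i := Some \<beta>]) P [] \<alpha>"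
  shows "code_definable \<Delta> (Load i P) [] (\<beta> \<rightarrow> \<alpha>)"
  unfolding code_definable_def
proof (intro allI impI)
  fix \<Gamma> \<rho> assume c: "compat \<Delta> \<Gamma> \<rho>"
  obtain Q where Q: "has_ty (\<beta> # \<Gamma>) Q \<alpha>"
    "\<And>d k R \<sigma> a N. reg_rel d k \<Delta> R \<rho> \<sigma> \<Longrightarrow> closed_env \<sigma> \<Gamma> \<Longrightarrow> arel d \<beta> k a N \<Longrightarrow>
       sim d \<alpha> k (EAM (R[i := Some a]) P []) (App (Lam (csub (Suc 0) \<sigma> Q)) N)"
    using code_definable_let[OF assms c] by metis
  have "sim d (\<beta> \<rightarrow> \<alpha>) k (EAM R (Load i P) []) (csub 0 \<sigma> (Lam Q))"
    if *: "reg_rel d k \<Delta> R \<rho> \<sigma>" "closed_env \<sigma> \<Gamma>" for d k R \<sigma>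
  proof (rule sim_ArrI)
    fix j b N assume "j \<le> k" "arel d \<beta> j b N"
    with Q(2)[OF reg_rel_mono[OF *(1)] *(2)]
    have "sim d \<alpha> j (EAM (R[i := Some b]) P []) (App (csub 0 \<sigma> (Lam Q)) N)" by simp
    moreover have "step (EAM R (Load i P) [] @@ [b]) (EAM (R[i := Some b]) P [])"
      using step.intros(2) by simp
    ultimately show "sim d \<alpha> j (EAM R (Load i P) [] @@ [b]) (App (csub 0 \<sigma> (Lam Q)) N)"
      using sim_Mc by blast
  qed
  then show "\<exists>Q. has_ty \<Gamma> Q (\<beta> \<rightarrow> \<alpha>) \<and> (\<forall>d k R \<sigma>. reg_rel d k \<Delta> R \<rho> \<sigma> \<longrightarrow> closed_env \<sigma> \<Gamma> \<longrightarrow>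
        sim d (\<beta> \<rightarrow> \<alpha>) k (EAM R (Load i P) []) (csub 0 \<sigma> Q))"
    using Q(1) has_ty.intros(3) by blast
qed

definition definable :: "'a eam \<Rightarrow> ty \<Rightarrow> bool" where
  "definable M \<alpha> \<longleftrightarrow> (\<exists>Q. has_ty [] Q \<alpha> \<and> (\<forall>d k. sim d \<alpha> k M Q))"

lemma code_definable_load:
  assumes "code_definable (\<Delta>[i := Some \<beta>]) P T \<alpha>" "eam_ty (mach a) \<beta>" "definable (mach a) \<beta>"
  shows "code_definable \<Delta> (Load i P) (a # T) \<alpha>"
  unfolding code_definable_def
proof (intro allI impI)
  fix \<Gamma> \<rho> assume c: "compat \<Delta> \<Gamma> \<rho>"
  obtain Q where Q: "has_ty (\<beta> # \<Gamma>) Q \<alpha>"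
    "\<And>d k R \<sigma> a N. reg_rel d k \<Delta> R \<rho> \<sigma> \<Longrightarrow> closed_env \<sigma> \<Gamma> \<Longrightarrow> arel d \<beta> k a N \<Longrightarrow>
       sim d \<alpha> k (EAM (R[i := Some a]) P T) (App (Lam (csub (Suc 0) \<sigma> Q)) N)"
    using code_definable_let[OF assms(1) c] by metis
  obtain N where N: "has_ty [] N \<beta>" "\<And>d k. sim d \<beta> k (mach a) N"
    using assms(3) by (auto simp: definable_def)
  have "sim d \<alpha> k (EAM R (Load i P) (a # T)) (csub 0 \<sigma> (App (Lam Q) N))"
    if *: "reg_rel d k \<Delta> R \<rho> \<sigma>" "closed_env \<sigma> \<Gamma>" for d k R \<sigma>
  proof -
    have "arel d \<beta> k a N" using N assms(2) by (simp add: arel_def)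
    from Q(2)[OF * this] csub_id[OF N(1), of 0]
    have "sim d \<alpha> k (EAM (R[i := Some a]) P T) (csub 0 \<sigma> (App (Lam Q) N))" by simp
    then show ?thesis using step.intros(2) sim_Mc by blast
  qed
  moreover have "has_ty \<Gamma> (App (Lam Q) N) \<alpha>"
    using Q(1) N(1) has_ty.intros(2,3) has_ty_closed_weaken by blast
  ultimately show "\<exists>Q. has_ty \<Gamma> Q \<alpha> \<and> (\<forall>d k R \<sigma>. reg_rel d k \<Delta> R \<rho> \<sigma> \<longrightarrow> closed_env \<sigma> \<Gamma> \<longrightarrow>
        sim d \<alpha> k (EAM R (Load i P) (a # T)) (csub 0 \<sigma> Q))"
    by blast
qed

lemma code_definable_app:
  assumes "code_definable (\<Delta>[x := Some \<gamma>]) (Run A) T \<alpha>"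
    "get \<Delta> i = Some (\<beta> \<rightarrow> \<gamma>)" "get \<Delta> j = Some \<beta>"
  shows "code_definable \<Delta> (Run (AppI x i j A)) T \<alpha>"
  unfolding code_definable_def
proof (intro allI impI)
  fix \<Gamma> \<rho> assume c: "compat \<Delta> \<Gamma> \<rho>"
  obtain Q where Q: "has_ty (\<gamma> # \<Gamma>) Q \<alpha>"
    "\<And>d k R \<sigma> a N. reg_rel d k \<Delta> R \<rho> \<sigma> \<Longrightarrow> closed_env \<sigma> \<Gamma> \<Longrightarrow> arel d \<gamma> k a N \<Longrightarrow>
       sim d \<alpha> k (EAM (R[x := Some a]) (Run A) T) (App (Lam (csub (Suc 0) \<sigma> Q)) N)"
    using code_definable_let[OF assms(1) c] by metis
  let ?N = "App (Var (\<rho> i)) (Var (\<rho> j))"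
  have "sim d \<alpha> k (EAM R (Run (AppI x i j A)) T) (csub 0 \<sigma> (App (Lam Q) ?N))"
    if *: "reg_rel d k \<Delta> R \<rho> \<sigma>" "closed_env \<sigma> \<Gamma>" for d k R \<sigma>
  proof -
    obtain a b where ab: "get R i = Some a" "arel d (\<beta> \<rightarrow> \<gamma>) k a (\<sigma> ! \<rho> i)"
      "get R j = Some b" "arel d \<beta> k b (\<sigma> ! \<rho> j)"
      using reg_rel_get[OF *(1)] assms(2,3) by metis
    then have "arel d \<gamma> k (a \<cdot> b) (App (\<sigma> ! \<rho> i) (\<sigma> ! \<rho> j))"
      using arel_App by blast
    from Q(2)[OF * this] csub_env_Var[OF c *(2)] assms(2,3)
    have "sim d \<alpha> k (EAM (R[x := Some (a \<cdot> b)]) (Run A) T) (csub 0 \<sigma> (App (Lam Q) ?N))"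
      by (simp del: csub.simps(1))
    then show ?thesis using step.intros(3)[OF ab(1,3)] sim_Mc by blast
  qed
  moreover have "has_ty \<Gamma> (App (Lam Q) ?N) \<alpha>"
    using Q(1) has_ty_env_Var[OF c] assms(2,3) has_ty.intros(2,3) by metis
  ultimately show "\<exists>Q. has_ty \<Gamma> Q \<alpha> \<and> (\<forall>d k R \<sigma>. reg_rel d k \<Delta> R \<rho> \<sigma> \<longrightarrow> closed_env \<sigma> \<Gamma> \<longrightarrow>
        sim d \<alpha> k (EAM R (Run (AppI x i j A)) T) (csub 0 \<sigma> Q))"
    by blast
qed

text \<open>A machine evaluates the argument of \<open>PredI\<close> or \<open>SuccI\<close> even if the result is not used. The
  terms below enforce this by a conditional with equal branches.\<close>

lemma code_definable_pred:
  assumes "code_definable (\<Delta>[j := Some TInt]) (Run A) T \<alpha>" "get \<Delta> i = Some TInt"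
  shows "code_definable \<Delta> (Run (PredI j i A)) T \<alpha>"
  unfolding code_definable_def
proof (intro allI impI)
  fix \<Gamma> \<rho> assume c: "compat \<Delta> \<Gamma> \<rho>"
  obtain Q where Q: "has_ty (TInt # \<Gamma>) Q \<alpha>"
    "\<And>d k R \<sigma> a N. reg_rel d k \<Delta> R \<rho> \<sigma> \<Longrightarrow> closed_env \<sigma> \<Gamma> \<Longrightarrow> arel d TInt k a N \<Longrightarrow>
       sim d \<alpha> k (EAM (R[j := Some a]) (Run A) T) (App (Lam (csub (Suc 0) \<sigma> Q)) N)"
    using code_definable_let[OF assms(1) c] by metis
  let ?x = "Var (\<rho> i)"
  let ?L = "App (Lam Q) (Pred ?x)"
  have "sim d \<alpha> k (EAM R (Run (PredI j i A)) T) (csub 0 \<sigma> (Ifz ?x ?L ?L))"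
    if *: "reg_rel d k \<Delta> R \<rho> \<sigma>" "closed_env \<sigma> \<Gamma>" for d k R \<sigma>
  proof -
    obtain a where a: "get R i = Some a" "arel d TInt k a (\<sigma> ! \<rho> i)"
      using reg_rel_get[OF *(1)] assms(2) by metis
    have x: "csub 0 \<sigma> ?x = \<sigma> ! \<rho> i" using csub_env_Var[OF c *(2)] assms(2) .
    have "sim d \<alpha> k (EAM (R[i := Some (addr (mach a))]) (Run (PredI j i A)) T)
        (Ifz (\<sigma> ! \<rho> i) (csub 0 \<sigma> ?L) (csub 0 \<sigma> ?L))"
    proof (rule sim_forces[OF forces_PredI forces_Ifz])
      show "i < length R" using get_less[OF a(1)] .
      show "sim d TInt k (mach a) (\<sigma> ! \<rho> i)" using a(2) by (simp add: arel_def)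
      fix v assume v: "pcf_step\<^sup>*\<^sup>* (\<sigma> ! \<rho> i) (num_tm v)"
      have "arel d TInt k (num (v - 1)) (Pred (\<sigma> ! \<rho> i))"
        using arel_Pred[OF _ v] a(2) by (simp add: arel_def)
      from Q(2)[OF reg_rel_num[OF *(1) assms(2) v] *(2) this]
      show "sim d \<alpha> k (EAM (R[i := Some (num v), j := Some (num (v - 1))]) (Run A) T)
          (if v = 0 then csub 0 \<sigma> ?L else csub 0 \<sigma> ?L)"
        using x by (simp del: csub.simps(1))
    qed simp
    then show ?thesis using x list_update_get[OF a(1)] by (simp del: csub.simps(1))
  qed
  moreover have "has_ty \<Gamma> (Ifz ?x ?L ?L) \<alpha>"
    using Q(1) has_ty_env_Var[OF c assms(2)] by (auto intro!: has_ty.intros(2,3,5,7))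
  ultimately show "\<exists>Q. has_ty \<Gamma> Q \<alpha> \<and> (\<forall>d k R \<sigma>. reg_rel d k \<Delta> R \<rho> \<sigma> \<longrightarrow> closed_env \<sigma> \<Gamma> \<longrightarrow>
        sim d \<alpha> k (EAM R (Run (PredI j i A)) T) (csub 0 \<sigma> Q))"
    by blast
qed

lemma code_definable_succ:
  assumes "code_definable (\<Delta>[j := Some TInt]) (Run A) T \<alpha>" "get \<Delta> i = Some TInt"
  shows "code_definable \<Delta> (Run (SuccI j i A)) T \<alpha>"
  unfolding code_definable_def
proof (intro allI impI)
  fix \<Gamma> \<rho> assume c: "compat \<Delta> \<Gamma> \<rho>"
  obtain Q where Q: "has_ty (TInt # \<Gamma>) Q \<alpha>"
    "\<And>d k R \<sigma> a N. reg_rel d k \<Delta> R \<rho> \<sigma> \<Longrightarrow> closed_env \<sigma> \<Gamma> \<Longrightarrow> arel d TInt k a N \<Longrightarrow>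
       sim d \<alpha> k (EAM (R[j := Some a]) (Run A) T) (App (Lam (csub (Suc 0) \<sigma> Q)) N)"
    using code_definable_let[OF assms(1) c] by metis
  let ?x = "Var (\<rho> i)"
  let ?L = "App (Lam Q) (Succ ?x)"
  have "sim d \<alpha> k (EAM R (Run (SuccI j i A)) T) (csub 0 \<sigma> (Ifz ?x ?L ?L))"
    if *: "reg_rel d k \<Delta> R \<rho> \<sigma>" "closed_env \<sigma> \<Gamma>" for d k R \<sigma>
  proof -
    obtain a where a: "get R i = Some a" "arel d TInt k a (\<sigma> ! \<rho> i)"
      using reg_rel_get[OF *(1)] assms(2) by metis
    have x: "csub 0 \<sigma> ?x = \<sigma> ! \<rho> i" using csub_env_Var[OF c *(2)] assms(2) .
    have "sim d \<alpha> k (EAM (R[i := Some (addr (mach a))]) (Run (SuccI j i A)) T)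
        (Ifz (\<sigma> ! \<rho> i) (csub 0 \<sigma> ?L) (csub 0 \<sigma> ?L))"
    proof (rule sim_forces[OF forces_SuccI forces_Ifz])
      show "i < length R" using get_less[OF a(1)] .
      show "sim d TInt k (mach a) (\<sigma> ! \<rho> i)" using a(2) by (simp add: arel_def)
      fix v assume v: "pcf_step\<^sup>*\<^sup>* (\<sigma> ! \<rho> i) (num_tm v)"
      have "arel d TInt k (num (Suc v)) (Succ (\<sigma> ! \<rho> i))"
        using arel_Succ[OF _ v] a(2) by (simp add: arel_def)
      from Q(2)[OF reg_rel_num[OF *(1) assms(2) v] *(2) this]
      show "sim d \<alpha> k (EAM (R[i := Some (num v), j := Some (num (Suc v))]) (Run A) T)
          (if v = 0 then csub 0 \<sigma> ?L else csub 0 \<sigma> ?L)"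
        using x by (simp del: csub.simps(1))
    qed simp
    then show ?thesis using x list_update_get[OF a(1)] by (simp del: csub.simps(1))
  qed
  moreover have "has_ty \<Gamma> (Ifz ?x ?L ?L) \<alpha>"
    using Q(1) has_ty_env_Var[OF c assms(2)] by (auto intro!: has_ty.intros(2,3,6,7))
  ultimately show "\<exists>Q. has_ty \<Gamma> Q \<alpha> \<and> (\<forall>d k R \<sigma>. reg_rel d k \<Delta> R \<rho> \<sigma> \<longrightarrow> closed_env \<sigma> \<Gamma> \<longrightarrow>
        sim d \<alpha> k (EAM R (Run (SuccI j i A)) T) (csub 0 \<sigma> Q))"
    by blast
qed

text \<open>The continuation is copied into both branches. Binding a conditional to a variable
  instead would delay the test until its result is used, whereas the machine performs it at
  once.\<close>

lemma code_definable_test: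
  assumes "code_definable (\<Delta>[l := Some \<beta>]) (Run A) T \<alpha>" "get \<Delta> i = Some TInt"
    "get \<Delta> j = Some \<beta>" "get \<Delta> h = Some \<beta>"
  shows "code_definable \<Delta> (Run (TestI l i j h A)) T \<alpha>"
  unfolding code_definable_def
proof (intro allI impI)
  fix \<Gamma> \<rho> assume c: "compat \<Delta> \<Gamma> \<rho>"
  obtain Q where Q: "has_ty (\<beta> # \<Gamma>) Q \<alpha>"
    "\<And>d k R \<sigma> a N. reg_rel d k \<Delta> R \<rho> \<sigma> \<Longrightarrow> closed_env \<sigma> \<Gamma> \<Longrightarrow> arel d \<beta> k a N \<Longrightarrow>
       sim d \<alpha> k (EAM (R[l := Some a]) (Run A) T) (App (Lam (csub (Suc 0) \<sigma> Q)) N)"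
    using code_definable_let[OF assms(1) c] by metis
  let ?x = "\<lambda>i. Var (\<rho> i)"
  let ?L = "\<lambda>j. App (Lam Q) (?x j)"
  have "sim d \<alpha> k (EAM R (Run (TestI l i j h A)) T) (csub 0 \<sigma> (Ifz (?x i) (?L j) (?L h)))"
    if *: "reg_rel d k \<Delta> R \<rho> \<sigma>" "closed_env \<sigma> \<Gamma>" for d k R \<sigma>
  proof -
    obtain a where a: "get R i = Some a" "arel d TInt k a (\<sigma> ! \<rho> i)"
      using reg_rel_get[OF *(1)] assms(2) by metis
    have x: "csub 0 \<sigma> (?x i) = \<sigma> ! \<rho> i" "csub 0 \<sigma> (?x j) = \<sigma> ! \<rho> j" "csub 0 \<sigma> (?x h) = \<sigma> ! \<rho> h"
      using csub_env_Var[OF c *(2)] assms(2-4) by blast+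
    obtain b b' where b: "get R j = Some b" "get R h = Some b'"
      using reg_rel_get[OF *(1)] assms(3,4) by metis
    have "sim d \<alpha> k (EAM (R[i := Some (addr (mach a))]) (Run (TestI l i j h A)) T)
        (Ifz (\<sigma> ! \<rho> i) (csub 0 \<sigma> (?L j)) (csub 0 \<sigma> (?L h)))"
    proof (rule sim_forces[OF forces_TestI forces_Ifz])
      show "i < length R" "j < length R" "h < length R" "R ! j \<noteq> None" "R ! h \<noteq> None"
        using get_less[OF a(1)] get_less[OF b(1)] get_less[OF b(2)] b by (auto simp: get_def)
      show "sim d TInt k (mach a) (\<sigma> ! \<rho> i)" using a(2) by (simp add: arel_def)
      fix v assume v: "pcf_step\<^sup>*\<^sup>* (\<sigma> ! \<rho> i) (num_tm v)"
      let ?m = "if v = 0 then j else h"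
      note rr = reg_rel_num[OF *(1) assms(2) v]
      have "get \<Delta> ?m = Some \<beta>" using assms by simp
      from reg_rel_get[OF rr this] obtain e where
        e: "get (R[i := Some (num v)]) ?m = Some e" "arel d \<beta> k e (\<sigma> ! \<rho> ?m)" .
      have "R[i := Some (num v)] ! ?m = Some e" using e(1) by (simp only: get_def split: if_splits) auto
      with Q(2)[OF rr *(2) e(2)]
      show "sim d \<alpha> k (EAM (R[i := Some (num v), l := R[i := Some (num v)] ! ?m]) (Run A) T)
          (if v = 0 then csub 0 \<sigma> (?L j) else csub 0 \<sigma> (?L h))"
        using x by (simp del: csub.simps(1) split: if_splits)
    qed simp
    then show ?thesis using x list_update_get[OF a(1)] by (simp del: csub.simps(1))
  qed
  moreover have "has_ty \<Gamma> (Ifz (?x i) (?L j) (?L h)) \<alpha>"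
    using Q(1) has_ty_env_Var[OF c] assms(2-4) by (auto intro!: has_ty.intros(2,3,7))
  ultimately show "\<exists>Q. has_ty \<Gamma> Q \<alpha> \<and> (\<forall>d k R \<sigma>. reg_rel d k \<Delta> R \<rho> \<sigma> \<longrightarrow> closed_env \<sigma> \<Gamma> \<longrightarrow>
        sim d \<alpha> k (EAM R (Run (TestI l i j h A)) T) (csub 0 \<sigma> Q))"
    by blast
qed

lemma sim_apps:
  "length T = length \<beta>s \<Longrightarrow> length Qs = length \<beta>s \<Longrightarrow>
   (\<And>i. i < length \<beta>s \<Longrightarrow> arel d (\<beta>s ! i) k (T ! i) (Qs ! i)) \<Longrightarrow>
   sim d (arrs \<beta>s \<alpha>) k M P \<Longrightarrow> sim d \<alpha> k (M @@ T) (foldl App P Qs)"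
proof (induction \<beta>s arbitrary: T Qs M P)
  case (Cons \<beta> \<beta>s)
  then obtain a T' N Qs' where T: "T = a # T'" "Qs = N # Qs'"
    by (metis length_Suc_conv list.size(4) Suc_eq_plus1)
  have "sim d \<alpha> k ((M @@ [a]) @@ T') (foldl App (App P N) Qs')"
  proof (rule Cons.IH)
    show "sim d (arrs \<beta>s \<alpha>) k (M @@ [a]) (App P N)"
      using Cons.prems(3)[of 0] Cons.prems(4) T sim_App by simp
    show "arel d (\<beta>s ! i) k (T' ! i) (Qs' ! i)" if "i < length \<beta>s" for i
      using Cons.prems(3)[of "Suc i"] that T by simp
  qed (use Cons.prems T in auto)
  then show ?case using T by simp
qed simp

lemma has_ty_apps:
  "list_all2 (has_ty \<Gamma>) Qs \<beta>s \<Longrightarrow> has_ty \<Gamma> P (arrs \<beta>s \<alpha>) \<Longrightarrow> has_ty \<Gamma> (foldl App P Qs) \<alpha>"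
  by (induction arbitrary: P rule: list_all2_induct) (auto intro: has_ty.intros)

lemma csub_apps: "csub k \<sigma> (foldl App P Qs) = foldl App (csub k \<sigma> P) (map (csub k \<sigma>) Qs)"
  by (induction Qs arbitrary: P) auto

text \<open>The called machine inherits the tape, so the term applies the variable of the register
  to closed terms for the inputs, which \<open>csub\<close> leaves unchanged.\<close>

lemma code_definable_call:
  assumes "get \<Delta> i = Some (arrs \<beta>s \<alpha>)"
    "list_all2 (\<lambda>a \<beta>. eam_ty (mach a) \<beta> \<and> definable (mach a) \<beta>) T \<beta>s"
  shows "code_definable \<Delta> (Run (Call i)) T \<alpha>"
  unfolding code_definable_def
proof (intro allI impI)
  fix \<Gamma> \<rho> assume c: "compat \<Delta> \<Gamma> \<rho>"
  have "\<forall>i<length \<beta>s. \<exists>Q. has_ty [] Q (\<beta>s ! i) \<and> (\<forall>d k. sim d (\<beta>s ! i) k (mach (T ! i)) Q)"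
    using assms(2) by (auto simp: list_all2_conv_all_nth definable_def)
  then obtain q where q: "\<And>i. i < length \<beta>s \<Longrightarrow> has_ty [] (q i) (\<beta>s ! i)"
    "\<And>i d k. i < length \<beta>s \<Longrightarrow> sim d (\<beta>s ! i) k (mach (T ! i)) (q i)"
    by metis
  define Qs where "Qs = map q [0..<length \<beta>s]"
  have "sim d \<alpha> k (EAM R (Run (Call i)) T) (csub 0 \<sigma> (foldl App (Var (\<rho> i)) Qs))"
    if *: "reg_rel d k \<Delta> R \<rho> \<sigma>" "closed_env \<sigma> \<Gamma>" for d k R \<sigma>
  proof -
    obtain a where a: "get R i = Some a" "arel d (arrs \<beta>s \<alpha>) k a (\<sigma> ! \<rho> i)"
      using reg_rel_get[OF *(1)] assms(1) by metis
    have "map (csub 0 \<sigma>) Qs = Qs"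
      using csub_id[OF q(1)] by (auto simp: Qs_def)
    moreover have "sim d \<alpha> k (mach a @@ T) (foldl App (\<sigma> ! \<rho> i) Qs)"
      using a(2) q assms(2)
      by (intro sim_apps[of T \<beta>s]) (auto simp: Qs_def arel_def list_all2_conv_all_nth)
    ultimately have "sim d \<alpha> k (mach a @@ T) (csub 0 \<sigma> (foldl App (Var (\<rho> i)) Qs))"
      using csub_env_Var[OF c *(2) assms(1)] by (simp add: csub_apps del: csub.simps(1))
    then show ?thesis using step.intros(1)[OF a(1)] sim_Mc by blast
  qed
  moreover have "has_ty \<Gamma> (foldl App (Var (\<rho> i)) Qs) \<alpha>"
    using has_ty_env_Var[OF c assms(1)] q(1)
    by (intro has_ty_apps[where \<beta>s = \<beta>s])
      (auto simp: Qs_def list_all2_conv_all_nth intro: has_ty_closed_weaken)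
  ultimately show "\<exists>Q. has_ty \<Gamma> Q \<alpha> \<and> (\<forall>d k R \<sigma>. reg_rel d k \<Delta> R \<rho> \<sigma> \<longrightarrow> closed_env \<sigma> \<Gamma> \<longrightarrow>
        sim d \<alpha> k (EAM R (Run (Call i)) T) (csub 0 \<sigma> Q))"
    by blast
qed

lemma definable_eam:
  assumes "list_all2 (rel_option (\<lambda>a \<beta>. eam_ty (mach a) \<beta> \<and> definable (mach a) \<beta>)) R \<Delta>"
    "code_definable \<Delta> P T \<alpha>"
  shows "definable (EAM R P T) \<alpha>"
proof -
  have *: "\<exists>a. get R i = Some a \<and> eam_ty (mach a) \<beta> \<and> definable (mach a) \<beta>"
    if "get \<Delta> i = Some \<beta>" for i \<beta>
  proof -
    have i: "i < length \<Delta>" "\<Delta> ! i = Some \<beta>"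
      using that get_less[OF that] by (auto simp: get_def)
    with list_all2_nthD2[OF assms(1) i(1)] list_all2_lengthD[OF assms(1)] show ?thesis
      by (auto simp: option_rel_Some2 get_def)
  qed
  \<comment> \<open>Uninitialised registers get the dummy type \<open>TInt\<close>, inhabited by
    \<open>Zero\<close>; then every register has its own variable and \<open>\<rho>\<close> can be
    the identity.\<close>
  define \<Gamma> where "\<Gamma> = map (case_option TInt id) \<Delta>"
  have "\<exists>Q. has_ty [] Q (\<Gamma> ! i) \<and> (\<forall>\<beta> d k. get \<Delta> i = Some \<beta> \<longrightarrow> (\<exists>a. get R i = Some a \<and> arel d \<beta> k a Q))"
    if "i < length \<Delta>" for i
  proof (cases "\<Delta> ! i")
    case None
    then have "get \<Delta> i = None" "\<Gamma> ! i = TInt" using that by (auto simp: get_def \<Gamma>_def)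
    then show ?thesis using has_ty.intros(4) by (metis option.distinct(1))
  next
    case (Some \<beta>)
    then have "get \<Delta> i = Some \<beta>" "\<Gamma> ! i = \<beta>" using that by (auto simp: get_def \<Gamma>_def)
    moreover obtain a N where "get R i = Some a" "eam_ty (mach a) \<beta>" "has_ty [] N \<beta>"
      "\<And>d k. sim d \<beta> k (mach a) N"
      using *[OF \<open>get \<Delta> i = Some \<beta>\<close>] unfolding definable_def by blast
    ultimately show ?thesis unfolding arel_def by (intro exI[of _ N]) simp
  qed
  then obtain q where q: "\<And>i. i < length \<Delta> \<Longrightarrow> has_ty [] (q i) (\<Gamma> ! i)"
    "\<And>i \<beta> d k. i < length \<Delta> \<Longrightarrow> get \<Delta> i = Some \<beta> \<Longrightarrow> \<exists>a. get R i = Some a \<and> arel d \<beta> k a (q i)"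
    by metis
  define \<sigma> where "\<sigma> = map q [0..<length \<Delta>]"
  have "compat \<Delta> \<Gamma> id"
    by (auto simp: compat_def \<Gamma>_def get_def split: if_splits)
  then obtain Q where Q: "has_ty \<Gamma> Q \<alpha>" "\<And>d k R \<sigma>. reg_rel d k \<Delta> R id \<sigma> \<Longrightarrow> closed_env \<sigma> \<Gamma> \<Longrightarrow>
        sim d \<alpha> k (EAM R P T) (csub 0 \<sigma> Q)"
    using assms(2) unfolding code_definable_def by metis
  have c: "closed_env \<sigma> \<Gamma>"
    using q(1) by (auto simp: closed_env_def \<sigma>_def list_all2_conv_all_nth \<Gamma>_def)
  moreover have "reg_rel d k \<Delta> R id \<sigma>" for d k
    unfolding reg_rel_def
  proof (intro conjI allI impI)
    fix i \<beta> assume i: "get \<Delta> i = Some \<beta>"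
    then have "i < length \<Delta>" by (rule get_less)
    then show "\<exists>a. get R i = Some a \<and> arel d \<beta> k a (\<sigma> ! id i)"
      using q(2)[OF _ i] by (simp add: \<sigma>_def)
  qed (rule list_all2_lengthD[OF assms(1)])
  ultimately show ?thesis
    using Q(2) has_ty_csub_env[OF c Q(1)] unfolding definable_def by blast
qed

text \<open>The rule \<open>ty_fix\<close> offers no code derivation to follow, so
  \<open>sim_fix\<close> compares the machine directly with the fixed-point operator.\<close>

lemma definable_Y: "definable (Y_eam y) ((\<alpha> \<rightarrow> \<alpha>) \<rightarrow> \<alpha>)"
proof -
  have "has_ty [] (Lam (Fix (Var 0))) ((\<alpha> \<rightarrow> \<alpha>) \<rightarrow> \<alpha>)"
    using has_ty.intros(1)[of 0 "[\<alpha> \<rightarrow> \<alpha>]"] by (auto intro: has_ty.intros)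
  moreover have "sim d ((\<alpha> \<rightarrow> \<alpha>) \<rightarrow> \<alpha>) k (Y_eam y) (Lam (Fix (Var 0)))" for d k
  proof (rule sim_ArrI)
    fix j b Q assume "arel d (\<alpha> \<rightarrow> \<alpha>) j b Q"
    moreover have "pcf_step (App (Lam (Fix (Var 0))) Q) (Fix Q)"
      using pcf_step.intros(1)[of "Fix (Var 0)" Q] by simp
    ultimately show "sim d \<alpha> j (Y_eam y @@ [b]) (App (Lam (Fix (Var 0))) Q)"
      using sim_fix sim_Tm by blast
  qed
  ultimately show ?thesis unfolding definable_def by blast
qed

lemma definable_num: "definable (numeral_eam n) TInt"
proof -
  have "has_ty [] (num_tm n) TInt" by (induction n) (auto simp: num_tm_Suc intro: has_ty.intros)
  then show ?thesis unfolding definable_def using sim_num by blast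
qed

text \<open>Machines could refer to each other in cycles, but \<open>ty_eam\<close> asks for
  derivations of the stored addresses first. Cycles enter only through the numeral machines and
  \<open>Y_eam y\<close>, whose own rules do not look into the registers.\<close>

lemma eam_ty_definable: "eam_ty M \<alpha> \<Longrightarrow> definable M \<alpha>"
  and code_ty_definable: "code_ty \<Delta> P T \<alpha> \<Longrightarrow> code_definable \<Delta> P T \<alpha>"
proof (induction rule: eam_ty_code_ty.inducts)
  case (ty_call \<Delta> i \<beta>s \<alpha> T)
  then show ?case using code_definable_call by blast
qed (blast intro: definable_num definable_Y definable_eam code_definable_load_empty
    code_definable_load code_definable_app code_definable_pred code_definable_succ
    code_definable_test)+

end

section \<open>Full abstraction\<close>

context address_table_map
begin

text \<open>Soundness of the translation supplies the counterpart of a term, definability that of a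
  machine.\<close>

lemma twin:
  assumes "oty X \<alpha>" "is_Mc X \<noteq> b"
  obtains X' where "is_Mc X' = b" "oty X' \<alpha>" "\<And>k. LR \<alpha> k X X'" "\<And>k. LR \<alpha> k X' X"
proof (cases X)
  case (Tm P)
  have "LR \<alpha> k X (Mc (Tr 0 P))" "LR \<alpha> k (Mc (Tr 0 P)) X" for k
    using Tr_closed_sim[of P \<alpha> True k] Tr_closed_sim[of P \<alpha> False k] Tm assms(1)
    by (simp_all add: sim_def)
  then show ?thesis
    using that[of "Mc (Tr 0 P)"] Tr_ty[of "[]" P \<alpha>] Tm assms by simp
next
  case (Mc M)
  then obtain Q where Q: "has_ty [] Q \<alpha>" "\<And>d k. sim d \<alpha> k M Q"
    using eam_ty_definable[of M \<alpha>] assms(1) by (auto simp: definable_def)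
  have "LR \<alpha> k X (Tm Q)" "LR \<alpha> k (Tm Q) X" for k
    using Q(2)[of True k] Q(2)[of False k] Mc by (simp_all add: sim_def)
  then show ?thesis using that[of "Tm Q"] Q(1) Mc assms by simp
qed

lemma oty_oapp:
  "oty X (\<alpha> \<rightarrow> \<beta>) \<Longrightarrow> oty A \<alpha> \<Longrightarrow> is_Mc A = is_Mc X \<Longrightarrow> oty (oapp X A) \<beta>"
  by (cases X; cases A) (auto intro: has_ty.intros(2) eam_ty_app_addr)

text \<open>At arrow types the middle object may be of another kind than the outer ones, so going through it
  needs an argument of its kind, provided by a twin.\<close>

lemma LR_trans:
  "oty X \<alpha> \<Longrightarrow> oty Y \<alpha> \<Longrightarrow> oty Z \<alpha> \<Longrightarrow> LR \<alpha> k X Y \<Longrightarrow> (\<And>k. LR \<alpha> k Y Z) \<Longrightarrow> LR \<alpha> k X Z"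
proof (induction \<alpha> arbitrary: X Y Z k)
  case TInt
  show ?case unfolding LR.simps
  proof (intro allI impI)
    fix j n assume "j < k" "ev X j n"
    then obtain i where "ev Y i n" using TInt(4) by auto
    \<comment> \<open>The run of \<open>Y\<close> has an unknown length \<open>i\<close>, so the
      second approximation is needed at an index above it.\<close>
    then show "\<exists>i. ev Z i n" using TInt(5)[of "Suc i"] by auto
  qed
next
  case (Arr \<alpha> \<beta>)
  \<comment> \<open>Transitivity at the smaller type, along \<open>A\<close>, its twin and
    \<open>A\<close> again.\<close>
  have refl: "LR \<alpha> k A A" if A: "oty A \<alpha>" for A k
  proof -
    obtain A' where A': "is_Mc A' = (\<not> is_Mc A)" "oty A' \<alpha>" "\<And>k. LR \<alpha> k A A'" "\<And>k. LR \<alpha> k A' A"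
      using twin[OF A, of "\<not> is_Mc A"] by blast
    show ?thesis using Arr.IH(1)[OF A A'(2) A A'(3) A'(4)] .
  qed
  have twin': "\<exists>B'. is_Mc B' = b \<and> oty B' \<alpha> \<and> (\<forall>k. LR \<alpha> k B B') \<and> (\<forall>k. LR \<alpha> k B' B)"
    if B: "oty B \<alpha>" for B b
  proof (cases "is_Mc B = b")
    case False
    then show ?thesis using twin[OF B False] by metis
  qed (use B refl in blast)
  show ?case unfolding LR.simps
  proof (intro allI impI)
    fix j A B
    assume *: "j \<le> k" "is_Mc A = is_Mc X" "is_Mc B = is_Mc Z" "oty A \<alpha>" "oty B \<alpha>" "LR \<alpha> j A B"
    obtain B' where B': "is_Mc B' = is_Mc Y" "oty B' \<alpha>" "\<And>k. LR \<alpha> k B B'" "\<And>k. LR \<alpha> k B' B"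
      using twin'[OF *(5)] by metis
    have "LR \<alpha> j A B'" using Arr.IH(1)[OF *(4,5) B'(2) *(6) B'(3)] .
    then have 1: "LR \<beta> j (oapp X A) (oapp Y B')"
      using Arr.prems(4) * B'(1,2) by simp
    have 2: "LR \<beta> i (oapp Y B') (oapp Z B)" for i
      using Arr.prems(5)[of i] B' * by simp
    show "LR \<beta> j (oapp X A) (oapp Z B)"
      using Arr.IH(2)[OF _ _ _ 1 2] Arr.prems(1-3) oty_oapp * B'(1,2) by metis
  qed
qed

lemma LR_refl: "oty A \<alpha> \<Longrightarrow> LR \<alpha> k A A"
proof -
  assume A: "oty A \<alpha>"
  obtain A' where A': "is_Mc A' = (\<not> is_Mc A)" "oty A' \<alpha>" "\<And>k. LR \<alpha> k A A'" "\<And>k. LR \<alpha> k A' A"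
    using twin[OF A, of "\<not> is_Mc A"] by blast
  show ?thesis using LR_trans[OF A A'(2) A A'(3,4)] .
qed

lemma LR_oapp:
  "LR (\<alpha> \<rightarrow> \<beta>) k X Y \<Longrightarrow> j \<le> k \<Longrightarrow> LR \<alpha> j A B \<Longrightarrow> is_Mc A = is_Mc X \<Longrightarrow> is_Mc B = is_Mc Y \<Longrightarrow>
   oty A \<alpha> \<Longrightarrow> oty B \<alpha> \<Longrightarrow> LR \<beta> j (oapp X A) (oapp Y B)"
  by simp

text \<open>\<open>eam_eq\<close> says nothing about arguments related in one direction or at one
  index only. Testing it on equal arguments is enough: for \<open>A\<close> below \<open>B\<close>,
  the application of \<open>K\<close> to \<open>A\<close> is below that of \<open>K\<close> to
  \<open>B\<close>, as \<open>K\<close> is related to itself, and this is below the application of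
  \<open>L\<close> to \<open>B\<close>. The converse uses both directions at all indices.\<close>

lemma eam_eq_iff_LR:
  "eam_ty M \<alpha> \<Longrightarrow> eam_ty N \<alpha> \<Longrightarrow>
   eam_eq \<alpha> M N \<longleftrightarrow> (\<forall>k. LR \<alpha> k (Mc M) (Mc N) \<and> LR \<alpha> k (Mc N) (Mc M))"
proof (induction \<alpha> arbitrary: M N)
  case TInt
  have *: "(\<forall>k. LR TInt k (Mc M) (Mc N)) \<longleftrightarrow>
      (\<forall>n. step\<^sup>*\<^sup>* M (numeral_eam n) \<longrightarrow> step\<^sup>*\<^sup>* N (numeral_eam n))" for M N
    unfolding LR.simps ex_ev_Mc[symmetric] by blast
  show ?case using *[of M N] *[of N M] by auto
next
  case (Arr \<alpha> \<beta>)
  have app: "eam_ty (K @@ [a]) \<beta>" if "eam_ty K (\<alpha> \<rightarrow> \<beta>)" "a \<in> D \<alpha>" for K a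
    using that eam_ty_app1 by (auto simp: D_def)
  have le: "LR (\<alpha> \<rightarrow> \<beta>) k (Mc K) (Mc L)"
    if K: "eam_ty K (\<alpha> \<rightarrow> \<beta>)" and L: "eam_ty L (\<alpha> \<rightarrow> \<beta>)" and
      imp: "\<And>a k. a \<in> D \<alpha> \<Longrightarrow> LR \<beta> k (Mc (K @@ [a])) (Mc (L @@ [a]))" for K L k
    unfolding LR.simps
  proof (intro allI impI)
    fix j A B
    assume *: "j \<le> k" "is_Mc A = is_Mc (Mc K)" "is_Mc B = is_Mc (Mc L)" "oty A \<alpha>" "oty B \<alpha>" "LR \<alpha> j A B"
    then obtain a b where ab: "A = Mc a" "B = Mc b" by (cases A; cases B) auto
    have D: "addr a \<in> D \<alpha>" "addr b \<in> D \<alpha>" using * ab by (auto simp: D_def)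
    have "LR (\<alpha> \<rightarrow> \<beta>) k (Mc K) (Mc K)" using K by (intro LR_refl) simp
    from LR_oapp[OF this *(1,6) _ _ *(4,5)]
    have "LR \<beta> j (oapp (Mc K) A) (oapp (Mc K) B)" using ab by simp
    then show "LR \<beta> j (oapp (Mc K) A) (oapp (Mc L) B)"
      using LR_trans[OF _ _ _ _ imp[OF D(2)]] ab app[OF K] app[OF L] D by simp
  qed
  show ?case
  proof
    assume eq: "eam_eq (\<alpha> \<rightarrow> \<beta>) M N"
    have "LR \<beta> k (Mc (M @@ [a])) (Mc (N @@ [a]))" "LR \<beta> k (Mc (N @@ [a])) (Mc (M @@ [a]))"
      if a: "a \<in> D \<alpha>" for a k
    proof -
      have "eam_eq \<alpha> (mach a) (mach a)" using a Arr.IH(1) LR_refl by (simp add: D_def)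
      then have "eam_eq \<beta> (M @@ [a]) (N @@ [a])" using eq a by simp
      then show "LR \<beta> k (Mc (M @@ [a])) (Mc (N @@ [a]))" "LR \<beta> k (Mc (N @@ [a])) (Mc (M @@ [a]))"
        using Arr.IH(2) app[OF _ a] Arr.prems by blast+
    qed
    then show "\<forall>k. LR (\<alpha> \<rightarrow> \<beta>) k (Mc M) (Mc N) \<and> LR (\<alpha> \<rightarrow> \<beta>) k (Mc N) (Mc M)"
      using le Arr.prems by blast
  next
    assume lr: "\<forall>k. LR (\<alpha> \<rightarrow> \<beta>) k (Mc M) (Mc N) \<and> LR (\<alpha> \<rightarrow> \<beta>) k (Mc N) (Mc M)"
    have "eam_eq \<beta> (M @@ [a]) (N @@ [b])"
      if ab: "a \<in> D \<alpha>" "b \<in> D \<alpha>" "eam_eq \<alpha> (mach a) (mach b)" for a b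
    proof -
      have ty: "eam_ty (mach a) \<alpha>" "eam_ty (mach b) \<alpha>" using ab by (auto simp: D_def)
      have le: "LR \<alpha> k (Mc (mach a)) (Mc (mach b))" "LR \<alpha> k (Mc (mach b)) (Mc (mach a))" for k
        using Arr.IH(1)[OF ty] ab(3) by blast+
      have "LR \<beta> k (oapp (Mc M) (Mc (mach a))) (oapp (Mc N) (Mc (mach b)))"
        "LR \<beta> k (oapp (Mc N) (Mc (mach b))) (oapp (Mc M) (Mc (mach a)))" for k
        using LR_oapp[OF lr[THEN spec, THEN conjunct1] order_refl le(1)]
          LR_oapp[OF lr[THEN spec, THEN conjunct2] order_refl le(2)] ty by (simp_all del: oapp_simps)
      then show ?thesis using Arr.IH(2) app Arr.prems ab by simp
    qed
    then show "eam_eq (\<alpha> \<rightarrow> \<beta>) M N" by simp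
  qed
qed

section \<open>The observational preorder on terms\<close>

definition pcf_le :: "ty \<Rightarrow> tm \<Rightarrow> tm \<Rightarrow> bool" where
  "pcf_le \<alpha> P P' \<longleftrightarrow> (\<forall>C n. ctx_ty \<alpha> [] C TInt \<longrightarrow>
     pcf_step\<^sup>*\<^sup>* (fill C P) (num_tm n) \<longrightarrow> pcf_step\<^sup>*\<^sup>* (fill C P') (num_tm n))"

text \<open>The context becomes an abstraction, which is related to itself and so maps related
  programs to related results. Determinism then removes the beta step that leads to the filled
  context.\<close>

lemma LR_imp_pcf_le:
  assumes P: "has_ty [] P \<alpha>" and P': "has_ty [] P' \<alpha>" and le: "\<And>k. LR \<alpha> k (Tm P) (Tm P')"
  shows "pcf_le \<alpha> P P'"
  unfolding pcf_le_def
proof (intro allI impI)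
  fix C n
  assume C: "ctx_ty \<alpha> [] C TInt" and n: "pcf_step\<^sup>*\<^sup>* (fill C P) (num_tm n)"
  let ?F = "Lam (fill_var 0 C)"
  have F: "has_ty [] ?F (\<alpha> \<rightarrow> TInt)"
    using has_ty_fill_var[OF C] by (auto intro: has_ty.intros)
  have beta: "pcf_step (App ?F Q) (fill C Q)" if "has_ty [] Q \<alpha>" for Q
    using subst_fill_var[OF C that] pcf_step.intros(1)[of "fill_var 0 C" Q] by simp
  have "pcf_step\<^sup>*\<^sup>* (App ?F P) (num_tm n)"
    using beta[OF P] n by (rule converse_rtranclp_into_rtranclp)
  then obtain j where j: "ev (Tm (App ?F P)) j n" using ex_ev_Tm by blast
  \<comment> \<open>At ground type the index must exceed the length \<open>j\<close> of the given
    run.\<close>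
  have "LR (\<alpha> \<rightarrow> TInt) (Suc j) (Tm ?F) (Tm ?F)" using F by (intro LR_refl) simp
  from LR_oapp[OF this order_refl le] P P'
  have "LR TInt (Suc j) (Tm (App ?F P)) (Tm (App ?F P'))" by simp
  then have "pcf_step\<^sup>*\<^sup>* (App ?F P') (num_tm n)" using j ex_ev_Tm by auto
  then show "pcf_step\<^sup>*\<^sup>* (fill C P') (num_tm n)"
  proof (cases rule: converse_rtranclpE)
    case base
    then show ?thesis using num_tm_simps(4) by metis
  next
    case (step Q)
    then show ?thesis using pcf_step_det beta[OF P'] by metis
  qed
qed

text \<open>With \<open>LR_imp_pcf_le\<close> this gives Milner's context lemma: applying the
  programs to closed terms observes as much as any context. The middle term is
  \<open>App P Q'\<close>, reached by reflexivity of \<open>P\<close>; from there the hypothesis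
  applies with \<open>Q'\<close> put in front of the arguments.\<close>

lemma applicative_imp_LR:
  assumes "has_ty [] P \<alpha>" "has_ty [] P' \<alpha>"
    "\<forall>\<beta>s Qs n. \<alpha> = arrs \<beta>s TInt \<longrightarrow> list_all2 (has_ty []) Qs \<beta>s \<longrightarrow>
       pcf_step\<^sup>*\<^sup>* (foldl App P Qs) (num_tm n) \<longrightarrow> pcf_step\<^sup>*\<^sup>* (foldl App P' Qs) (num_tm n)"
  shows "LR \<alpha> k (Tm P) (Tm P')"
  using assms
proof (induction \<alpha> arbitrary: P P' k rule: ty.induct)
  case TInt
  then have "pcf_step\<^sup>*\<^sup>* P (num_tm n) \<longrightarrow> pcf_step\<^sup>*\<^sup>* P' (num_tm n)" for n
    by (metis foldl_Nil foldr_Nil id_apply list_all2_Nil)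
  then show ?case unfolding LR.simps ex_ev_Tm[symmetric] by blast
next
  case (Arr \<alpha> \<beta>)
  show ?case unfolding LR.simps
  proof (intro allI impI)
    fix j A B
    assume *: "j \<le> k" "is_Mc A = is_Mc (Tm P :: 'a obj)" "is_Mc B = is_Mc (Tm P' :: 'a obj)"
      "oty A \<alpha>" "oty B \<alpha>" "LR \<alpha> j A B"
    then obtain Q Q' where Q: "A = Tm Q" "B = Tm Q'" by (cases A; cases B) auto
    have "LR (\<alpha> \<rightarrow> \<beta>) k (Tm P) (Tm P)" using Arr.prems(1) by (intro LR_refl) simp
    from LR_oapp[OF this *(1,6) _ _ *(4,5)]
    have 1: "LR \<beta> j (Tm (App P Q)) (Tm (App P Q'))" using Q by simp
    have ty: "has_ty [] (App P Q) \<beta>" "has_ty [] (App P Q') \<beta>" "has_ty [] (App P' Q') \<beta>"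
      using Arr.prems(1,2) * Q by (auto intro: has_ty.intros)
    have "pcf_step\<^sup>*\<^sup>* (foldl App (App P' Q') Qs) (num_tm n)"
      if "\<beta> = arrs \<beta>s TInt" "list_all2 (has_ty []) Qs \<beta>s"
        "pcf_step\<^sup>*\<^sup>* (foldl App (App P Q') Qs) (num_tm n)" for \<beta>s Qs n
      using Arr.prems(3)[rule_format, of "\<alpha> # \<beta>s" "Q' # Qs" n] that * Q by simp
    then have 2: "LR \<beta> i (Tm (App P Q')) (Tm (App P' Q'))" for i
      by (intro Arr.IH(2)[OF ty(2,3)]) blast
    show "LR \<beta> j (oapp (Tm P) A) (oapp (Tm P') B)"
      using LR_trans[OF _ _ _ 1 2] ty Q by simp
  qed
qed

lemma ctx_ty_apps:
  "list_all2 (has_ty []) Qs \<beta>s \<Longrightarrow> ctx_ty \<gamma> [] C (arrs \<beta>s \<alpha>) \<Longrightarrow> ctx_ty \<gamma> [] (foldl AppC1 C Qs) \<alpha>"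
  by (induction arbitrary: C rule: list_all2_induct) (auto intro: ctx_ty.intros)

lemma fill_apps: "fill (foldl AppC1 C Qs) P = foldl App (fill C P) Qs"
  by (induction Qs arbitrary: C) auto

lemma pcf_le_iff_LR:
  assumes "has_ty [] P \<alpha>" "has_ty [] P' \<alpha>"
  shows "pcf_le \<alpha> P P' \<longleftrightarrow> (\<forall>k. LR \<alpha> k (Tm P) (Tm P'))"
proof
  assume le: "pcf_le \<alpha> P P'"
  have "pcf_step\<^sup>*\<^sup>* (foldl App P' Qs) (num_tm n)"
    if "\<alpha> = arrs \<beta>s TInt" "list_all2 (has_ty []) Qs \<beta>s" "pcf_step\<^sup>*\<^sup>* (foldl App P Qs) (num_tm n)"
    for \<beta>s Qs n
  proof -
    have "ctx_ty \<alpha> [] (foldl AppC1 Hole Qs) TInt"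
      using ctx_ty_apps[OF that(2)] that(1) ctx_ty.intros(1) by blast
    then show ?thesis using le that(3) unfolding pcf_le_def by (metis fill_apps fill.simps(1))
  qed
  then show "\<forall>k. LR \<alpha> k (Tm P) (Tm P')" using applicative_imp_LR[OF assms] by blast
qed (use LR_imp_pcf_le[OF assms] in blast)

text \<open>A term and its translation approximate each other, so either side of an approximation
  may be exchanged for its counterpart by transitivity.\<close>

lemma Tr_LR_iff:
  assumes "has_ty [] P \<alpha>" "has_ty [] P' \<alpha>"
  shows "(\<forall>k. LR \<alpha> k (Mc (Tr 0 P)) (Mc (Tr 0 P'))) \<longleftrightarrow> (\<forall>k. LR \<alpha> k (Tm P) (Tm P'))"
proof -
  have ty: "oty (Tm Q) \<alpha>" "oty (Mc (Tr 0 Q)) \<alpha>"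
    and le: "LR \<alpha> k (Tm Q) (Mc (Tr 0 Q))" and ge: "LR \<alpha> k (Mc (Tr 0 Q)) (Tm Q)"
    if "has_ty [] Q \<alpha>" for Q k
    using that Tr_ty[OF that] Tr_closed_sim[OF that, of True k] Tr_closed_sim[OF that, of False k]
    by (simp_all add: sim_def)
  note P = ty[OF assms(1)] and P' = ty[OF assms(2)]
  show ?thesis
  proof (intro iffI allI)
    fix k assume "\<forall>k. LR \<alpha> k (Mc (Tr 0 P)) (Mc (Tr 0 P'))"
    then have "LR \<alpha> k (Tm P) (Mc (Tr 0 P'))" for k
      using LR_trans[OF P(1,2) P'(2) le[OF assms(1)]] by blast
    then show "LR \<alpha> k (Tm P) (Tm P')"
      using LR_trans[OF P(1) P'(2,1) _ ge[OF assms(2)]] by blast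
  next
    fix k assume "\<forall>k. LR \<alpha> k (Tm P) (Tm P')"
    then have "LR \<alpha> k (Mc (Tr 0 P)) (Tm P')" for k
      using LR_trans[OF P(2,1) P'(1) ge[OF assms(1)]] by blast
    then show "LR \<alpha> k (Mc (Tr 0 P)) (Mc (Tr 0 P'))"
      using LR_trans[OF P(2) P'(1,2) _ le[OF assms(2)]] by blast
  qed
qed

lemma addr_eq_iff_LR:
  "(a, b) \<in> addr_eq \<alpha> \<longleftrightarrow> eam_ty (mach a) \<alpha> \<and> eam_ty (mach b) \<alpha> \<and>
     (\<forall>k. LR \<alpha> k (Mc (mach a)) (Mc (mach b))) \<and> (\<forall>k. LR \<alpha> k (Mc (mach b)) (Mc (mach a)))"
  unfolding addr_eq_def D_def using eam_eq_iff_LR by blast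

text \<open>Equal classes amount to related representatives only for an equivalence. Reflexivity and
  transitivity of the model's relation are not visible in its definition; they are inherited from
  \<open>LR\<close>.\<close>

lemma equiv_addr_eq: "equiv (D \<alpha>) (addr_eq \<alpha>)"
proof (rule equivI)
  show "addr_eq \<alpha> \<subseteq> D \<alpha> \<times> D \<alpha>" by (auto simp: addr_eq_def)
  show "refl_on (D \<alpha>) (addr_eq \<alpha>)"
    by (rule refl_onI) (simp add: addr_eq_iff_LR D_def LR_refl)
  show "sym (addr_eq \<alpha>)" by (rule symI) (simp add: addr_eq_iff_LR)
  show "trans (addr_eq \<alpha>)"
  proof (rule transI)
    fix a b c assume ab: "(a, b) \<in> addr_eq \<alpha>" and bc: "(b, c) \<in> addr_eq \<alpha>"
    have ty: "oty (Mc (mach a)) \<alpha>" "oty (Mc (mach b)) \<alpha>" "oty (Mc (mach c)) \<alpha>"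
      using ab bc by (auto simp: addr_eq_iff_LR)
    have "LR \<alpha> k (Mc (mach a)) (Mc (mach c))" "LR \<alpha> k (Mc (mach c)) (Mc (mach a))" for k
      using LR_trans[OF ty(1,2,3)] LR_trans[OF ty(3,2,1)] ab bc by (simp_all add: addr_eq_iff_LR)
    then show "(a, c) \<in> addr_eq \<alpha>" using ab bc by (simp add: addr_eq_iff_LR)
  qed
qed

lemma interp_eq_iff_obs_eq:
  assumes "has_ty [] P \<alpha>" "has_ty [] P' \<alpha>"
  shows "interp [] P \<alpha> = interp [] P' \<alpha> \<longleftrightarrow> obs_eq \<alpha> P P'"
proof -
  have ty: "eam_ty (Tr 0 P) \<alpha>" "eam_ty (Tr 0 P') \<alpha>"
    using Tr_ty[OF assms(1)] Tr_ty[OF assms(2)] by simp_all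
  then have "interp [] P \<alpha> = interp [] P' \<alpha> \<longleftrightarrow> (addr (Tr 0 P), addr (Tr 0 P')) \<in> addr_eq \<alpha>"
    using eq_equiv_class_iff[OF equiv_addr_eq, of "addr (Tr 0 P)" \<alpha> "addr (Tr 0 P')"]
    by (simp add: interp_def D_def)
  also have "\<dots> \<longleftrightarrow> (\<forall>k. LR \<alpha> k (Tm P) (Tm P')) \<and> (\<forall>k. LR \<alpha> k (Tm P') (Tm P))"
    using ty Tr_LR_iff[OF assms] Tr_LR_iff[OF assms(2,1)] by (simp add: addr_eq_iff_LR)
  also have "\<dots> \<longleftrightarrow> pcf_le \<alpha> P P' \<and> pcf_le \<alpha> P' P"
    using pcf_le_iff_LR assms by simp
  also have "\<dots> \<longleftrightarrow> obs_eq \<alpha> P P'"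
    unfolding pcf_le_def obs_eq_def by blast
  finally show ?thesis .
qed

end

theorem theorem5p20:
  fixes num :: "nat \<Rightarrow> 'a::countable"
    and addr :: "'a eam \<Rightarrow> 'a"
    and y :: 'a
    and \<alpha> :: ty
    and P P' :: tm
  assumes "address_table_map num addr y"
    and "has_ty [] P \<alpha>"
    and "has_ty [] P' \<alpha>"
  shows "address_table_map.interp num addr y [] P \<alpha> = address_table_map.interp num addr y [] P' \<alpha>
    \<longleftrightarrow> obs_eq \<alpha> P P'"
  using assms by (rule address_table_map.interp_eq_iff_obs_eq)

end
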